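(* For every $b>0$ there exist $0<c,\alpha<\infty$ such that for every positive integer $n$ there is a probability space on which are defined a Brownian bridge $B$ and a family of processes $\{S^{(n,z)}:z\in L_n\}$ (each $S^{(n,z)}$ having the law of simple random walk conditioned on $S_n=z$) such that for all $z\in L_n$ and all $r>0$, $$\mathbb{P}\{\Delta(n,z)>r\,c\log n\}\le c\,n^{\alpha-r}\,e^{bz^2/n}.$$
   Context: $S_n$ is simple random walk on $\mathbb{Z}$ started at $0$ (i.i.d. steps $\pm1$ with probability $1/2$), $L_n=\{z\in\mathbb{Z}:\mathbb{P}\{S_n=z\}>0\}$, and for $z\in L_n$, $(S^{(n,z)}_m)_{m=0}^n$ has the law of $(S_m)_{m=0}^n$ conditioned on $S_n=z$; it is extended to real times $0\le t\le n$ by linear interpolation. A (one-dimensional) Brownian bridge is $B_t=W_t-tW_1$, $0\le t\le1$, $W$ standard one-dimensional Brownian motion. Set $Y^{(n,z)}_t=\sqrt n\,B_{t/n}+\frac tn z$ for $0\le t\le n$, and $\Delta(n,z)=\sup_{0\le t\le n}|Y^{(n,z)}_t-S^{(n,z)}_t|$. *)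

theory Defs
  imports "HOL-Probability.Probability"
begin

text \<open>Simple random walk path of length n started at 0: steps xi_i, i<n, iid uniform on {-1,1};
  the path is m \<mapsto> sum of the first m steps (constant S_n for m \<ge> n).\<close>
definition srw_pmf :: "nat \<Rightarrow> (nat \<Rightarrow> int) pmf" where
  "srw_pmf n = map_pmf (\<lambda>\<xi> m. \<Sum>i<m. \<xi> i)
                 (Pi_pmf {..<n} 0 (\<lambda>_. pmf_of_set {-1, 1}))"

definition L :: "nat \<Rightarrow> int set" where
  "L n = {z. measure_pmf.prob (srw_pmf n) {S. S n = z} > 0}"

definition srw_cond_pmf :: "nat \<Rightarrow> int \<Rightarrow> (nat \<Rightarrow> int) pmf" where
  "srw_cond_pmf n z = cond_pmf (srw_pmf n) {S. S n = z}"

definition interp :: "(nat \<Rightarrow> int) \<Rightarrow> real \<Rightarrow> real" where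
  "interp S t = (1 - frac t) * real_of_int (S (nat \<lfloor>t\<rfloor>))
                + frac t * real_of_int (S (Suc (nat \<lfloor>t\<rfloor>)))"

definition brownian_motion :: "'a measure \<Rightarrow> (real \<Rightarrow> 'a \<Rightarrow> real) \<Rightarrow> bool" where
  "brownian_motion M W \<longleftrightarrow>
     (\<forall>t\<ge>0. W t \<in> borel_measurable M) \<and>
     (\<forall>\<omega>\<in>space M. W 0 \<omega> = 0) \<and>
     (\<forall>\<omega>\<in>space M. continuous_on {0..} (\<lambda>t. W t \<omega>)) \<and>
     (\<forall>s t. 0 \<le> s \<and> s < t \<longrightarrow>
        distributed M lborel (\<lambda>\<omega>. W t \<omega> - W s \<omega>) (normal_density 0 (sqrt (t - s)))) \<and>
     (\<forall>(k::nat) (ts::nat \<Rightarrow> real). 0 \<le> ts 0 \<and> strict_mono ts \<longrightarrow>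
        prob_space.indep_vars M (\<lambda>_. borel) (\<lambda>i \<omega>. W (ts (Suc i)) \<omega> - W (ts i) \<omega>) {..<k})"

definition brownian_bridge :: "'a measure \<Rightarrow> (real \<Rightarrow> 'a \<Rightarrow> real) \<Rightarrow> bool" where
  "brownian_bridge M B \<longleftrightarrow>
     (\<exists>W. brownian_motion M W \<and>
          (\<forall>t\<in>{0..1}. \<forall>\<omega>\<in>space M. B t \<omega> = W t \<omega> - t * W 1 \<omega>))"

definition Delta :: "nat \<Rightarrow> int \<Rightarrow> (real \<Rightarrow> 'a \<Rightarrow> real) \<Rightarrow> ('a \<Rightarrow> nat \<Rightarrow> int) \<Rightarrow> 'a \<Rightarrow> real" where
  "Delta n z B S \<omega> = (SUP t\<in>{0..real n}.
      \<bar>sqrt (real n) * B (t / real n) \<omega> + t / real n * real_of_int z - interp (S \<omega>) t\<bar>)"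

end

theory Submission
  imports Defs
begin

text \<open>The coupling is built by dyadic recursion. To couple bridges of length \<open>n\<close>, cut them at
  \<open>m = n div 2\<close> if \<open>n\<close> is even, and before the last step if \<open>n\<close> is odd. The value of the Brownian
  bridge at the cut is a Gaussian \<open>N\<close>, and conditionally on \<open>N\<close> the two parts are independent
  Brownian bridges, to which the coupling for shorter lengths applies; the value \<open>X\<close> of the walk at
  the cut is the monotone image of \<open>N\<close> under its conditional law.

  For the halving step a version of Tusnady's lemma bounds the error at the cut by
  \<open>C (1 + N^2 + z^2 / n)\<close>. Writing \<open>\<Delta>\<close> for the discrepancy and \<open>b = 1/16\<close>, the inductive claim
  \<open>E exp (a \<Delta>(n, z)) \<le> G n^\<alpha> exp (b z^2 / n)\<close> therefore survives: since \<open>X\<close> is close to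
  \<open>z/2 + sqrt n N / 2\<close>, the expectation of \<open>exp (b X^2 / (n/2))\<close> is at most a constant times
  \<open>exp (\<rho> b z^2 / n)\<close> with \<open>\<rho> < 1\<close>, which leaves room for the error at the cut when \<open>a\<close> is small,
  and every constant factor is absorbed by \<open>2^\<alpha>\<close>. Markov's inequality gives the tail bound for
  this \<open>b\<close>; as a probability that is at most \<open>A\<close> is also at most \<open>A^\<theta>\<close> for \<open>\<theta> \<le> 1\<close>, the bound
  holds for every \<open>b > 0\<close>.\<close>


section \<open>The Gaussian tail and monotone couplings\<close>

text \<open>Two features keep the recursion from blowing up. The error at the cut is added to the
  larger of the errors of the two parts, not to their sum; as exp of a maximum is at most the sum of
  the exps, the moments of the parts are added instead of multiplied, and a halving costs only a
  constant factor. Moreover the bridge is chosen before the endpoint: each part carries couplings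
  for all of its endpoints at once, so that \<open>X\<close> may depend on \<open>z\<close> while
  the Brownian bridge does not. The number 1/16 comes from a variance proxy. Given \<open>z\<close>,
  the midpoint is sub-Gaussian around \<open>z / 2\<close> with proxy \<open>m = n / 2\<close>, so
  even the doubled exponent \<open>X^2 / (8 m)\<close> has an exponential moment of at most
  \<open>2 exp (z^2 / (24 m))\<close>. The doubling is what AM-GM needs to separate this term from
  the error at the cut, on which it depends. All randomness is one sequence of independent
  Gaussians. It splits into one Gaussian and two sequences of the same law, so the probability space
  is the same at every stage.\<close>

abbreviation std_normal :: "real measure" where
  "std_normal \<equiv> std_normal_distribution"

lemma prob_space_std_normal: "prob_space std_normal"
  using real_dist_normal_dist real_distribution_def by blast

definition normal_tail :: "real \<Rightarrow> real" where
  "normal_tail x = measure std_normal {x..}"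

lemma measure_std_normal:
  assumes "A \<in> sets borel"
  shows "measure std_normal A = (\<integral>t. std_normal_density t * indicator A t \<partial>lborel)"
proof -
  interpret prob_space std_normal by (rule prob_space_std_normal)
  have "measure std_normal A = (\<integral>t. indicator A t \<partial>std_normal)"
    using assms by simp
  also have "\<dots> = (\<integral>t. std_normal_density t *\<^sub>R indicator A t \<partial>lborel)"
    by (rule integral_density) (use assms in auto)
  finally show ?thesis by simp
qed

lemma integrable_std_normal_indicator:
  assumes "A \<in> sets borel"
  shows "integrable lborel (\<lambda>t. std_normal_density t * indicator A t)"
  using assms by (intro integrable_real_mult_indicator) auto

lemma measure_std_normal_shift:
  assumes [measurable]: "A \<in> sets borel"
  shows "measure std_normal ((\<lambda>t. t - \<delta>) -` A) = (\<integral>t. std_normal_density (t + \<delta>) * indicator A t \<partial>lborel)"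
proof -
  have "(\<lambda>t. t - \<delta>) -` A \<in> sets borel"
    using measurable_sets_borel[of "\<lambda>t. t - \<delta>" borel A] by simp
  then have "measure std_normal ((\<lambda>t. t - \<delta>) -` A) = (\<integral>t. std_normal_density t * indicator ((\<lambda>t. t - \<delta>) -` A) t \<partial>lborel)"
    by (rule measure_std_normal)
  also have "\<dots> = (\<integral>t. std_normal_density (\<delta> + 1 * t) * indicator ((\<lambda>t. t - \<delta>) -` A) (\<delta> + 1 * t) \<partial>lborel)"
    by (subst lborel_integral_real_affine[where c=1 and t=\<delta>]) auto
  also have "\<dots> = (\<integral>t. std_normal_density (t + \<delta>) * indicator A t \<partial>lborel)"
    by (intro Bochner_Integration.integral_cong) (auto simp: indicator_def add.commute)
  finally show ?thesis .
qed

lemma integrable_std_normal_shift: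
  assumes [measurable]: "A \<in> sets borel"
  shows "integrable lborel (\<lambda>t. std_normal_density (t + \<delta>) * indicator A t)"
proof -
  have "(\<lambda>t. t - \<delta>) -` A \<in> sets borel"
    using measurable_sets_borel[of "\<lambda>t. t - \<delta>" borel A] by simp
  then have "integrable lborel (\<lambda>t. std_normal_density t * indicator ((\<lambda>t. t - \<delta>) -` A) t)"
    by (rule integrable_std_normal_indicator)
  then have "integrable lborel (\<lambda>t. std_normal_density (\<delta> + 1 * t) * indicator ((\<lambda>t. t - \<delta>) -` A) (\<delta> + 1 * t))"
    by (subst lborel_integrable_real_affine_iff) auto
  then show ?thesis
    by (rule back_subst[of "integrable lborel"]) (auto simp: indicator_def add.commute)
qed

lemma std_normal_density_shift:
  "std_normal_density (t + \<delta>) = std_normal_density t * exp (- \<delta> * t - \<delta>\<^sup>2 / 2)"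
  unfolding std_normal_density_def
  by (simp add: exp_add[symmetric] power2_eq_square field_simps)

lemma normal_tail_diff:
  assumes "x \<le> y"
  shows "normal_tail x - normal_tail y = measure std_normal {x..<y}"
proof -
  interpret prob_space std_normal by (rule prob_space_std_normal)
  have "{x..} = {x..<y} \<union> {y..}" using assms by auto
  then have "normal_tail x = measure std_normal {x..<y} + normal_tail y"
    unfolding normal_tail_def by (subst finite_measure_Union[symmetric]) auto
  then show ?thesis by simp
qed

text \<open>Translating the second cell onto the first multiplies the density by
  \<open>exp (- \<delta> * t - \<delta>^2 / 2)\<close>, which is monotone in \<open>t\<close>; the
  two bounds take its values at the ends of the first cell. They are matched below with ratios of
  consecutive hypergeometric weights.\<close>

lemma normal_tail_cell_ratio:
  fixes x \<delta> :: real
  assumes "\<delta> \<ge> 0"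
  shows "normal_tail (x + \<delta>) - normal_tail (x + 2 * \<delta>)
           \<le> exp (- \<delta> * x - \<delta>\<^sup>2 / 2) * (normal_tail x - normal_tail (x + \<delta>))"
    and "exp (- \<delta> * x - 3 * \<delta>\<^sup>2 / 2) * (normal_tail x - normal_tail (x + \<delta>))
           \<le> normal_tail (x + \<delta>) - normal_tail (x + 2 * \<delta>)"
proof -
  have 1: "normal_tail x - normal_tail (x + \<delta>) = (\<integral>t. std_normal_density t * indicator {x..<x+\<delta>} t \<partial>lborel)"
    using assms by (simp add: normal_tail_diff measure_std_normal)
  have "(\<lambda>t. t - \<delta>) -` {x..<x+\<delta>} = {x+\<delta>..<x+2*\<delta>}" by auto
  then have 2: "normal_tail (x + \<delta>) - normal_tail (x + 2 * \<delta>)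
      = (\<integral>t. std_normal_density (t + \<delta>) * indicator {x..<x+\<delta>} t \<partial>lborel)"
    using assms by (simp add: normal_tail_diff flip: measure_std_normal_shift)
  have [simp]: "integrable lborel (\<lambda>t. c * (std_normal_density t * indicator {x..<x+\<delta>} t))" for c
    using integrable_std_normal_indicator[of "{x..<x+\<delta>}"] by (intro integrable_mult_right) simp
  show "normal_tail (x + \<delta>) - normal_tail (x + 2 * \<delta>)
           \<le> exp (- \<delta> * x - \<delta>\<^sup>2 / 2) * (normal_tail x - normal_tail (x + \<delta>))"
    unfolding 1 2 integral_mult_right_zero[symmetric]
  proof (intro integral_mono integrable_std_normal_shift)
    fix t
    have "std_normal_density t * exp (- \<delta> * t - \<delta>\<^sup>2 / 2) \<le> std_normal_density t * exp (- \<delta> * x - \<delta>\<^sup>2 / 2)" if "x \<le> t"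
      using mult_left_mono[OF that assms] by (intro mult_left_mono) simp_all
    then show "std_normal_density (t + \<delta>) * indicator {x..<x+\<delta>} t
        \<le> exp (- \<delta> * x - \<delta>\<^sup>2 / 2) * (std_normal_density t * indicator {x..<x+\<delta>} t)"
      unfolding std_normal_density_shift by (simp add: indicator_def mult.commute)
  qed (use integrable_std_normal_indicator in simp_all)
  have *: "- \<delta> * x - 3 * \<delta>\<^sup>2 / 2 \<le> - \<delta> * t - \<delta>\<^sup>2 / 2" if "t \<le> x + \<delta>" for t
    using mult_left_mono[OF that assms] by (simp add: power2_eq_square algebra_simps)
  show "exp (- \<delta> * x - 3 * \<delta>\<^sup>2 / 2) * (normal_tail x - normal_tail (x + \<delta>))
           \<le> normal_tail (x + \<delta>) - normal_tail (x + 2 * \<delta>)"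
    unfolding 1 2 integral_mult_right_zero[symmetric]
  proof (intro integral_mono integrable_std_normal_shift)
    fix t
    have "std_normal_density t * exp (- \<delta> * x - 3 * \<delta>\<^sup>2 / 2) \<le> std_normal_density t * exp (- \<delta> * t - \<delta>\<^sup>2 / 2)" if "t \<le> x + \<delta>"
      using *[OF that] by (intro mult_left_mono) simp_all
    then show "exp (- \<delta> * x - 3 * \<delta>\<^sup>2 / 2) * (std_normal_density t * indicator {x..<x+\<delta>} t)
        \<le> std_normal_density (t + \<delta>) * indicator {x..<x+\<delta>} t"
      unfolding std_normal_density_shift by (simp add: indicator_def mult.commute)
  qed (use integrable_std_normal_indicator in simp_all)
qed

lemma normal_tail_antimono: "x \<le> y \<Longrightarrow> normal_tail y \<le> normal_tail x"
  using normal_tail_diff[of x y] measure_nonneg[of std_normal "{x..<y}"] by linarith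

text \<open>The density decreases on the positive axis. This lower bound for a short cell will later
  outweigh a whole far tail.\<close>

lemma normal_tail_diff_ge:
  assumes "0 \<le> x" "0 \<le> \<eta>"
  shows "\<eta> * std_normal_density (x + \<eta>) \<le> normal_tail x - normal_tail (x + \<eta>)"
proof -
  have "\<eta> * std_normal_density (x + \<eta>) = (\<integral>t. std_normal_density (x + \<eta>) * indicator {x..<x+\<eta>} t \<partial>lborel)"
    using assms by simp
  also have "\<dots> \<le> (\<integral>t. std_normal_density t * indicator {x..<x+\<eta>} t \<partial>lborel)"
  proof (intro integral_mono integrable_std_normal_indicator)
    show "integrable lborel (\<lambda>t. std_normal_density (x + \<eta>) * indicator {x..<x+\<eta>} t)"
      using assms by (intro integrable_mult_right integrable_real_indicator) simp_all
    fix t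
    show "std_normal_density (x + \<eta>) * indicator {x..<x+\<eta>} t \<le> std_normal_density t * indicator {x..<x+\<eta>} t"
      using assms power_mono[of t "x + \<eta>" 2] unfolding std_normal_density_def
      by (auto simp: indicator_def intro!: divide_right_mono)
  qed simp
  also have "\<dots> = normal_tail x - normal_tail (x + \<eta>)"
    using assms by (simp add: normal_tail_diff measure_std_normal)
  finally show ?thesis .
qed

lemma normal_tail_less:
  assumes "x < y"
  shows "normal_tail y < normal_tail x"
proof -
  have "0 < (\<integral>t. std_normal_density t * indicator {x..<y} t \<partial>lborel)"
  proof (rule ccontr)
    assume "\<not> ?thesis"
    moreover have "0 \<le> (\<integral>t. std_normal_density t * indicator {x..<y} t \<partial>lborel)"
      by (rule Bochner_Integration.integral_nonneg) simp
    ultimately have "(\<integral>t. std_normal_density t * indicator {x..<y} t \<partial>lborel) = 0"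
      by linarith
    then have "AE t in lborel. std_normal_density t * indicator {x..<y} t = 0"
      by (subst (asm) integral_nonneg_eq_0_iff_AE) (auto intro!: integrable_std_normal_indicator)
    then have "AE t in lborel. t \<notin> {x..<y}"
      by eventually_elim (auto simp: indicator_def normal_density_pos[THEN less_imp_neq, symmetric] dest: split: if_splits)
    then have "emeasure lborel {x..<y} = 0"
      by (subst (asm) AE_iff_measurable[of "{x..<y}"]) auto
    then show False using assms by simp
  qed
  then show ?thesis using normal_tail_diff[of x y] assms by (simp add: measure_std_normal)
qed

lemma normal_tail_le_1: "normal_tail x \<le> 1"
  unfolding normal_tail_def using prob_space.prob_le_1[OF prob_space_std_normal] by blast

lemma normal_tail_pos: "0 < normal_tail x"
  using normal_tail_less[of x "x+1"] measure_nonneg[of std_normal "{x+1..}"]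
  unfolding normal_tail_def by linarith

text \<open>Shifted by \<open>y\<close>, the density carries the factor
  \<open>exp (- y * t - y^2 / 2)\<close>, which is at most \<open>exp (- y^2 / 2)\<close> for
  \<open>t \<ge> 0\<close>.\<close>

lemma normal_tail_le_exp:
  assumes "0 \<le> y"
  shows "normal_tail y \<le> exp (- y\<^sup>2 / 2)"
proof -
  have eq: "(\<lambda>t. t - y) -` {0..} = {y..}" by auto
  have "normal_tail y = (\<integral>t. std_normal_density (t + y) * indicator {0..} t \<partial>lborel)"
    unfolding normal_tail_def using measure_std_normal_shift[of "{0..}" y] eq by simp
  also have "\<dots> \<le> (\<integral>t. exp (- y\<^sup>2 / 2) * (std_normal_density t * indicator {0..} t) \<partial>lborel)"
    using assms
    by (intro integral_mono integrable_std_normal_shift integrable_mult_right integrable_std_normal_indicator)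
       (auto simp: std_normal_density_shift indicator_def mult.commute intro!: mult_left_mono)
  also have "\<dots> = exp (- y\<^sup>2 / 2) * normal_tail 0"
    by (simp add: normal_tail_def measure_std_normal)
  also have "\<dots> \<le> exp (- y\<^sup>2 / 2)"
    using normal_tail_le_1[of 0] by simp
  finally show ?thesis .
qed

lemma measure_std_normal_singleton: "measure std_normal {x} = 0"
proof -
  have "(\<integral>t. std_normal_density t * indicator {x} t \<partial>lborel) = (\<integral>t. 0 \<partial>(lborel :: real measure))"
    by (intro integral_cong_AE) (auto intro!: AE_I[where N="{x}"] simp: indicator_def)
  then show ?thesis by (subst measure_std_normal) auto
qed

lemma normal_tail_eq_cdf: "normal_tail x = 1 - cdf std_normal x"
proof -
  interpret prob_space std_normal by (rule prob_space_std_normal)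
  have "measure std_normal {..x} = measure std_normal {..<x} + measure std_normal {x}"
    by (subst finite_measure_Union[symmetric]) (auto intro!: arg_cong[where f="measure std_normal"])
  moreover have "measure std_normal (UNIV - {x..}) = 1 - measure std_normal {x..}"
    using prob_compl[of "{x..}"] by simp
  moreover have "UNIV - {x..} = {..<x}" by auto
  ultimately show ?thesis
    by (simp add: normal_tail_def cdf_def measure_std_normal_singleton)
qed

lemma normal_tail_minus: "normal_tail (- x) = 1 - normal_tail x"
proof -
  have "normal_tail (- x) = (\<integral>t. std_normal_density t * indicator {-x..} t \<partial>lborel)"
    by (simp add: normal_tail_def measure_std_normal)
  also have "\<dots> = (\<integral>t. std_normal_density (0 + (-1) * t) * indicator {-x..} (0 + (-1) * t) \<partial>lborel)"
    by (subst lborel_integral_real_affine[where c="-1" and t=0]) auto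
  also have "\<dots> = (\<integral>t. std_normal_density t * indicator {..x} t \<partial>lborel)"
    by (intro Bochner_Integration.integral_cong) (auto simp: indicator_def std_normal_density_def)
  also have "\<dots> = cdf std_normal x" by (simp add: cdf_def measure_std_normal)
  finally show ?thesis using normal_tail_eq_cdf[of x] by simp
qed

lemma normal_tail_0: "normal_tail 0 = 1 / 2"
  using normal_tail_minus[of 0] by simp

text \<open>The probability integral transform: \<open>normal_tail\<close> of a standard Gaussian is
  uniform on the unit interval. The law has no atoms, so every level strictly between 0 and 1 is
  attained and the set is a half-line.\<close>

lemma measure_normal_tail_le:
  assumes "0 \<le> u" "u \<le> 1"
  shows "measure std_normal {g. normal_tail g \<le> u} = u"
proof (cases "u = 0 \<or> u = 1")
  case True
  then show ?thesis
    using normal_tail_pos normal_tail_le_1 prob_space.prob_space[OF prob_space_std_normal]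
    by (auto simp: not_le[symmetric])
next
  case False
  interpret real_distribution std_normal by (rule real_dist_normal_dist)
  have cont: "isCont (cdf std_normal) x" for x
    using measure_std_normal_singleton by (simp add: isCont_cdf)
  have "\<forall>\<^sub>F x in at_top. cdf std_normal x > 1 - u"
    using cdf_lim_at_top_prob by (rule order_tendstoD) (use False assms in auto)
  then obtain r where r: "cdf std_normal r > 1 - u"
    by (auto simp: eventually_at_top_linorder)
  have "\<forall>\<^sub>F x in at_bot. cdf std_normal x < 1 - u"
    using cdf_lim_at_bot by (rule order_tendstoD) (use False assms in auto)
  then obtain l where l: "cdf std_normal l < 1 - u"
    by (auto simp: eventually_at_bot_linorder)
  have "l \<le> r"
    using cdf_nondecreasing[of r l] l r by linarith
  then obtain g where "cdf std_normal g = 1 - u"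
    using IVT[of "cdf std_normal" l "1 - u" r] l r cont by auto
  then have g: "normal_tail g = u" by (simp add: normal_tail_eq_cdf)
  then have "{x. normal_tail x \<le> u} = {g..}"
    using normal_tail_antimono[of g] normal_tail_less[of _ g] by (auto simp: not_le[symmetric] intro: leI)

  then show ?thesis using g by (simp add: normal_tail_def)
qed

text \<open>Completing the square: with \<open>v = 1 - 2 * s\<close> the integrand is a multiple of
  the normal density of mean \<open>t / v\<close> and variance \<open>1 / v\<close>.\<close>

lemma std_normal_exp_quadratic:
  fixes s t :: real
  assumes "s < 1 / 2"
  shows "(\<integral>\<^sup>+g. ennreal (exp (t * g + s * g\<^sup>2)) \<partial>std_normal) = ennreal (exp (t\<^sup>2 / (2 * (1 - 2 * s))) / sqrt (1 - 2 * s))"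
proof -
  define v where "v = 1 - 2 * s"
  have v: "v > 0" using assms by (simp add: v_def)
  have eq: "std_normal_density g * exp (t * g + s * g\<^sup>2)
      = exp (t\<^sup>2 / (2 * v)) / sqrt v * normal_density (t / v) (1 / sqrt v) g" for g
  proof -
    have "- g\<^sup>2 / 2 + (t * g + s * g\<^sup>2) = t\<^sup>2 / (2 * v) + - (g - t / v)\<^sup>2 / (2 * (1 / sqrt v)\<^sup>2)"
    proof -
      have s: "s = (1 - v) / 2" by (simp add: v_def)
      show ?thesis using v unfolding s by (simp add: power_divide power2_diff field_simps power2_eq_square)
    qed
    then have "exp (- g\<^sup>2 / 2) * exp (t * g + s * g\<^sup>2) = exp (t\<^sup>2 / (2 * v)) * exp (- (g - t / v)\<^sup>2 / (2 * (1 / sqrt v)\<^sup>2))"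
      by (simp flip: exp_add)
    moreover have "sqrt (2 * pi * (1 / sqrt v)\<^sup>2) = sqrt (2 * pi) / sqrt v"
      using v by (simp add: power_divide real_sqrt_divide)
    ultimately show ?thesis
      unfolding std_normal_density_def normal_density_def using v by (simp add: field_simps)
  qed
  have "(\<integral>\<^sup>+g. ennreal (exp (t * g + s * g\<^sup>2)) \<partial>std_normal) = (\<integral>\<^sup>+g. ennreal (std_normal_density g) * ennreal (exp (t * g + s * g\<^sup>2)) \<partial>lborel)"
    by (subst nn_integral_density) auto
  also have "\<dots> = (\<integral>\<^sup>+g. ennreal (exp (t\<^sup>2 / (2 * v)) / sqrt v) * ennreal (normal_density (t / v) (1 / sqrt v) g) \<partial>lborel)"
    using v by (intro nn_integral_cong) (simp add: eq flip: ennreal_mult)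
  also have "\<dots> = ennreal (exp (t\<^sup>2 / (2 * v)) / sqrt v) * (\<integral>\<^sup>+g. ennreal (normal_density (t / v) (1 / sqrt v) g) \<partial>lborel)"
    by (rule nn_integral_cmult) simp
  also have "(\<integral>\<^sup>+g. ennreal (normal_density (t / v) (1 / sqrt v) g) \<partial>lborel) = 1"
    using v by (subst nn_integral_eq_integral) auto
  finally show ?thesis by (simp add: v_def)
qed

text \<open>The quantile transform, stated through upper tails as a Galois connection, so that
  estimates of tails turn directly into estimates of \<open>q g\<close>. Membership in the support
  holds for every \<open>g\<close>, on which the pointwise construction of paths relies.\<close>

definition monotone_coupling :: "int pmf \<Rightarrow> (real \<Rightarrow> int) \<Rightarrow> bool" where
  "monotone_coupling p q \<longleftrightarrow> q \<in> measurable borel (count_space UNIV) \<and>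
     (\<forall>g. q g \<in> set_pmf p) \<and>
     (\<forall>g d. d \<le> q g \<longleftrightarrow> normal_tail g \<le> measure_pmf.prob p {d..}) \<and>
     distr std_normal (count_space UNIV) q = measure_pmf p"

lemma exists_monotone_coupling:
  assumes fin: "finite (set_pmf p)"
  shows "\<exists>q. monotone_coupling p q"
proof -
  define A where "A g = {d \<in> set_pmf p. normal_tail g \<le> measure_pmf.prob p {d..}}" for g
  define q where "q g = Max (A g)" for g
  have finA: "finite (A g)" for g using fin by (simp add: A_def)
  have neA: "A g \<noteq> {}" for g
  proof -
    have "Min (set_pmf p) \<in> set_pmf p" using fin set_pmf_not_empty by (rule Min_in)
    moreover have "measure_pmf.prob p {Min (set_pmf p)..} = 1"
      using fin by (subst measure_pmf.prob_eq_1) (auto simp: AE_measure_pmf_iff)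
    ultimately show ?thesis using normal_tail_le_1[of g] by (auto simp: A_def)
  qed
  have qA: "q g \<in> A g" for g unfolding q_def using finA neA by (rule Max_in)
  have iff: "d \<le> q g \<longleftrightarrow> normal_tail g \<le> measure_pmf.prob p {d..}" for g d
  proof
    assume "d \<le> q g"
    then have "measure_pmf.prob p {q g..} \<le> measure_pmf.prob p {d..}"
      by (intro measure_pmf.finite_measure_mono) auto
    with qA[of g] show "normal_tail g \<le> measure_pmf.prob p {d..}" by (simp add: A_def)
  next
    assume le: "normal_tail g \<le> measure_pmf.prob p {d..}"
    then have "measure_pmf.prob p {d..} \<noteq> 0" using normal_tail_pos[of g] by simp
    then have ne: "set_pmf p \<inter> {d..} \<noteq> {}"
      by (metis measure_pmf_zero_iff)
    \<comment> \<open>The maximum defining \<open>q\<close> ranges over atoms only, so the threshold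
      \<open>d\<close> is replaced by the smallest atom that is at least \<open>d\<close>; the tail
      does not change.\<close>
    define e where "e = Min (set_pmf p \<inter> {d..})"
    have e: "e \<in> set_pmf p \<inter> {d..}" unfolding e_def using fin ne by (intro Min_in) auto
    have "x \<in> {d..} \<longleftrightarrow> x \<in> {e..}" if "x \<in> set_pmf p" for x
      using that e Min_le[of "set_pmf p \<inter> {d..}" x] fin by (auto simp: e_def)
    then have "measure_pmf.prob p {d..} = measure_pmf.prob p {e..}"
      by (intro measure_pmf.finite_measure_eq_AE) (auto simp: AE_measure_pmf_iff)
    with le e have "e \<in> A g" by (simp add: A_def)
    then have "e \<le> q g" unfolding q_def using finA by (intro Max_ge) auto
    with e show "d \<le> q g" by auto
  qed
  have ge_set: "{g. d \<le> q g} \<in> sets borel" for d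
  proof -
    have "is_interval {g. normal_tail g \<le> measure_pmf.prob p {d..}}"
      unfolding is_interval_1 by (auto intro: order_trans[OF normal_tail_antimono])
    then show ?thesis by (simp add: iff real_interval_borel_measurable)
  qed
  have vim: "q -` {d} = {g. d \<le> q g} - {g. d + 1 \<le> q g}" for d by auto
  have meas: "q \<in> measurable borel (count_space UNIV)"
    by (subst measurable_count_space_eq2_countable) (auto simp: vim ge_set)
  have ms: "measure std_normal (q -` {d}) = pmf p d" for d
  proof -
    interpret prob_space std_normal by (rule prob_space_std_normal)
    have "measure std_normal (q -` {d}) = measure std_normal {g. d \<le> q g} - measure std_normal {g. d + 1 \<le> q g}"
      unfolding vim by (rule finite_measure_Diff) (use ge_set in auto)
    also have "\<dots> = measure_pmf.prob p {d..} - measure_pmf.prob p {d+1..}"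
      by (simp add: iff measure_normal_tail_le)
    also have "{d..} = {d} \<union> {d+1..}" by auto
    also have "measure_pmf.prob p ({d} \<union> {d+1..}) = measure_pmf.prob p {d} + measure_pmf.prob p {d+1..}"
      by (rule measure_pmf.finite_measure_Union) auto
    finally show ?thesis by (simp add: measure_pmf_single)
  qed
  have "distr std_normal (count_space UNIV) q = measure_pmf p"
  proof (rule measure_eqI_countable[where A=UNIV])
    fix d :: int
    interpret prob_space std_normal by (rule prob_space_std_normal)
    have "emeasure (distr std_normal (count_space UNIV) q) {d} = emeasure std_normal (q -` {d})"
      using meas by (subst emeasure_distr) auto
    also have "\<dots> = emeasure (measure_pmf p) {d}"
      by (simp add: emeasure_eq_measure ms emeasure_pmf_single)
    finally show "emeasure (distr std_normal (count_space UNIV) q) {d} = emeasure (measure_pmf p) {d}" .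
  qed auto
  moreover have "q g \<in> set_pmf p" for g using qA[of g] unfolding A_def by blast
  ultimately have "monotone_coupling p q" unfolding monotone_coupling_def using meas iff by blast
  then show ?thesis by blast
qed

section \<open>Tusnady's lemma for random walk bridges\<close>

text \<open>If \<open>p / c\<close> is nonincreasing, then
  \<open>p j * c i' \<le> p i' * c j\<close> for all \<open>i' \<le> j\<close>, and summing over the
  pairs on the two sides of the cut \<open>i\<close> gives the claim. This carries comparisons of
  consecutive ratios over to tails without any normalising constant.\<close>

lemma likelihood_ratio_tail:
  fixes p c :: "nat \<Rightarrow> real"
  assumes c: "\<And>j. a \<le> j \<Longrightarrow> j < J \<Longrightarrow> 0 < c j"
    and p: "\<And>j. a \<le> j \<Longrightarrow> j < J \<Longrightarrow> 0 \<le> p j"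
    and step: "\<And>j. a \<le> j \<Longrightarrow> Suc j < J \<Longrightarrow> p (Suc j) * c j \<le> p j * c (Suc j)"
  shows "sum p {i..<J} * sum c {a..<i} \<le> sum p {a..<i} * sum c {i..<J}"
proof -
  have *: "p j * c i' \<le> p i' * c j" if "a \<le> i'" "i' \<le> j" "j < J" for i' j
    using that(2,1,3)
  proof (induction j rule: dec_induct)
    case base
    then show ?case by simp
  next
    case (step j)
    have "(p (Suc j) * c i') * c j \<le> (p i' * c (Suc j)) * c j"
    proof -
      have "p (Suc j) * c j * c i' \<le> p j * c (Suc j) * c i'"
        using step assms(3)[of j] c[of i'] by (intro mult_right_mono) auto
      also have "\<dots> = p j * c i' * c (Suc j)" by simp
      also have "\<dots> \<le> p i' * c j * c (Suc j)"
        using step c[of "Suc j"] by (intro mult_right_mono) auto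
      finally show ?thesis by (simp add: mult_ac)
    qed
    then show ?case using c[of j] step by (simp add: mult_le_cancel_right)
  qed
  have "sum p {i..<J} * sum c {a..<i} = (\<Sum>j\<in>{i..<J}. \<Sum>i'\<in>{a..<i}. p j * c i')"
    by (simp add: sum_product)
  also have "\<dots> \<le> (\<Sum>j\<in>{i..<J}. \<Sum>i'\<in>{a..<i}. p i' * c j)"
    by (intro sum_mono *) auto
  also have "\<dots> = sum p {a..<i} * sum c {i..<J}"
    by (subst sum.swap) (simp add: sum_product)
  finally show ?thesis .
qed

text \<open>Up to normalisation, the probability that a walk bridge of length \<open>2 m\<close> from 0 to \<open>2 (l - m)\<close>
  passes through \<open>2 k - m\<close> at time \<open>m\<close>. Its deviation from the mean \<open>l - m\<close> is \<open>2 k - l\<close>.\<close>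

definition hyp_weight :: "nat \<Rightarrow> nat \<Rightarrow> nat \<Rightarrow> real" where
  "hyp_weight m l k = (if k \<le> l then real (m choose k) * real (m choose (l - k)) else 0)"

lemma hyp_weight_nonneg [simp]: "0 \<le> hyp_weight m l k"
  by (simp add: hyp_weight_def)

lemma hyp_weight_pos_iff: "0 < hyp_weight m l k \<longleftrightarrow> k \<le> l \<and> k \<le> m \<and> l - k \<le> m"
  by (auto simp: hyp_weight_def zero_less_mult_iff)

lemma hyp_weight_sym: "k \<le> l \<Longrightarrow> hyp_weight m l (l - k) = hyp_weight m l k"
  by (simp add: hyp_weight_def)

lemma hyp_weight_sum: "sum (hyp_weight m l) {..l} = real (2 * m choose l)"
proof -
  have "sum (hyp_weight m l) {..l} = real (\<Sum>k\<le>l. (m choose k) * (m choose (l - k)))"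
    by (simp add: hyp_weight_def)
  then show ?thesis by (simp add: vandermonde mult_2)
qed

section \<open>Ratios of consecutive hypergeometric weights\<close>

lemma real_choose_Suc: "real (m choose Suc k) * (real k + 1) = real (m choose k) * (real m - real k)"
proof (cases "k \<le> m")
  case True
  have "(m choose Suc k) * Suc k = (m choose k) * (m - k)"
    by (metis binomial_absorb_comp binomial_absorption mult.commute)
  then have "real ((m choose Suc k) * Suc k) = real ((m choose k) * (m - k))" by simp
  with True show ?thesis by (simp add: of_nat_diff algebra_simps)
qed (simp add: binomial_eq_0)

text \<open>Centred coordinates: \<open>e\<close> is the mean of the deviations at \<open>k\<close>
  and \<open>k + 1\<close>, \<open>w\<close> is half the endpoint of the walk bridge, and the
  factors on the two sides differ only in the sign of \<open>e\<close>. The product form stays valid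
  where weights vanish.\<close>

lemma hyp_weight_Suc:
  fixes m l k :: nat
  defines "M \<equiv> real m + 1" and "e \<equiv> 2 * real k - real l + 1" and "w \<equiv> real l - real m"
  shows "hyp_weight m l (Suc k) * ((M + e)\<^sup>2 - w\<^sup>2) = hyp_weight m l k * ((M - e)\<^sup>2 - w\<^sup>2)"
proof -
  have 1: "(M + e)\<^sup>2 - w\<^sup>2 = 4 * ((real k + 1) * (real m + real k + 1 - real l))"
    unfolding M_def e_def w_def by (simp add: power2_eq_square algebra_simps)
  have 2: "(M - e)\<^sup>2 - w\<^sup>2 = 4 * ((real m - real k) * (real l - real k))"
    unfolding M_def e_def w_def by (simp add: power2_eq_square algebra_simps)
  show ?thesis
  proof (cases "k < l")
    case True
    define j where "j = l - Suc k"
    have j: "l - k = Suc j" "real l = real j + real k + 1" using True by (auto simp: j_def)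
    have "hyp_weight m l (Suc k) * ((real k + 1) * (real m + real k + 1 - real l))
       = (real (m choose Suc k) * (real k + 1)) * (real (m choose j) * (real m - real j))"
    proof -
      have "hyp_weight m l (Suc k) = real (m choose Suc k) * real (m choose j)"
        using True by (simp add: hyp_weight_def j_def)
      moreover have "real m + real k + 1 - real l = real m - real j" using j(2) by simp
      ultimately show ?thesis by (simp only: mult_ac)
    qed
    also have "\<dots> = (real (m choose k) * (real m - real k)) * (real (m choose Suc j) * (real j + 1))"
      by (simp add: real_choose_Suc)
    also have "\<dots> = hyp_weight m l k * ((real m - real k) * (real l - real k))"
      using True j by (simp add: hyp_weight_def)
    finally show ?thesis unfolding 1 2 by simp
  next
    case False
    then show ?thesis unfolding 1 2 by (auto simp: hyp_weight_def)
  qed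
qed

text \<open>For \<open>a < 1\<close> this bounds \<open>ln ((1 + a) / (1 - a))\<close> from below by
  \<open>2 * a\<close>; the next lemma bounds it from above by \<open>2 * (y + y ^ 3)\<close> for
  arguments up to 1/2.\<close>

lemma one_minus_le_exp_one_plus:
  fixes a :: real
  assumes "0 \<le> a"
  shows "1 - a \<le> exp (- 2 * a) * (1 + a)"
proof -
  have "(\<lambda>a. exp (- 2 * a) * (1 + a) - (1 - a)) 0 \<le> (\<lambda>a. exp (- 2 * a) * (1 + a) - (1 - a)) a"
  proof (rule DERIV_nonneg_imp_nondecreasing[OF assms])
    fix x :: real assume x: "0 \<le> x" "x \<le> a"
    have "(1 + 2 * x) * exp (- 2 * x) \<le> exp (2 * x) * exp (- 2 * x)"
      using exp_ge_add_one_self[of "2 * x"] by (intro mult_right_mono) auto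
    then have "0 \<le> exp (- 2 * x) * (- 2) * (1 + x) + exp (- 2 * x) + 1"
      by (simp add: exp_minus field_simps)
    moreover have "((\<lambda>a. exp (- 2 * a) * (1 + a) - (1 - a)) has_real_derivative
        exp (- 2 * x) * (- 2) * (1 + x) + exp (- 2 * x) + 1) (at x)"
      by (auto intro!: derivative_eq_intros)
    ultimately show "\<exists>y. ((\<lambda>a. exp (- 2 * a) * (1 + a) - (1 - a)) has_real_derivative y) (at x) \<and> 0 \<le> y"
      by blast
  qed
  then show ?thesis by simp
qed

lemma exp_le_one_minus_over_one_plus:
  fixes y :: real
  assumes "0 \<le> y" "y \<le> 1 / 2"
  shows "exp (- 2 * (y + y ^ 3)) * (1 + y) \<le> 1 - y"
proof -
  have "(\<lambda>y. 2 * (y + y ^ 3) - ln (1 + y) + ln (1 - y)) 0 \<le> (\<lambda>y. 2 * (y + y ^ 3) - ln (1 + y) + ln (1 - y)) y"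
  proof (rule DERIV_nonneg_imp_nondecreasing[OF assms(1)])
    fix x :: real assume x: "0 \<le> x" "x \<le> y"
    then have x2: "x\<^sup>2 \<le> 1 / 4" using assms power_mono[of x "1/2" 2] by (simp add: power2_eq_square)
    have "1 \<le> (1 + 3 * x\<^sup>2) * (1 - x\<^sup>2)"
    proof -
      have "0 \<le> x\<^sup>2 * (2 - 3 * x\<^sup>2)" using x2 by (intro mult_nonneg_nonneg) auto
      then show ?thesis by (simp add: algebra_simps)
    qed
    then have "2 / (1 - x\<^sup>2) \<le> 2 + 6 * x\<^sup>2" using x2 by (simp add: divide_le_eq algebra_simps)
    moreover have "1 / (1 + x) + 1 / (1 - x) = 2 / (1 - x\<^sup>2)"
      using x assms by (simp add: field_simps power2_eq_square)
    ultimately have "0 \<le> 2 * (1 + 3 * x\<^sup>2) - 1 / (1 + x) + - 1 / (1 - x)" by simp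
    moreover have "((\<lambda>y. 2 * (y + y ^ 3) - ln (1 + y) + ln (1 - y)) has_real_derivative
        2 * (1 + 3 * x\<^sup>2) - 1 / (1 + x) + - 1 / (1 - x)) (at x)"
      using x assms by (auto intro!: derivative_eq_intros simp: power2_eq_square divide_simps)
    ultimately show "\<exists>z. ((\<lambda>y. 2 * (y + y ^ 3) - ln (1 + y) + ln (1 - y)) has_real_derivative z) (at x) \<and> 0 \<le> z"
      by blast
  qed
  then have "- 2 * (y + y ^ 3) + ln (1 + y) \<le> ln (1 - y)" by simp
  then have "exp (- 2 * (y + y ^ 3) + ln (1 + y)) \<le> exp (ln (1 - y))" by (rule iffD2[OF exp_le_cancel_iff])
  then show ?thesis using assms by (simp add: exp_add)
qed

text \<open>To the right of the centre the numerator is below the denominator, so subtracting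
  \<open>w^2\<close> from both only decreases the quotient. What remains is the square of
  \<open>(1 - a) / (1 + a)\<close> with \<open>a = e / M\<close>; hence the bound is uniform in the
  endpoint.\<close>

lemma hyp_weight_Suc_le:
  assumes l: "l \<le> 2 * m" and e: "l \<le> 2 * k + 1"
  shows "hyp_weight m l (Suc k) \<le> exp (- 4 * (2 * real k - real l + 1) / (real m + 1)) * hyp_weight m l k"
proof -
  define M where "M = real m + 1"
  define e where "e = 2 * real k - real l + 1"
  define w where "w = real l - real m"
  note eq = hyp_weight_Suc[of m l k, folded M_def e_def w_def]
  have e0: "0 \<le> e" using assms unfolding e_def by linarith
  have Mw: "\<bar>w\<bar> < M" using l unfolding M_def w_def by linarith
  then have M0: "M > 0" by simp
  have w2: "w\<^sup>2 < M\<^sup>2" using Mw by (metis abs_ge_zero power2_abs power_strict_mono zero_less_numeral)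
  have "M\<^sup>2 \<le> (M + e)\<^sup>2" using e0 M0 by (intro power_mono) auto
  then have den: "(M + e)\<^sup>2 - w\<^sup>2 > 0" using w2 by linarith
  show ?thesis
  proof (cases "k \<le> l \<and> k \<le> m \<and> l - k \<le> m")
    case False
    then have "hyp_weight m l k = 0" using hyp_weight_pos_iff[of m l k] hyp_weight_nonneg[of m l k] by linarith
    with eq den have "hyp_weight m l (Suc k) = 0" by simp
    then show ?thesis using hyp_weight_nonneg[of m l k] by simp
  next
    case True
    \<comment> \<open>On the support \<open>e \<le> M\<close>, so \<open>M - e\<close> is
      nonnegative and its upper bound may be squared.\<close>
    then have eM: "e \<le> M" unfolding e_def M_def by linarith
    have "M - e = M * (1 - e / M)" using M0 by (simp add: field_simps)
    also have "\<dots> \<le> M * (exp (- 2 * (e / M)) * (1 + e / M))"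
      using M0 e0 one_minus_le_exp_one_plus[of "e / M"] by (intro mult_left_mono) auto
    also have "\<dots> = exp (- 2 * (e / M)) * (M + e)" using M0 by (simp add: field_simps)
    finally have "(M - e)\<^sup>2 \<le> (exp (- 2 * (e / M)) * (M + e))\<^sup>2" using eM by (intro power_mono) auto
    also have "\<dots> = exp (- 4 * e / M) * (M + e)\<^sup>2"
      by (simp add: power_mult_distrib power2_eq_square[of "exp _"] flip: exp_add)
    finally have 1: "(M - e)\<^sup>2 \<le> exp (- 4 * e / M) * (M + e)\<^sup>2" .
    have "((M - e)\<^sup>2 - w\<^sup>2) * (M + e)\<^sup>2 \<le> (M - e)\<^sup>2 * ((M + e)\<^sup>2 - w\<^sup>2)"
    proof -
      have "(M - e)\<^sup>2 \<le> (M + e)\<^sup>2" using e0 eM by (intro power_mono) auto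
      then have "w\<^sup>2 * (M - e)\<^sup>2 \<le> w\<^sup>2 * (M + e)\<^sup>2" by (intro mult_left_mono) auto
      then show ?thesis by (simp add: algebra_simps)
    qed
    also have "\<dots> \<le> (exp (- 4 * e / M) * (M + e)\<^sup>2) * ((M + e)\<^sup>2 - w\<^sup>2)"
      using den by (intro mult_right_mono 1) auto
    finally have "((M - e)\<^sup>2 - w\<^sup>2) \<le> exp (- 4 * e / M) * ((M + e)\<^sup>2 - w\<^sup>2)"
      using e0 M0 by (simp add: mult_ac)
    then have "hyp_weight m l k * ((M - e)\<^sup>2 - w\<^sup>2) \<le> hyp_weight m l k * (exp (- 4 * e / M) * ((M + e)\<^sup>2 - w\<^sup>2))"
      by (intro mult_left_mono) auto
    then have "hyp_weight m l (Suc k) * ((M + e)\<^sup>2 - w\<^sup>2) \<le> (exp (- 4 * e / M) * hyp_weight m l k) * ((M + e)\<^sup>2 - w\<^sup>2)"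
      unfolding eq by (simp add: mult_ac)
    then show ?thesis using den unfolding M_def e_def by (simp add: mult_le_cancel_right)
  qed
qed

text \<open>After division by \<open>M^2\<close> the quotient is \<open>(1 - y) / (1 + y)\<close>
  with \<open>y = 2 * a / (1 + a^2 - b^2)\<close>. The ranges of \<open>a\<close> and
  \<open>b\<close> give \<open>y \<le> 2 * a * (1 + 2 * b^2)\<close> and
  \<open>y \<le> 3 * a\<close>, so the exponent misses the ideal \<open>4 * a\<close> by a relative
  error of order \<open>a^2 + b^2\<close>; the constant 32 is generous.\<close>

lemma hyp_weight_Suc_ge:
  assumes l: "l \<le> 2 * m" and k: "l \<le> 2 * k + 1"
    and a: "a = (2 * real k - real l + 1) / (real m + 1)" "a \<le> 1 / 8"
    and b: "b = (real l - real m) / (real m + 1)" "\<bar>b\<bar> \<le> 1 / 2"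
  shows "exp (- 4 * a * (1 + 32 * (a\<^sup>2 + b\<^sup>2))) * hyp_weight m l k \<le> hyp_weight m l (Suc k)"
proof -
  define M where "M = real m + 1"
  define e where "e = 2 * real k - real l + 1"
  define w where "w = real l - real m"
  note eq = hyp_weight_Suc[of m l k, folded M_def e_def w_def]
  have M0: "M > 0" by (simp add: M_def)
  have ea: "e = a * M" and wb: "w = b * M" using M0 unfolding a b e_def w_def M_def by auto
  have a0: "0 \<le> a" using k unfolding a(1) by (intro divide_nonneg_nonneg) linarith+
  have b2: "b\<^sup>2 \<le> 1 / 4" using b(2) power_mono[of "\<bar>b\<bar>" "1/2" 2] by (simp add: power2_eq_square)
  have a2: "a\<^sup>2 \<le> 1 / 64" using a(2) a0 power_mono[of a "1/8" 2] by (simp add: power2_eq_square)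
  define y where "y = 2 * a / (1 + a\<^sup>2 - b\<^sup>2)"
  have den: "1 + a\<^sup>2 - b\<^sup>2 > 0" using b2 zero_le_power2[of a] by linarith
  have y0: "0 \<le> y" unfolding y_def using a0 den by simp
  have "1 \<le> (1 + a\<^sup>2 - b\<^sup>2) * (1 + 2 * b\<^sup>2)"
  proof -
    have "(1 + a\<^sup>2 - b\<^sup>2) * (1 + 2 * b\<^sup>2) = 1 + b\<^sup>2 * (1 - 2 * b\<^sup>2) + a\<^sup>2 * (1 + 2 * b\<^sup>2)"
      by (simp add: algebra_simps)
    moreover have "0 \<le> b\<^sup>2 * (1 - 2 * b\<^sup>2)" using b2 by (intro mult_nonneg_nonneg) auto
    ultimately show ?thesis by simp
  qed
  then have "2 * a * 1 \<le> 2 * a * ((1 + a\<^sup>2 - b\<^sup>2) * (1 + 2 * b\<^sup>2))"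
    using a0 by (intro mult_left_mono) auto
  then have y1: "y \<le> 2 * a * (1 + 2 * b\<^sup>2)"
    unfolding y_def pos_divide_le_eq[OF den] by (simp only: mult_ac mult_1_right)
  also have "\<dots> \<le> 2 * a * (3 / 2)" using b2 a0 by (intro mult_left_mono) auto
  finally have y3: "y \<le> 3 * a" by simp
  then have yh: "y \<le> 1 / 2" using a(2) by simp
  have "y ^ 3 \<le> (3 * a) ^ 3" using y3 y0 by (intro power_mono)
  then have "y ^ 3 \<le> 27 * a * a\<^sup>2" by (simp add: power2_eq_square power3_eq_cube)
  moreover have "0 \<le> a * a\<^sup>2" "0 \<le> a * b\<^sup>2" using a0 by auto
  ultimately have "2 * (y + y ^ 3) \<le> 4 * a * (1 + 32 * (a\<^sup>2 + b\<^sup>2))"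
    using y1 by (simp add: algebra_simps)
  then have "exp (- 4 * a * (1 + 32 * (a\<^sup>2 + b\<^sup>2))) * (1 + y) \<le> exp (- 2 * (y + y ^ 3)) * (1 + y)"
    using y0 by (intro mult_right_mono) auto
  also have "\<dots> \<le> 1 - y" by (rule exp_le_one_minus_over_one_plus[OF y0 yh])
  finally have "M\<^sup>2 * (1 + a\<^sup>2 - b\<^sup>2) * (exp (- 4 * a * (1 + 32 * (a\<^sup>2 + b\<^sup>2))) * (1 + y)) \<le> M\<^sup>2 * (1 + a\<^sup>2 - b\<^sup>2) * (1 - y)"
    using den by (intro mult_left_mono) auto
  moreover have "M\<^sup>2 * (1 + a\<^sup>2 - b\<^sup>2) * (1 - y) = (M - e)\<^sup>2 - w\<^sup>2" "M\<^sup>2 * (1 + a\<^sup>2 - b\<^sup>2) * (1 + y) = (M + e)\<^sup>2 - w\<^sup>2"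
    using den unfolding y_def ea wb by (simp_all add: field_simps power2_eq_square)
  ultimately have *: "exp (- 4 * a * (1 + 32 * (a\<^sup>2 + b\<^sup>2))) * ((M + e)\<^sup>2 - w\<^sup>2) \<le> (M - e)\<^sup>2 - w\<^sup>2"
    by (metis mult.left_commute)
  have pos: "(M + e)\<^sup>2 - w\<^sup>2 > 0"
    using \<open>_ * (1 + y) = (M + e)\<^sup>2 - w\<^sup>2\<close>[symmetric] M0 den y0 by simp
  have "(exp (- 4 * a * (1 + 32 * (a\<^sup>2 + b\<^sup>2))) * hyp_weight m l k) * ((M + e)\<^sup>2 - w\<^sup>2)
      \<le> hyp_weight m l k * ((M - e)\<^sup>2 - w\<^sup>2)"
    using mult_left_mono[OF *, of "hyp_weight m l k"] by (simp add: mult_ac)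
  also have "\<dots> = hyp_weight m l (Suc k) * ((M + e)\<^sup>2 - w\<^sup>2)" by (rule eq[symmetric])
  finally show ?thesis using pos by (simp add: mult_le_cancel_right)
qed

section \<open>Hypergeometric tails against Gaussian tails\<close>

lemma hyp_weight_sum_reflect:
  assumes "k \<le> l"
  shows "sum (hyp_weight m l) {k..l} = sum (hyp_weight m l) {..l - k}"
  by (rule sum.reindex_bij_witness[of _ "\<lambda>j. l - j" "\<lambda>j. l - j"]) (use assms in \<open>auto simp: hyp_weight_sym\<close>)

text \<open>In the two tail bounds, consecutive weights are compared with consecutive cells of a shifted or
  scaled Gaussian of variance \<open>m / 2\<close>. The comparison starts at the center, where both tails are
  1/2 by symmetry, so that no normalising constant has to be estimated.\<close>

lemma hyp_tail_le:
  assumes m: "m \<ge> 1" and l: "l \<le> 2 * m" and k: "l < 2 * k"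
  shows "sum (hyp_weight m l) {k..l}
    \<le> real (2 * m choose l) * normal_tail ((2 * real k - real l - 3) / sqrt (real m / 2))"
proof (cases "k \<le> l")
  case False
  then show ?thesis by (simp add: less_imp_le[OF normal_tail_pos])
next
  case kl: True
  define \<sigma> where "\<sigma> = sqrt (real m / 2)"
  have \<sigma>: "\<sigma> > 0" "\<sigma>\<^sup>2 = real m / 2" using m by (auto simp: \<sigma>_def)
  define Z where "Z = sum (hyp_weight m l) {..l}"
  \<comment> \<open>The shift by 3 cancels the term \<open>3 * \<delta>^2 / 2\<close> in the lower
    bound for the ratio of Gaussian cells. That ratio is then at least
    \<open>exp (- 4 * (2 * j - l) / m)\<close>, which dominates the ratio of the weights.\<close>
  define t where "t j = normal_tail ((2 * real j - real l - 3) / \<sigma>)" for j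
  define c where "c j = t j - t (Suc j)" for j
  \<comment> \<open>The first index to the right of the centre. Its tail is disjoint from its mirror
    image and so has at most half of the mass, while the shift by 3 keeps \<open>t k0\<close> at
    least 1/2.\<close>
  define k0 where "k0 = l div 2 + 1"
  have k0: "k0 \<le> k" "l < 2 * k0" "2 * k0 \<le> l + 2" using k by (auto simp: k0_def)
  have tS: "t (Suc j) = normal_tail ((2 * real j - real l - 3) / \<sigma> + 2 / \<sigma>)"
       "t (Suc (Suc j)) = normal_tail ((2 * real j - real l - 3) / \<sigma> + 2 * (2 / \<sigma>))" for j
    unfolding t_def by (rule arg_cong[where f=normal_tail], simp add: add_divide_distrib[symmetric])+
  have cpos: "0 < c j" for j
    unfolding c_def tS(1) using \<sigma> normal_tail_less[of _ "_ + 2 / \<sigma>"] by (simp add: t_def)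
  have cstep: "exp (- 4 * (2 * real j - real l) / real m) * c j \<le> c (Suc j)" for j
  proof -
    define \<delta> x where "\<delta> = 2 / \<sigma>" and "x = (2 * real j - real l - 3) / \<sigma>"
    have "\<delta> * x + 3 * \<delta>\<^sup>2 / 2 = 2 * (2 * real j - real l) / \<sigma>\<^sup>2"
      using \<sigma>(1) unfolding \<delta>_def x_def by (simp add: field_simps power2_eq_square)
    also have "\<dots> = 4 * (2 * real j - real l) / real m" unfolding \<sigma>(2) by (simp add: field_simps)
    finally have e: "\<delta> * x + 3 * \<delta>\<^sup>2 / 2 = 4 * (2 * real j - real l) / real m" .
    have "- \<delta> * x - 3 * \<delta>\<^sup>2 / 2 = - (\<delta> * x + 3 * \<delta>\<^sup>2 / 2)" by simp
    also have "\<dots> = - 4 * (2 * real j - real l) / real m" unfolding e using m by (simp add: field_simps)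
    finally have "- \<delta> * x - 3 * \<delta>\<^sup>2 / 2 = - 4 * (2 * real j - real l) / real m" .
    with normal_tail_cell_ratio(2)[of \<delta> x] \<sigma>(1) show ?thesis
      unfolding c_def tS(2)[of j] tS(1)[of j] \<delta>_def x_def by (simp add: t_def)
  qed
  have step: "hyp_weight m l (Suc j) * c j \<le> hyp_weight m l j * c (Suc j)" if "k0 \<le> j" for j
  proof -
    have 1: "hyp_weight m l (Suc j) \<le> exp (- 4 * (2 * real j - real l + 1) / (real m + 1)) * hyp_weight m l j"
      using that k0 by (intro hyp_weight_Suc_le[OF l]) auto
    have 2: "exp (- 4 * (2 * real j - real l + 1) / (real m + 1)) * hyp_weight m l j \<le> exp (- 4 * (2 * real j - real l) / real m) * hyp_weight m l j"
    proof (cases "hyp_weight m l j = 0")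
      case False
      then have "j \<le> l" "j \<le> m" using hyp_weight_pos_iff[of m l j] hyp_weight_nonneg[of m l j] by linarith+
      \<comment> \<open>Deviations on the support are at most \<open>m\<close>; this is when adding
        1 to numerator and denominator does not decrease the fraction.\<close>
      then have d: "2 * real j - real l \<le> real m" by simp
      have "(2 * real j - real l) / real m \<le> (2 * real j - real l + 1) / (real m + 1)"
        using d m by (simp add: field_simps)
      then have "- 4 * ((2 * real j - real l + 1) / (real m + 1)) \<le> - 4 * ((2 * real j - real l) / real m)"
        by linarith
      then show ?thesis by (intro mult_right_mono) (simp_all only: times_divide_eq_right exp_le_cancel_iff hyp_weight_nonneg)
    qed simp
    have "hyp_weight m l (Suc j) * c j \<le> exp (- 4 * (2 * real j - real l) / real m) * hyp_weight m l j * c j"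
      using order_trans[OF 1 2] cpos[of j] by (intro mult_right_mono) auto
    also have "\<dots> = hyp_weight m l j * (exp (- 4 * (2 * real j - real l) / real m) * c j)" by simp
    also have "\<dots> \<le> hyp_weight m l j * c (Suc j)" by (intro mult_left_mono cstep) simp
    finally show ?thesis .
  qed
  define A where "A = sum (hyp_weight m l) {k..l}"
  define B where "B = sum (hyp_weight m l) {k0..<k}"
  have AB: "A + B = sum (hyp_weight m l) {k0..l}"
    unfolding A_def B_def using k0 kl sum.atLeastLessThan_concat[of k0 k "Suc l" "hyp_weight m l"]
    by (simp add: atLeastLessThanSuc_atLeastAtMost)
  have "sum (hyp_weight m l) {k0..l} + sum (hyp_weight m l) {..l - k0} \<le> Z"
    unfolding Z_def using k0 kl by (subst sum.union_disjoint[symmetric]) (auto intro!: sum_mono2)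
  then have ABZ: "2 * (A + B) \<le> Z" using hyp_weight_sum_reflect[of k0 l m] k0 kl unfolding AB by simp
  have tele: "sum c {i..<j} = t i - t j" if "i \<le> j" for i j
    unfolding c_def using sum_Suc_diff'[of i j "\<lambda>j. - t j"] that by simp
  have "A * (t k0 - t k) \<le> B * (t k - t (Suc l))"
    using likelihood_ratio_tail[of k0 "Suc l" c "hyp_weight m l" k] cpos step k0 kl
      tele[of k "Suc l"]
    by (simp add: tele A_def B_def atLeastLessThanSuc_atLeastAtMost)
  also have "\<dots> \<le> B * t k"
    unfolding t_def by (intro mult_left_mono) (auto simp: B_def sum_nonneg intro: less_imp_le[OF normal_tail_pos])
  finally have "A * t k0 \<le> (A + B) * t k" by (simp add: algebra_simps)
  also have "\<dots> \<le> (Z / 2) * t k" unfolding t_def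
    by (intro mult_right_mono) (use ABZ normal_tail_pos less_imp_le in auto)
  also have "\<dots> \<le> (Z * t k0) * t k"
  proof (rule mult_right_mono)
    have "(2 * real k0 - real l - 3) / \<sigma> \<le> 0" using k0 \<sigma> by (intro divide_nonpos_pos) linarith+
    then have "1 / 2 \<le> t k0" unfolding t_def using normal_tail_antimono normal_tail_0 by metis
    moreover have "0 \<le> Z" by (simp add: Z_def sum_nonneg)
    ultimately show "Z / 2 \<le> Z * t k0" using mult_left_mono[of "1/2" "t k0" Z] by simp
  qed (simp add: t_def less_imp_le[OF normal_tail_pos])
  finally have "A * t k0 \<le> (Z * t k) * t k0" by (simp add: mult_ac)
  then have "A \<le> Z * t k" unfolding t_def using normal_tail_pos by (simp add: mult_le_cancel_right not_less[symmetric])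
  then show ?thesis unfolding A_def Z_def t_def \<sigma>_def hyp_weight_sum by simp
qed

text \<open>The ratios of the weights are bounded below only up to an error factor in the exponent,
  and only for deviations up to about \<open>m / 8\<close>. The factor is absorbed by scaling the
  Gaussian argument by \<open>s\<close>; the restricted range forces a stop at \<open>J\<close>, at
  the price of the Gaussian tail beyond it.\<close>

lemma hyp_tail_ge:
  assumes m: "m \<ge> 2" and l: "l \<le> 2 * m" and k: "l \<le> 2 * k" "k \<le> J" and s: "s \<ge> 1"
    and J: "2 * real J - real l \<le> (real m + 1) / 8" and w: "\<bar>real l - real m\<bar> \<le> (real m + 1) / 2"
    and s2: "1 + 32 * ((2 * real J - real l)\<^sup>2 + (real l - real m)\<^sup>2) / (real m + 1)\<^sup>2 \<le> s\<^sup>2"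
  shows "real (2 * m choose l) * (normal_tail (s * (2 * real k - real l) / sqrt (real m / 2))
            - normal_tail (s * (2 * real J - real l) / sqrt (real m / 2)))
      \<le> sum (hyp_weight m l) {k..l}"
proof -
  define \<sigma> where "\<sigma> = sqrt (real m / 2)"
  have \<sigma>: "\<sigma> > 0" "\<sigma>\<^sup>2 = real m / 2" using m by (auto simp: \<sigma>_def)
  define Z where "Z = sum (hyp_weight m l) {..l}"
  define t where "t j = normal_tail (s * (2 * real j - real l) / \<sigma>)" for j
  define c where "c j = t j - t (Suc j)" for j
  \<comment> \<open>Here the tail from \<open>k0\<close> and its mirror image have to cover
    everything, so \<open>k0\<close> may be the centre itself; accordingly \<open>t k0\<close> is at
    most 1/2.\<close>
  define k0 where "k0 = (l + 1) div 2"
  have k0: "k0 \<le> k" "l \<le> 2 * k0" "2 * k0 \<le> l + 1" using k by (auto simp: k0_def)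
  have "real l - real m \<le> (real m + 1) / 2" "real m - real l \<le> (real m + 1) / 2" "2 \<le> real m"
    using w m by linarith+
  then have "real J \<le> real l" "real J \<le> real m" using J by argo+
  then have JL: "J \<le> l" "J \<le> m" by simp_all
  have tS: "t (Suc j) = normal_tail (s * (2 * real j - real l) / \<sigma> + 2 * s / \<sigma>)"
       "t (Suc (Suc j)) = normal_tail (s * (2 * real j - real l) / \<sigma> + 2 * (2 * s / \<sigma>))" for j
    unfolding t_def by (rule arg_cong[where f=normal_tail], simp add: add_divide_distrib[symmetric] algebra_simps)+
  have cpos: "0 < c j" for j
    unfolding c_def tS(1) using \<sigma> s normal_tail_less[of _ "_ + 2 * s / \<sigma>"] by (simp add: t_def)
  have cstep: "c (Suc j) \<le> exp (- 4 * s\<^sup>2 * (2 * real j - real l + 1) / real m) * c j" for j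
  proof -
    define \<delta> x where "\<delta> = 2 * s / \<sigma>" and "x = s * (2 * real j - real l) / \<sigma>"
    have "\<delta> * x + \<delta>\<^sup>2 / 2 = 2 * s\<^sup>2 * (2 * real j - real l + 1) / \<sigma>\<^sup>2"
      using \<sigma>(1) unfolding \<delta>_def x_def by (simp add: field_simps power2_eq_square)
    also have "\<dots> = 4 * s\<^sup>2 * (2 * real j - real l + 1) / real m" unfolding \<sigma>(2) by (simp add: field_simps)
    finally have "- \<delta> * x - \<delta>\<^sup>2 / 2 = - 4 * s\<^sup>2 * (2 * real j - real l + 1) / real m"
      by simp
    with normal_tail_cell_ratio(1)[of \<delta> x] \<sigma>(1) s show ?thesis
      unfolding c_def tS(2)[of j] tS(1)[of j] \<delta>_def x_def by (simp add: t_def)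
  qed
  have step: "c (Suc j) * hyp_weight m l j \<le> c j * hyp_weight m l (Suc j)" if "k0 \<le> j" "Suc j < J" for j
  proof -
    define a where "a = (2 * real j - real l + 1) / (real m + 1)"
    define b where "b = (real l - real m) / (real m + 1)"
    have e0: "0 \<le> 2 * real j - real l + 1" and eH: "2 * real j - real l + 1 \<le> 2 * real J - real l"
      using that k0 by linarith+
    have "a \<le> 1 / 8" using J eH unfolding a_def by (simp add: divide_le_eq)
    moreover have "\<bar>b\<bar> \<le> 1 / 2" using w unfolding b_def by (simp add: abs_divide divide_le_eq)
    ultimately have 1: "exp (- 4 * a * (1 + 32 * (a\<^sup>2 + b\<^sup>2))) * hyp_weight m l j \<le> hyp_weight m l (Suc j)"
      using that k0 by (intro hyp_weight_Suc_ge[OF l _ a_def _ b_def]) auto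
    have "(2 * real j - real l + 1)\<^sup>2 \<le> (2 * real J - real l)\<^sup>2" using e0 eH by (intro power_mono)
    then have "1 + 32 * (a\<^sup>2 + b\<^sup>2) \<le> 1 + 32 * ((2 * real J - real l)\<^sup>2 + (real l - real m)\<^sup>2) / (real m + 1)\<^sup>2"
      unfolding a_def b_def by (simp add: power_divide add_divide_distrib[symmetric] divide_right_mono)
    then have ab: "1 + 32 * (a\<^sup>2 + b\<^sup>2) \<le> s\<^sup>2" using s2 by linarith
    have "4 * a * (1 + 32 * (a\<^sup>2 + b\<^sup>2)) \<le> 4 * a * s\<^sup>2"
      using ab e0 by (intro mult_left_mono) (auto simp: a_def)
    also have "\<dots> = 4 * s\<^sup>2 * ((2 * real j - real l + 1) / (real m + 1))" by (simp add: a_def)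
    also have "\<dots> \<le> 4 * s\<^sup>2 * ((2 * real j - real l + 1) / real m)"
      using e0 m by (intro mult_left_mono divide_left_mono) auto
    finally have "- 4 * s\<^sup>2 * (2 * real j - real l + 1) / real m \<le> - 4 * a * (1 + 32 * (a\<^sup>2 + b\<^sup>2))" by simp
    then have "c (Suc j) \<le> exp (- 4 * a * (1 + 32 * (a\<^sup>2 + b\<^sup>2))) * c j"
      using cstep[of j] cpos[of j]
      by (meson exp_le_cancel_iff less_imp_le mult_right_mono order_trans)
    then have "c (Suc j) * hyp_weight m l j \<le> exp (- 4 * a * (1 + 32 * (a\<^sup>2 + b\<^sup>2))) * c j * hyp_weight m l j"
      by (intro mult_right_mono) auto
    also have "\<dots> = c j * (exp (- 4 * a * (1 + 32 * (a\<^sup>2 + b\<^sup>2))) * hyp_weight m l j)" by simp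
    also have "\<dots> \<le> c j * hyp_weight m l (Suc j)" using cpos[of j] by (intro mult_left_mono 1) auto
    finally show ?thesis .
  qed
  have hpos: "0 < hyp_weight m l j" if "k0 \<le> j" "j < J" for j
    unfolding hyp_weight_pos_iff using that k0 JL l by linarith
  define A where "A = sum (hyp_weight m l) {k..l}"
  define B where "B = sum (hyp_weight m l) {k0..<k}"
  have kl: "k \<le> l" using k JL by simp
  have AB: "A + B = sum (hyp_weight m l) {k0..l}"
    unfolding A_def B_def using k0 kl sum.atLeastLessThan_concat[of k0 k "Suc l" "hyp_weight m l"]
    by (simp add: atLeastLessThanSuc_atLeastAtMost)
  have "Z \<le> sum (hyp_weight m l) {k0..l} + sum (hyp_weight m l) {..l - k0}"
  proof -
    have "Z \<le> sum (hyp_weight m l) ({k0..l} \<union> {..l - k0})"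
      unfolding Z_def using k0 by (intro sum_mono2) auto
    also have "\<dots> \<le> sum (hyp_weight m l) {k0..l} + sum (hyp_weight m l) {..l - k0}"
      by (subst sum.union_inter[symmetric]) (auto intro: sum_nonneg)
    finally show ?thesis .
  qed
  then have ABZ: "Z \<le> 2 * (A + B)" using hyp_weight_sum_reflect[of k0 l m] k0 kl unfolding AB by simp
  have tele: "sum c {i..<j} = t i - t j" if "i \<le> j" for i j
    unfolding c_def using sum_Suc_diff'[of i j "\<lambda>j. - t j"] that by simp
  define C where "C = t k - t J"
  have C0: "0 \<le> C" unfolding C_def t_def
    using k s \<sigma> normal_tail_antimono[of "s * (2 * real k - real l) / \<sigma>" "s * (2 * real J - real l) / \<sigma>"]
    by (simp add: divide_right_mono)
  have "C * B \<le> (t k0 - t k) * sum (hyp_weight m l) {k..<J}"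
    using likelihood_ratio_tail[of k0 J "hyp_weight m l" c k] cpos step hpos k0 k
    by (simp add: tele B_def C_def less_imp_le)
  also have "\<dots> \<le> (t k0 - t k) * A"
  proof (rule mult_left_mono)
    show "sum (hyp_weight m l) {k..<J} \<le> A" unfolding A_def using JL by (intro sum_mono2) auto
    show "0 \<le> t k0 - t k" using tele[of k0 k] k0 cpos by (metis less_imp_le sum_nonneg)
  qed
  finally have "C * (A + B) \<le> (t k0 - t k + C) * A" by (simp add: algebra_simps)
  also have "\<dots> \<le> (1 / 2) * A"
  proof (rule mult_right_mono)
    have "0 \<le> s * (2 * real k0 - real l) / \<sigma>" using k0 s \<sigma> by (intro divide_nonneg_pos mult_nonneg_nonneg) linarith+
    then have "t k0 \<le> 1 / 2" unfolding t_def using normal_tail_antimono normal_tail_0 by metis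
    moreover have "0 < t J" by (simp add: t_def normal_tail_pos)
    ultimately show "t k0 - t k + C \<le> 1 / 2" by (simp add: C_def)
  qed (simp add: A_def sum_nonneg)
  finally have "2 * C * (A + B) \<le> A" by simp
  moreover have "C * Z \<le> C * (2 * (A + B))" using ABZ C0 by (intro mult_left_mono)
  ultimately have "Z * C \<le> A" by (simp add: mult_ac)
  then show ?thesis unfolding A_def Z_def C_def t_def \<sigma>_def hyp_weight_sum by simp
qed

text \<open>Both losses become a shift of the argument. With the cut-off at a deviation of at least
  \<open>2 * m^(3/4)\<close>, the Gaussian tail given up is smaller than the mass of a cell of width
  \<open>1 / \<sigma>\<close> next to the argument, so it costs one unit. The scaling costs
  \<open>(s - 1) * d\<close>, of order \<open>d * (H^2 + w^2) / m^2\<close> with \<open>H^2\<close>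
  of order \<open>1 + d^2 + m^(3/2)\<close>; as \<open>d \<le> m\<close>, this is of order
  \<open>1 + (d^2 + w^2) / m\<close>.\<close>

lemma hyp_tail_ge_local:
  assumes m: "m \<ge> 2 ^ 20" and l: "l \<le> 2 * m" and k: "l \<le> 2 * k"
    and d: "d = 2 * real k - real l" "d \<le> real m / 32"
    and w: "w = real l - real m" "\<bar>w\<bar> \<le> real m / 4"
  shows "real (2 * m choose l) * normal_tail ((d + 1000 * (1 + (d\<^sup>2 + w\<^sup>2) / real m)) / sqrt (real m / 2))
      \<le> sum (hyp_weight m l) {k..l}"
proof -
  define \<sigma> where "\<sigma> = sqrt (real m / 2)"
  have \<sigma>: "\<sigma> > 0" "\<sigma>\<^sup>2 = real m / 2" using m by (auto simp: \<sigma>_def)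
  have rm: "real m \<ge> 1048576" using m by simp
  \<comment> \<open>The fourth root of \<open>m\<close>; since \<open>2 ^ 20 = 32 ^ 4\<close> it is
    at least 32, so that \<open>R = q ^ 3\<close>, that is \<open>m^(3/4)\<close>, is at most
    \<open>m / 32\<close> and the cut-off stays within the admissible range.\<close>
  define q where "q = sqrt (sqrt (real m))"
  have q4: "q ^ 4 = real m" unfolding q_def using power_mult[of "sqrt (sqrt (real m))" 2 2] by simp
  have q2: "q\<^sup>2 = sqrt (real m)" by (simp add: q_def)
  have q32: "32 \<le> q"
  proof (rule ccontr)
    assume "\<not> ?thesis"
    then have "q ^ 4 < 32 ^ 4" by (intro power_strict_mono) (auto simp: q_def)
    then show False using q4 rm by simp
  qed
  define R where "R = q ^ 3"
  have "R * 32 \<le> R * q" unfolding R_def using q32 by (intro mult_left_mono) auto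
  moreover have "R * q = real m" unfolding q4[symmetric] R_def by (simp add: power3_eq_cube power4_eq_xxxx)
  ultimately have R: "R \<le> real m / 32" by linarith
  have R0: "0 \<le> R" using q32 by (simp add: R_def)
  have R2: "R\<^sup>2 = real m * sqrt (real m)"
  proof -
    have "R\<^sup>2 = q ^ 4 * q\<^sup>2" unfolding R_def by (simp flip: power_mult power_add)
    then show ?thesis by (simp only: q4 q2)
  qed
  define H0 where "H0 = max (2 * (d + 1)) (2 * R)"
  have d0: "0 \<le> d" using k unfolding d by linarith
  define J where "J = nat \<lceil>(real l + H0) / 2\<rceil>"
  define H where "H = 2 * real J - real l"
  have H0: "0 \<le> H0" using d0 by (simp add: H0_def)
  have "0 \<le> (real l + H0) / 2" using H0 by simp
  then have "real J = of_int \<lceil>(real l + H0) / 2\<rceil>" unfolding J_def by (subst of_nat_nat) linarith+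
  then have "(real l + H0) / 2 \<le> real J" "real J < (real l + H0) / 2 + 1" by linarith+
  then have H: "H0 \<le> H" "H \<le> H0 + 2" unfolding H_def by (simp_all add: field_simps)
  have Hd: "2 * (d + 1) \<le> H" "2 * R \<le> H" using H(1) unfolding H0_def by linarith+
  have "H0 \<le> real m / 16 + 2" unfolding H0_def using d R by (intro max.boundedI) argo+
  then have HM: "H \<le> (real m + 1) / 8" using H(2) rm by simp
  have "real k \<le> real J" using Hd(1) d0 unfolding H_def d(1) by argo
  then have kJ: "k \<le> J" by simp
  define Q where "Q = (H\<^sup>2 + w\<^sup>2) / (real m + 1)\<^sup>2"
  have Q0: "0 \<le> Q" by (simp add: Q_def)
  define s where "s = sqrt (1 + 32 * Q)"
  have s: "1 \<le> s" "s\<^sup>2 = 1 + 32 * Q" using Q0 by (simp_all add: s_def)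
  have s_le: "s \<le> 1 + 16 * Q" unfolding s_def using Q0
    by (intro real_le_lsqrt) (auto simp: power2_eq_square algebra_simps)
  define x where "x = s * d / \<sigma>"
  define y where "y = s * H / \<sigma>"
  have wM: "\<bar>real l - real m\<bar> \<le> (real m + 1) / 2"
    using order_trans[OF w(2), of "(real m + 1) / 2"] unfolding w(1) by simp
  have "real (2 * m choose l) * (normal_tail x - normal_tail y) \<le> sum (hyp_weight m l) {k..l}"
    unfolding x_def y_def H_def \<sigma>_def d(1)
    by (rule hyp_tail_ge[OF _ l k kJ s(1) _ wM]) (use HM s m in \<open>auto simp: H_def Q_def w(1)\<close>)
  moreover have "normal_tail ((d + 1000 * (1 + (d\<^sup>2 + w\<^sup>2) / real m)) / \<sigma>) \<le> normal_tail x - normal_tail y"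
  proof -
    have x0: "0 \<le> x" unfolding x_def using s d0 \<sigma> by simp
    have "2 * (s * d + 1) \<le> s * (2 * (d + 1))" using s(1) by (simp add: algebra_simps)
    also have "\<dots> \<le> s * H" using s Hd by (intro mult_left_mono) auto
    finally have *: "2 * (s * d + 1) \<le> s * H" .
    have xy: "2 * (x + 1 / \<sigma>) \<le> y"
    proof -
      have "2 * (x + 1 / \<sigma>) = 2 * (s * d + 1) / \<sigma>" by (simp add: x_def add_divide_distrib algebra_simps)
      also have "\<dots> \<le> s * H / \<sigma>" using * \<sigma>(1) by (intro divide_right_mono) auto
      finally show ?thesis by (simp add: y_def)
    qed
    have "(2 * (x + 1 / \<sigma>))\<^sup>2 \<le> y\<^sup>2" using xy x0 \<sigma> by (intro power_mono) auto
    moreover have "4 * (x + 1 / \<sigma>)\<^sup>2 = (2 * (x + 1 / \<sigma>))\<^sup>2" by (simp only: power_mult_distrib) simp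
    ultimately have xy2: "4 * (x + 1 / \<sigma>)\<^sup>2 \<le> y\<^sup>2" by (simp only:)
    have "(2 * R)\<^sup>2 \<le> (s * H)\<^sup>2"
      using Hd(2) R0 s(1) mult_mono[of 1 s "2 * R" H] by (intro power_mono) auto
    then have "4 * R\<^sup>2 / \<sigma>\<^sup>2 \<le> y\<^sup>2"
      unfolding y_def power_divide by (intro divide_right_mono) (auto simp: power_mult_distrib)
    then have "8 * sqrt (real m) \<le> y\<^sup>2" unfolding R2 \<sigma>(2) using rm by simp
    \<comment> \<open>As \<open>(x + 1 / \<sigma>)^2 \<le> y^2 / 4\<close>, the difference is at
      least \<open>3 * y^2 / 8\<close>. It is already as large as the prefactor
      \<open>\<sigma> * sqrt (2 * pi)\<close>, so \<open>exp t \<ge> 1 + t\<close> suffices.\<close>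
    then have "3 * sqrt (real m) \<le> y\<^sup>2 / 2 - (x + 1 / \<sigma>)\<^sup>2 / 2" using xy2 by linarith
    then have "3 * sqrt (real m) \<le> exp (y\<^sup>2 / 2 - (x + 1 / \<sigma>)\<^sup>2 / 2)"
      using exp_ge_add_one_self[of "y\<^sup>2 / 2 - (x + 1 / \<sigma>)\<^sup>2 / 2"] by linarith
    moreover have "\<sigma> * sqrt (2 * pi) \<le> 3 * sqrt (real m)"
    proof -
      have "\<sigma> * sqrt (2 * pi) = sqrt (pi * real m)"
        unfolding \<sigma>_def by (simp flip: real_sqrt_mult)
      also have "\<dots> \<le> sqrt (9 * real m)" using pi_less_4 by (intro real_sqrt_le_mono mult_right_mono) auto
      finally show ?thesis by (simp add: real_sqrt_mult)
    qed
    ultimately have "\<sigma> * sqrt (2 * pi) \<le> exp (y\<^sup>2 / 2 - (x + 1 / \<sigma>)\<^sup>2 / 2)" by linarith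
    then have "exp (- y\<^sup>2 / 2) * (\<sigma> * sqrt (2 * pi)) \<le> exp (- y\<^sup>2 / 2) * exp (y\<^sup>2 / 2 - (x + 1 / \<sigma>)\<^sup>2 / 2)"
      by (intro mult_left_mono) auto
    also have "\<dots> = exp (- (x + 1 / \<sigma>)\<^sup>2 / 2)" by (simp flip: exp_add)
    finally have "exp (- y\<^sup>2 / 2) \<le> 1 / \<sigma> * std_normal_density (x + 1 / \<sigma>)"
      unfolding std_normal_density_def using \<sigma>(1) by (simp add: pos_le_divide_eq mult_ac)
    moreover have "normal_tail y \<le> exp (- y\<^sup>2 / 2)" using x0 xy \<sigma> by (intro normal_tail_le_exp) (smt (verit) divide_pos_pos)
    moreover have "1 / \<sigma> * std_normal_density (x + 1 / \<sigma>) \<le> normal_tail x - normal_tail (x + 1 / \<sigma>)"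
      using x0 \<sigma> by (intro normal_tail_diff_ge) auto
    ultimately have "normal_tail (x + 1 / \<sigma>) \<le> normal_tail x - normal_tail y" by linarith
    moreover have "x + 1 / \<sigma> \<le> (d + 1000 * (1 + (d\<^sup>2 + w\<^sup>2) / real m)) / \<sigma>"
    proof -
      have m0: "real m > 0" using rm by (rule less_le_trans[rotated]) simp
      have dm: "d \<le> real m" using d by linarith
      \<comment> \<open>The cut-off contributes \<open>d * R^2 / m^2 = u\<close>, which is linear in
        \<open>u\<close> and paid for by \<open>u \<le> 1 + u^2\<close>.\<close>
      define u where "u = d / sqrt (real m)"
      have u0: "0 \<le> u" using d0 by (simp add: u_def)
      have u2: "u\<^sup>2 = d\<^sup>2 / real m" by (simp add: u_def power_divide)
      have du: "d * sqrt (real m) = real m * u" unfolding u_def using m0 by (simp add: field_simps)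
      have "H0 \<le> 2 * (d + 1) + 2 * R" unfolding H0_def using d0 R0 by simp
      then have "H \<le> 2 * d + 4 + 2 * R" using H(2) by argo
      then have "H\<^sup>2 \<le> (2 * d + 4 + 2 * R)\<^sup>2" using H H0 by (intro power_mono) auto
      also have "\<dots> \<le> 3 * (4 * d\<^sup>2 + 16 + 4 * R\<^sup>2)"
        using sum_squares_ge_zero[of "2*d - 4" "2*d-2*R"] zero_le_power2[of "4 - 2 * R"] by (simp add: power2_eq_square algebra_simps)
      finally have "d * H\<^sup>2 \<le> d * (3 * (4 * d\<^sup>2 + 16 + 4 * R\<^sup>2))" using d0 by (intro mult_left_mono)
      also have "\<dots> = 12 * d\<^sup>2 * d + 48 * d + 12 * real m * (real m * u)"
        unfolding R2 du[symmetric] by (simp add: algebra_simps power2_eq_square)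
      also have "\<dots> \<le> 12 * d\<^sup>2 * real m + 48 * (real m)\<^sup>2 + 12 * real m * (real m * u)"
      proof -
        have "d \<le> (real m)\<^sup>2" using dm rm self_le_power[of "real m" 2] by linarith
        then show ?thesis using dm by (intro add_mono mult_left_mono) auto
      qed
      also have "\<dots> = (real m)\<^sup>2 * (12 * (d\<^sup>2 / real m) + 48 + 12 * u)"
        using m0 by (simp add: field_simps power2_eq_square)
      also have "\<dots> \<le> (real m)\<^sup>2 * (24 * (d\<^sup>2 / real m) + 60)"
      proof -
        have "u \<le> 1 + u\<^sup>2" using zero_le_power2[of "u - 1"] u0 by (simp add: power2_eq_square algebra_simps)
        then show ?thesis unfolding u2 by (intro mult_left_mono) auto
      qed
      finally have 1: "d * H\<^sup>2 \<le> (real m)\<^sup>2 * (24 * (d\<^sup>2 / real m) + 60)" .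
      have "d * w\<^sup>2 \<le> real m * w\<^sup>2" using dm by (intro mult_right_mono) auto
      also have "\<dots> = (real m)\<^sup>2 * (w\<^sup>2 / real m)" using m0 by (simp add: power2_eq_square)
      finally have 2: "d * (H\<^sup>2 + w\<^sup>2) \<le> (real m)\<^sup>2 * (24 * (d\<^sup>2 / real m) + 60 + w\<^sup>2 / real m)"
        using 1 by (simp add: algebra_simps)
      have "d * Q \<le> d * (H\<^sup>2 + w\<^sup>2) / (real m)\<^sup>2"
        unfolding Q_def using d0 m0 by (auto intro!: divide_left_mono power_mono)
      also have "\<dots> \<le> 24 * (d\<^sup>2 / real m) + 60 + w\<^sup>2 / real m"
        using 2 m0 by (simp add: divide_le_eq mult_ac)
      finally have 3: "d * Q \<le> 24 * (d\<^sup>2 / real m) + 60 + w\<^sup>2 / real m" .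
      have "s * d \<le> (1 + 16 * Q) * d" using s_le d0 by (intro mult_right_mono)
      then have "s * d \<le> d + 16 * (d * Q)" by (simp add: algebra_simps)
      moreover have "0 \<le> d\<^sup>2 / real m" "0 \<le> w\<^sup>2 / real m" by auto
      ultimately have "s * d + 1 \<le> d + 1000 * (1 + (d\<^sup>2 / real m + w\<^sup>2 / real m))"
        using 3 by argo
      then show ?thesis unfolding x_def using \<sigma>(1)
        by (simp add: add_divide_distrib[symmetric] divide_right_mono)
    qed
    ultimately show ?thesis using normal_tail_antimono order_trans by metis
  qed
  ultimately show ?thesis unfolding \<sigma>_def[symmetric]
    by (meson mult_left_mono of_nat_0_le_iff order_trans)
qed

text \<open>Here \<open>k\<close> is the quantile index at level \<open>normal_tail g\<close>. If
  \<open>m\<close> is small, or the endpoint or \<open>k\<close> lies far out, then \<open>m\<close>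
  itself is at most a multiple of the right-hand side and the trivial bound
  \<open>2 * m + g^2\<close> suffices; otherwise the two tail bounds apply, after reflection when
  \<open>k\<close> lies left of the centre. The constant is \<open>2 ^ 22\<close>, dictated with
  some slack by the case \<open>m < 2 ^ 20\<close>.\<close>

lemma hyp_quantile_close:
  assumes m: "m \<ge> 1" and l: "l \<le> 2 * m" and k: "k \<le> m" "k \<le> l" "l - k \<le> m"
    and lo: "real (2 * m choose l) * normal_tail g \<le> sum (hyp_weight m l) {k..l}"
    and hi: "sum (hyp_weight m l) {Suc k..l} < real (2 * m choose l) * normal_tail g"
  shows "\<bar>2 * real k - real l - sqrt (real m / 2) * g\<bar> \<le> 4194304 * (1 + g\<^sup>2 + (real l - real m)\<^sup>2 / real m)"
proof -
  define \<sigma> where "\<sigma> = sqrt (real m / 2)"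
  have \<sigma>: "\<sigma> > 0" "\<sigma>\<^sup>2 = real m / 2" using m by (auto simp: \<sigma>_def)
  define Z where "Z = real (2 * m choose l)"
  have Z0: "Z > 0" using l by (simp add: Z_def)
  define d where "d = 2 * real k - real l"
  define w where "w = real l - real m"
  define G where "G = \<sigma> * g"
  have G2: "G\<^sup>2 = real m * g\<^sup>2 / 2" by (simp add: G_def power_mult_distrib \<sigma>(2))
  have dm: "\<bar>d\<bar> \<le> real m" unfolding d_def using k by linarith
  have m0: "real m > 0" using m by simp
  have cmp: "x \<le> G" if "normal_tail g \<le> normal_tail (x / \<sigma>)" for x
  proof -
    have "x / \<sigma> \<le> g" using that normal_tail_less[of g "x / \<sigma>"] by linarith
    then show ?thesis using \<sigma> by (simp add: G_def divide_le_eq mult.commute)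
  qed
  have cmp': "G \<le> x" if "normal_tail (x / \<sigma>) < normal_tail g" for x
  proof -
    have "g \<le> x / \<sigma>" using that normal_tail_antimono[of "x / \<sigma>" g] by linarith
    then show ?thesis using \<sigma> by (simp add: G_def le_divide_eq mult.commute)
  qed
  \<comment> \<open>By symmetry a lower tail is the upper tail at the mirrored index, so the tail
    bounds become available on either side of the centre.\<close>
  have compl: "sum (hyp_weight m l) {j..l} = Z - sum (hyp_weight m l) {Suc l - j..l}" if "j \<le> l" for j
  proof (cases "j = 0")
    case True
    then show ?thesis using hyp_weight_sum[of m l] by (simp add: Z_def atLeast0AtMost)
  next
    case False
    have "sum (hyp_weight m l) {Suc l - j..l} = sum (hyp_weight m l) {..l - (Suc l - j)}"
      using False by (intro hyp_weight_sum_reflect) auto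
    also have "l - (Suc l - j) = j - 1" using that False by auto
    finally have "sum (hyp_weight m l) {Suc l - j..l} = sum (hyp_weight m l) {..<j}"
      using False by (simp add: lessThan_Suc_atMost[symmetric])
    moreover have "sum (hyp_weight m l) {..<j} + sum (hyp_weight m l) {j..l} = Z"
      unfolding Z_def hyp_weight_sum[symmetric] using that
      by (subst sum.union_disjoint[symmetric]) (auto intro!: sum.cong)
    ultimately show ?thesis by simp
  qed
  have up: "d - 3 \<le> G" if "1 \<le> d"
  proof -
    have "l < 2 * k" using that unfolding d_def by linarith
    then have "Z * normal_tail g \<le> Z * normal_tail ((d - 3) / \<sigma>)"
      using lo hyp_tail_le[OF m l, of k] unfolding d_def \<sigma>_def Z_def by linarith
    then show ?thesis using Z0 by (intro cmp) simp
  qed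
  have dn: "G \<le> d + 3" if "d \<le> -1"
  proof -
    have kl: "l < 2 * (l - k)" "k < l" using that unfolding d_def by linarith+
    have "sum (hyp_weight m l) {l - k..l} \<le> Z * normal_tail ((- d - 3) / \<sigma>)"
      using hyp_tail_le[OF m l kl(1)] kl(2) unfolding d_def \<sigma>_def Z_def by (simp add: of_nat_diff)
    then have "Z - Z * normal_tail ((- d - 3) / \<sigma>) < Z * normal_tail g"
      using hi compl[of "Suc k"] kl unfolding Z_def by simp
    moreover have "normal_tail ((- d - 3) / \<sigma>) = 1 - normal_tail ((d + 3) / \<sigma>)"
    proof -
      have "(- d - 3) / \<sigma> = - ((d + 3) / \<sigma>)" using \<sigma> by (simp add: field_simps)
      then show ?thesis using normal_tail_minus[of "(d + 3) / \<sigma>"] by simp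
    qed
    ultimately have "Z * normal_tail ((d + 3) / \<sigma>) < Z * normal_tail g" by (simp add: algebra_simps)
    then show ?thesis using Z0 by (intro cmp') simp
  qed
  \<comment> \<open>With no restriction on \<open>m\<close> or the endpoint, \<open>d\<close>
    exceeds \<open>G\<close> outwards by at most 3. This is what trades \<open>d^2\<close> for
    \<open>G^2\<close> in the error terms at the end.\<close>
  have dG: "\<bar>d\<bar> \<le> \<bar>G\<bar> + 3"
  proof -
    have "l = 2 * k \<or> Suc l \<le> 2 * k \<or> Suc (2 * k) \<le> l" by linarith
    then have "d = 0 \<or> 1 \<le> d \<or> d \<le> -1" unfolding d_def by linarith
    then show ?thesis using up dn by fastforce
  qed
  have crude: "\<bar>d - G\<bar> \<le> 2 * real m + g\<^sup>2"
  proof -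
    have "2 * \<bar>G\<bar> * 1 \<le> G\<^sup>2 / real m + real m"
      using zero_le_power2[of "\<bar>G\<bar> / sqrt (real m) - sqrt (real m)"] m0
      by (simp add: power2_diff power_divide)
    also have "G\<^sup>2 / real m = g\<^sup>2 / 2" unfolding G2 using m0 by simp
    finally have "\<bar>G\<bar> \<le> real m + g\<^sup>2" using m0 zero_le_power2[of g] by linarith
    then show ?thesis using dm by linarith
  qed
  define E where "E = 1 + g\<^sup>2 + w\<^sup>2 / real m"
  have E: "1 \<le> E" "g\<^sup>2 \<le> E" "w\<^sup>2 / real m \<le> E" using m0 by (simp_all add: E_def)
  consider "m < 2 ^ 20" | "\<bar>w\<bar> > real m / 4" | "m \<ge> 2 ^ 20" "\<bar>d\<bar> + 2 > real m / 32"
    | "m \<ge> 2 ^ 20" "\<bar>w\<bar> \<le> real m / 4" "\<bar>d\<bar> + 2 \<le> real m / 32" by linarith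
  then have "\<bar>d - G\<bar> \<le> 4194304 * E"
  proof cases
    case 1
    then have "real m \<le> 1048576" by simp
    then show ?thesis using crude E by linarith
  next
    case 2
    then have "(real m / 4)\<^sup>2 \<le> \<bar>w\<bar>\<^sup>2" using m0 by (intro power_mono) auto
    then have "real m \<le> 16 * (w\<^sup>2 / real m)" using m0 by (simp add: field_simps power2_eq_square)
    then show ?thesis using crude E by linarith
  next
    case 3
    then have "real m \<ge> 1048576" by simp
    then have "real m / 64 \<le> \<bar>G\<bar>" using 3 dG by linarith
    then have "(real m / 64)\<^sup>2 \<le> \<bar>G\<bar>\<^sup>2" using m0 by (intro power_mono) auto
    then have "real m * real m \<le> real m * (2048 * g\<^sup>2)" using G2 by (simp add: power_divide power2_eq_square)
    then have "real m \<le> 2048 * g\<^sup>2" using m0 by (simp only: mult_le_cancel_left_pos)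
    then show ?thesis using crude E by linarith
  next
    case 4
    have m20: "real m \<ge> 1048576" using 4 by simp
    define h where "h x = x + 1000 * (1 + (x\<^sup>2 + w\<^sup>2) / real m)" for x
    have tail: "Z * normal_tail (h x / \<sigma>) \<le> sum (hyp_weight m l) {j..l}"
      if "x = 2 * real j - real l" "0 \<le> x" "x \<le> \<bar>d\<bar> + 2" for x j
      unfolding h_def Z_def \<sigma>_def
      by (rule hyp_tail_ge_local[OF 4(1) l _ that(1) _ w_def 4(2)]) (use that 4 in linarith)+
    \<comment> \<open>The neighbouring index enters on either side: through \<open>hi\<close> on the
      right, through reflection on the left. It changes the deviation by 2.\<close>
    define e where "e = \<bar>d\<bar> + 2"
    have "G - d \<le> 3 + 1000 * (1 + (e\<^sup>2 + w\<^sup>2) / real m)"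
    proof (cases "0 \<le> d")
      case True
      have "Z * normal_tail (h (d + 2) / \<sigma>) \<le> sum (hyp_weight m l) {Suc k..l}"
        by (rule tail) (use True in \<open>auto simp: d_def\<close>)
      then have "Z * normal_tail (h (d + 2) / \<sigma>) < Z * normal_tail g" using hi unfolding Z_def by linarith
      then have "G \<le> h (d + 2)" using Z0 by (intro cmp') simp
      then show ?thesis using True by (simp add: h_def e_def)
    next
      case False
      then have "Suc (2 * k) \<le> l" unfolding d_def by linarith
      then have "d \<le> -1" unfolding d_def by linarith
      then have "G - d \<le> 3" using dn by simp
      then show ?thesis using m0 by (smt (verit) divide_nonneg_pos zero_le_power2)
    qed
    moreover have "d - G \<le> 3 + 1000 * (1 + (e\<^sup>2 + w\<^sup>2) / real m)"
    proof (cases "d \<le> 0")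
      case True
      have "Z * normal_tail (h (- d + 2) / \<sigma>) \<le> sum (hyp_weight m l) {Suc l - k..l}"
        by (rule tail) (use True k in \<open>auto simp: d_def of_nat_diff\<close>)
      then have "Z * normal_tail g \<le> Z - Z * normal_tail (h (- d + 2) / \<sigma>)"
        using lo compl[of k] k unfolding Z_def by linarith
      moreover have "normal_tail (- h (- d + 2) / \<sigma>) = 1 - normal_tail (h (- d + 2) / \<sigma>)"
        using normal_tail_minus[of "h (- d + 2) / \<sigma>"] by simp
      ultimately have "Z * normal_tail g \<le> Z * normal_tail (- h (- d + 2) / \<sigma>)"
        by (simp only: right_diff_distrib mult_1_right)
      then have "- h (- d + 2) \<le> G" using Z0 by (intro cmp) simp
      then show ?thesis using True by (simp add: h_def e_def)
    next
      case False
      then have "Suc l \<le> 2 * k" unfolding d_def by linarith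
      then have "1 \<le> d" unfolding d_def by linarith
      then have "d - G \<le> 3" using up by simp
      then show ?thesis using m0 by (smt (verit) divide_nonneg_pos zero_le_power2)
    qed
    ultimately have 1: "\<bar>d - G\<bar> \<le> 3 + 1000 * (1 + (e\<^sup>2 + w\<^sup>2) / real m)" by linarith
    have "e\<^sup>2 \<le> (\<bar>G\<bar> + 5)\<^sup>2" unfolding e_def using dG by (intro power_mono) auto
    also have "\<dots> \<le> 2 * G\<^sup>2 + 50"
      using zero_le_power2[of "\<bar>G\<bar> - 5"] by (simp add: power2_sum power2_diff)
    also have "\<dots> \<le> real m * g\<^sup>2 + 50 * real m" unfolding G2 using m20 by simp
    finally have "e\<^sup>2 / real m \<le> g\<^sup>2 + 50" using m0 by (simp add: divide_le_eq algebra_simps)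
    then show ?thesis using 1 E unfolding add_divide_distrib by argo
  qed
  then show ?thesis by (simp add: d_def G_def \<sigma>_def E_def w_def)
qed

section \<open>Decomposition of random walk bridges\<close>

text \<open>Concatenation of walks: up to \<open>m\<close> truncated subtraction yields
  \<open>v 0\<close>, which is 0 for a walk, and after \<open>m\<close> a walk \<open>u\<close> of
  length \<open>m\<close> stays at \<open>u m\<close>.\<close>

definition glue :: "nat \<Rightarrow> (nat \<Rightarrow> int) \<Rightarrow> (nat \<Rightarrow> int) \<Rightarrow> nat \<Rightarrow> int" where
  "glue m u v = (\<lambda>i. u i + v (i - m))"

definition walk_law :: "nat \<Rightarrow> int pmf" where
  "walk_law n = map_pmf (\<lambda>S. S n) (srw_pmf n)"

definition mid_law :: "nat \<Rightarrow> nat \<Rightarrow> int \<Rightarrow> int pmf" where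
  "mid_law m k z = map_pmf (\<lambda>S. S m) (srw_cond_pmf (m + k) z)"

lemma Pi_pmf_lessThan_add:
  fixes m k :: nat
  shows "Pi_pmf {..<m + k} d (\<lambda>_. P) = map_pmf (\<lambda>(f, g) i. if i < m then f i else g (i - m))
     (pair_pmf (Pi_pmf {..<m} d (\<lambda>_. P)) (Pi_pmf {..<k} d (\<lambda>_. P)))"
proof -
  \<comment> \<open>Indices below \<open>m\<close> are sent to \<open>k\<close>, which lies outside
    \<open>{..<k}\<close>, so that the default value is read there.\<close>
  define h where "h i = (if m \<le> i then i - m else k)" for i
  have "bij_betw h {m..<m + k} {..<k}"
    by (rule bij_betwI[where g="\<lambda>i. i + m"]) (auto simp: h_def)
  then have 1: "Pi_pmf {m..<m + k} d (\<lambda>_. P) = map_pmf (\<lambda>g. g \<circ> h) (Pi_pmf {..<k} d (\<lambda>_. P))"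
    by (rule Pi_pmf_bij_betw[rotated]) (auto simp: h_def)
  have "{..<m + k} = {..<m} \<union> {m..<m + k}" by auto
  then have "Pi_pmf {..<m + k} d (\<lambda>_. P) = Pi_pmf ({..<m} \<union> {m..<m + k}) d (\<lambda>_. P)"
    by (rule arg_cong)
  also have "\<dots> = map_pmf (\<lambda>(f, g) x. if x \<in> {..<m} then f x else g x)
      (pair_pmf (Pi_pmf {..<m} d (\<lambda>_. P)) (Pi_pmf {m..<m + k} d (\<lambda>_. P)))"
    by (rule Pi_pmf_union) auto
  also have "pair_pmf (Pi_pmf {..<m} d (\<lambda>_. P)) (Pi_pmf {m..<m + k} d (\<lambda>_. P))
     = map_pmf (\<lambda>(f, g). (f, g \<circ> h)) (pair_pmf (Pi_pmf {..<m} d (\<lambda>_. P)) (Pi_pmf {..<k} d (\<lambda>_. P)))"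
    using map_pair[of "\<lambda>f. f" "\<lambda>g. g \<circ> h" "Pi_pmf {..<m} d (\<lambda>_. P)" "Pi_pmf {..<k} d (\<lambda>_. P)"] by (simp add: 1)
  finally show ?thesis
    unfolding map_pmf_comp
    by (rule trans) (intro map_pmf_cong, auto simp: h_def fun_eq_iff)
qed

lemma sum_if_shift:
  fixes f g :: "nat \<Rightarrow> int"
  assumes "\<And>i. m \<le> i \<Longrightarrow> f i = 0"
  shows "(\<Sum>i<j. if i < m then f i else g (i - m)) = (\<Sum>i<j. f i) + (\<Sum>i<j - m. g i)"
  by (induction j) (use assms in \<open>auto simp: Suc_diff_le not_less\<close>)

lemma steps_support:
  fixes n i :: nat
  assumes "\<xi> \<in> set_pmf (Pi_pmf {..<n} 0 (\<lambda>_. pmf_of_set {-1, 1 :: int}))"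
  shows "n \<le> i \<Longrightarrow> \<xi> i = 0"
  using assms by (auto simp: set_Pi_pmf PiE_dflt_def)

lemma srw_pmf_add:
  "srw_pmf (m + k) = map_pmf (\<lambda>(u, v). glue m u v) (pair_pmf (srw_pmf m) (srw_pmf k))"
  unfolding srw_pmf_def Pi_pmf_lessThan_add map_pair[symmetric] map_pmf_comp glue_def
  by (intro map_pmf_cong) (auto simp: fun_eq_iff sum_if_shift steps_support)

lemma finite_set_srw_pmf: "finite (set_pmf (srw_pmf n))"
  unfolding srw_pmf_def by (auto simp: set_Pi_pmf intro!: finite_PiE_dflt)

lemma srw_pmf_const:
  assumes "S \<in> set_pmf (srw_pmf n)" "n \<le> j"
  shows "S j = S n"
proof -
  obtain \<xi> where \<xi>: "\<xi> \<in> set_pmf (Pi_pmf {..<n} 0 (\<lambda>_. pmf_of_set {-1, 1 :: int}))" "S = (\<lambda>m. \<Sum>i<m. \<xi> i)"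
    using assms by (auto simp: srw_pmf_def)
  have "(\<Sum>i<j. \<xi> i) = (\<Sum>i<n. \<xi> i)"
    using assms(2) steps_support[OF \<xi>(1)] by (intro sum.mono_neutral_right) auto
  with \<xi> show ?thesis by simp
qed

lemma srw_pmf_0: "S \<in> set_pmf (srw_pmf n) \<Longrightarrow> S 0 = 0"
  by (auto simp: srw_pmf_def)

lemma walk_law_0: "walk_law 0 = return_pmf 0"
  by (simp add: walk_law_def srw_pmf_def)

lemma walk_law_1: "walk_law (Suc 0) = pmf_of_set {-1, 1}"
  unfolding walk_law_def srw_pmf_def map_pmf_comp
  using Pi_pmf_component[of "{..<Suc 0}" 0 0 "\<lambda>_. pmf_of_set {-1, 1 :: int}"] by simp

lemma glue_end:
  assumes "u \<in> set_pmf (srw_pmf m)"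
  shows "glue m u v (m + k) = u m + v k"
  using srw_pmf_const[OF assms, of "m + k"] by (simp add: glue_def)

lemma walk_law_add:
  "walk_law (m + k) = map_pmf (\<lambda>(a, b). a + b) (pair_pmf (walk_law m) (walk_law k))"
  unfolding walk_law_def srw_pmf_add map_pair[symmetric] map_pmf_comp
  by (intro map_pmf_cong) (auto simp: glue_end)

lemma pmf_walk_law_Suc:
  "pmf (walk_law (Suc n)) x = (pmf (walk_law n) (x - 1) + pmf (walk_law n) (x + 1)) / 2"
proof -
  have "walk_law (Suc n) = map_pmf (\<lambda>(a, b). a + b) (pair_pmf (pmf_of_set {-1, 1}) (walk_law n))"
    using walk_law_add[of 1 n] by (simp add: walk_law_1)
  also have "\<dots> = bind_pmf (pmf_of_set {-1, 1}) (\<lambda>a. map_pmf (\<lambda>b. a + b) (walk_law n))"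
    by (simp add: pair_pmf_def map_bind_pmf map_pmf_def bind_assoc_pmf bind_return_pmf)
  finally have "pmf (walk_law (Suc n)) x = (\<Sum>a\<in>{-1, 1}. pmf (map_pmf (\<lambda>b. a + b) (walk_law n)) x) / 2"
    by (simp add: pmf_bind_pmf_of_set)
  moreover have "pmf (map_pmf (\<lambda>b. a + b) (walk_law n)) x = pmf (walk_law n) (x - a)" for a
    using pmf_map_inj'[of "\<lambda>b. a + b" "walk_law n" "x - a"] by (simp add: inj_def)
  ultimately show ?thesis by (simp add: add.commute)
qed

lemma set_walk_law_subset: "x \<in> set_pmf (walk_law n) \<Longrightarrow> \<exists>k\<le>n. x = 2 * int k - int n"
proof (induction n arbitrary: x)
  case 0
  then show ?case by (simp add: walk_law_0)
next
  case (Suc n)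
  then have "pmf (walk_law n) (x - 1) \<noteq> 0 \<or> pmf (walk_law n) (x + 1) \<noteq> 0"
    by (auto simp: set_pmf_iff pmf_walk_law_Suc)
  then consider "x - 1 \<in> set_pmf (walk_law n)" | "x + 1 \<in> set_pmf (walk_law n)" by (auto simp: set_pmf_iff)
  then show ?case
  proof cases
    case 1
    then obtain k where "k \<le> n" "x - 1 = 2 * int k - int n" using Suc.IH by blast
    then show ?thesis by (intro exI[of _ "Suc k"]) auto
  next
    case 2
    then obtain k where "k \<le> n" "x + 1 = 2 * int k - int n" using Suc.IH by blast
    then show ?thesis by (intro exI[of _ k]) auto
  qed
qed

lemma pmf_walk_law: "pmf (walk_law n) (2 * int k - int n) = real (n choose k) / 2 ^ n"
proof (induction n arbitrary: k)
  case 0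
  then show ?case by (cases k) (auto simp: walk_law_0)
next
  case (Suc n)
  have 1: "pmf (walk_law n) (2 * int k - int (Suc n) + 1) = real (n choose k) / 2 ^ n"
    using Suc.IH[of k] by simp
  have 2: "pmf (walk_law n) (2 * int k - int (Suc n) - 1) = (case k of 0 \<Rightarrow> 0 | Suc j \<Rightarrow> real (n choose j) / 2 ^ n)"
  proof (cases k)
    case 0
    have "2 * int k - int (Suc n) - 1 \<notin> set_pmf (walk_law n)"
      using set_walk_law_subset[of "2 * int k - int (Suc n) - 1" n] 0 by auto
    then show ?thesis using 0 by (simp add: set_pmf_iff)
  next
    case (Suc j)
    then show ?thesis using Suc.IH[of j] by (simp add: algebra_simps)
  qed
  show ?case unfolding pmf_walk_law_Suc 1 2 by (cases k) (auto simp: field_simps)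
qed

section \<open>Conditioned walks and their Markov property at the cut\<close>

lemma L_eq: "L n = set_pmf (walk_law n)"
  unfolding L_def walk_law_def
  by (auto simp: set_pmf_iff pmf_map vimage_def zero_less_measure_iff simp del: set_map_pmf)

lemma L_bound: "z \<in> L n \<Longrightarrow> \<bar>z\<bar> \<le> int n"
  unfolding L_eq using set_walk_law_subset[of z n] by auto

lemma finite_L: "finite (L n)"
  unfolding L_eq walk_law_def using finite_set_srw_pmf by simp

lemma srw_cond_nonempty: "z \<in> L n \<Longrightarrow> set_pmf (srw_pmf n) \<inter> {S. S n = z} \<noteq> {}"
  unfolding L_eq walk_law_def by auto

lemma set_srw_cond_pmf: "z \<in> L n \<Longrightarrow> set_pmf (srw_cond_pmf n z) = set_pmf (srw_pmf n) \<inter> {S. S n = z}"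
  unfolding srw_cond_pmf_def by (rule set_cond_pmf[OF srw_cond_nonempty])

lemma measure_pmf_cong_support:
  assumes "set_pmf p \<inter> A = set_pmf p \<inter> B"
  shows "measure_pmf.prob p A = measure_pmf.prob p B"
  using assms by (metis Int_commute measure_Int_set_pmf)

lemma cond_pmf_cong:
  assumes "set_pmf p \<inter> A \<noteq> {}" "set_pmf p \<inter> A = set_pmf p \<inter> B"
  shows "cond_pmf p A = cond_pmf p B"
proof (rule pmf_eqI)
  fix x
  have ne: "set_pmf p \<inter> B \<noteq> {}" using assms by simp
  note eqs = pmf_cond[OF assms(1)] pmf_cond[OF ne] measure_pmf_cong_support[OF assms(2)]
  show "pmf (cond_pmf p A) x = pmf (cond_pmf p B) x"
  proof (cases "pmf p x = 0")
    case True
    then show ?thesis unfolding eqs by simp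
  next
    case False
    then have "x \<in> set_pmf p" by (simp add: set_pmf_iff)
    then have "x \<in> A \<longleftrightarrow> x \<in> B" using assms(2) by blast
    then show ?thesis unfolding eqs by simp
  qed
qed

text \<open>On \<open>f u = x\<close> the conditioning event is the rectangle
  \<open>{u. f u = x} \<times> {v. g v = z - x}\<close>. Given \<open>x\<close>, the two coordinates
  therefore stay independent and are conditioned separately.\<close>

lemma cond_pair_pmf_sum:
  fixes U :: "'a pmf" and V :: "'b pmf" and f :: "'a \<Rightarrow> int" and g :: "'b \<Rightarrow> int"
  assumes ne: "set_pmf (pair_pmf U V) \<inter> {(u, v). f u + g v = z} \<noteq> {}"
  defines "Q \<equiv> cond_pmf (pair_pmf U V) {(u, v). f u + g v = z}"
  shows "pmf (map_pmf (\<lambda>(u, v). f u) Q) x = measure U {u. f u = x} * measure V {v. g v = z - x}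
           / measure (pair_pmf U V) {(u, v). f u + g v = z}" (is ?A)
    and "Q = bind_pmf (map_pmf (\<lambda>(u, v). f u) Q)
           (\<lambda>x. pair_pmf (cond_pmf U {u. f u = x}) (cond_pmf V {v. g v = z - x}))" (is ?B)
proof -
  define c where "c = measure (pair_pmf U V) {(u, v). f u + g v = z}"
  have c0: "c \<noteq> 0" unfolding c_def by (rule measure_measure_pmf_not_zero[OF ne])
  have A: "pmf (map_pmf (\<lambda>(u, v). f u) Q) x = measure U {u. f u = x} * measure V {v. g v = z - x} / c" for x
  proof -
    have "pmf (map_pmf (\<lambda>(u, v). f u) Q) x = measure Q {(u, v). f u = x}"
      unfolding pmf_map by (rule arg_cong[where f="measure Q"]) auto
    also have "\<dots> = measure (pair_pmf U V) ({(u, v). f u = x} \<inter> {(u, v). f u + g v = z}) / c"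
      unfolding Q_def c_def cond_pmf.rep_eq[OF ne]
      by (subst measure_uniform_measure) (auto simp: emeasure_measure_pmf_not_zero[OF ne] Int_commute)
    also have "{(u, v). f u = x} \<inter> {(u, v). f u + g v = z} = {u. f u = x} \<times> {v. g v = z - x}" by auto
    also have "measure (pair_pmf U V) \<dots> = measure U {u. f u = x} * measure V {v. g v = z - x}"
    proof -
      have "emeasure (pair_pmf U V) ({u. f u = x} \<times> {v. g v = z - x})
          = (\<integral>\<^sup>+a. \<integral>\<^sup>+b. indicator {u. f u = x} a * indicator {v. g v = z - x} b \<partial>V \<partial>U)"
        by (subst nn_integral_indicator[symmetric], simp, subst nn_integral_pair_pmf')
           (auto simp: indicator_def intro!: nn_integral_cong)
      also have "\<dots> = emeasure U {u. f u = x} * emeasure V {v. g v = z - x}"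
        by (simp add: nn_integral_cmult nn_integral_multc)
      finally show ?thesis
        by (simp add: measure_pmf.emeasure_eq_measure flip: ennreal_mult)
    qed
    finally show ?thesis .
  qed
  then show ?A by (simp add: c_def)
  show ?B
  proof (rule pmf_eqI)
    fix uv :: "'a \<times> 'b"
    obtain u v where uv: "uv = (u, v)" by (cases uv)
    define N where "N = map_pmf (\<lambda>(u, v). f u) Q"
    define F where "F x = pair_pmf (cond_pmf U {u. f u = x}) (cond_pmf V {v. g v = z - x})" for x
    have neN: "set_pmf U \<inter> {u. f u = x} \<noteq> {}" "set_pmf V \<inter> {v. g v = z - x} \<noteq> {}" if "x \<in> set_pmf N" for x
      using that unfolding N_def Q_def by (auto simp: set_cond_pmf[OF ne])
    have F: "pmf (F x) (u, v) = (if f u = x then pmf U u / measure U {u. f u = x} else 0)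
        * (if g v = z - x then pmf V v / measure V {v. g v = z - x} else 0)" if "x \<in> set_pmf N" for x
      unfolding F_def pmf_pair using neN[OF that] by (simp add: pmf_cond)
    have "pmf (bind_pmf N F) (u, v) = (\<integral>x. pmf (F x) (u, v) \<partial>N)" by (rule pmf_bind)
    \<comment> \<open>For a fixed pair only the value \<open>x = f u\<close> contributes.\<close>
    also have "\<dots> = (\<Sum>x\<in>{f u}. pmf (F x) (u, v) * pmf N x)"
      by (rule integral_measure_pmf_real) (auto simp: F split: if_splits)
    also have "\<dots> = pmf Q (u, v)"
    proof (cases "f u \<in> set_pmf N")
      case True
      then show ?thesis
        using measure_measure_pmf_not_zero[OF neN(1)[OF True]] measure_measure_pmf_not_zero[OF neN(2)[OF True]]
        by (auto simp: F[OF True] A[folded N_def] Q_def pmf_cond[OF ne] pmf_pair c_def)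
    next
      case False
      then have "(u, v) \<notin> set_pmf Q" unfolding N_def by (auto simp: image_iff)
      then show ?thesis using False by (simp add: set_pmf_iff)
    qed
    finally show "pmf Q uv = pmf (bind_pmf (map_pmf (\<lambda>(u, v). f u) Q) (\<lambda>x. pair_pmf (cond_pmf U {u. f u = x}) (cond_pmf V {v. g v = z - x}))) uv"
      unfolding uv N_def F_def[abs_def] by simp
  qed
qed

text \<open>The Markov property of the walk bridge at time \<open>m\<close>: a glued path ends at
  \<open>u m + v k\<close>, so conditioning the long walk amounts to conditioning an independent
  pair on a sum.\<close>

lemma srw_cond_pmf_add:
  assumes z: "z \<in> L (m + k)"
  shows "srw_cond_pmf (m + k) z
     = bind_pmf (mid_law m k z) (\<lambda>x. map_pmf (\<lambda>(u, v). glue m u v) (pair_pmf (srw_cond_pmf m x) (srw_cond_pmf k (z - x))))"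
    and "pmf (mid_law m k z) x = pmf (walk_law m) x * pmf (walk_law k) (z - x) / pmf (walk_law (m + k)) z"
proof -
  let ?P = "pair_pmf (srw_pmf m) (srw_pmf k)"
  let ?A = "{(u, v). u m + v k = z}"
  define Q where "Q = cond_pmf ?P ?A"
  have vim: "set_pmf ?P \<inter> (\<lambda>(u, v). glue m u v) -` {S. S (m + k) = z} = set_pmf ?P \<inter> ?A"
    by (auto simp: glue_end)
  have "set_pmf (srw_pmf (m + k)) \<inter> {S. S (m + k) = z} \<noteq> {}" by (rule srw_cond_nonempty[OF z])
  then have ne': "set_pmf ?P \<inter> (\<lambda>(u, v). glue m u v) -` {S. S (m + k) = z} \<noteq> {}"
    unfolding srw_pmf_add by auto
  then have ne: "set_pmf ?P \<inter> ?A \<noteq> {}" unfolding vim .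
  have 1: "srw_cond_pmf (m + k) z = map_pmf (\<lambda>(u, v). glue m u v) Q"
    unfolding srw_cond_pmf_def srw_pmf_add cond_map_pmf[OF ne'] Q_def
    by (subst cond_pmf_cong[OF ne' vim]) simp
  have mid: "mid_law m k z = map_pmf (\<lambda>(u, v). u m) Q"
    unfolding mid_law_def 1 map_pmf_comp
  proof (intro map_pmf_cong refl)
    fix uv assume "uv \<in> set_pmf Q"
    then have "snd uv \<in> set_pmf (srw_pmf k)" unfolding Q_def by (auto simp: set_cond_pmf[OF ne])
    then show "(case uv of (u, v) \<Rightarrow> glue m u v) m = (case uv of (u, v) \<Rightarrow> u m)"
      using srw_pmf_0[of "snd uv" k] by (cases uv) (simp add: glue_def)
  qed
  note * = cond_pair_pmf_sum[where f="\<lambda>u. u m" and g="\<lambda>v. v k", OF ne, folded Q_def, folded mid]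
  show "srw_cond_pmf (m + k) z
     = bind_pmf (mid_law m k z) (\<lambda>x. map_pmf (\<lambda>(u, v). glue m u v) (pair_pmf (srw_cond_pmf m x) (srw_cond_pmf k (z - x))))"
    unfolding 1 by (subst *(2)) (simp add: map_bind_pmf srw_cond_pmf_def)
  have "pmf (walk_law (m + k)) z = measure ?P ?A"
    unfolding walk_law_def srw_pmf_add map_pmf_comp pmf_map
    by (rule measure_pmf_cong_support) (auto simp: glue_end)
  then show "pmf (mid_law m k z) x = pmf (walk_law m) x * pmf (walk_law k) (z - x) / pmf (walk_law (m + k)) z"
    unfolding *(1) by (simp add: walk_law_def pmf_map vimage_def)
qed

lemma set_mid_law:
  assumes "z \<in> L (m + k)" "x \<in> set_pmf (mid_law m k z)"
  shows "x \<in> L m" "z - x \<in> L k"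
  using assms(2) by (auto simp: set_pmf_iff srw_cond_pmf_add(2)[OF assms(1)] L_eq)

lemma finite_set_mid_law: "z \<in> L (m + k) \<Longrightarrow> finite (set_pmf (mid_law m k z))"
  by (rule finite_subset[OF _ finite_L[of m]]) (auto intro: set_mid_law)

text \<open>Coordinates by numbers of up-steps, \<open>l\<close> for the whole walk and
  \<open>k\<close> for its first half; in them the law of the midpoint is hypergeometric.\<close>

lemma mid_law_half:
  assumes z: "z \<in> L (m + m)"
  obtains l where "l \<le> 2 * m" "z = 2 * int l - 2 * int m"
    "\<And>x. x \<in> set_pmf (mid_law m m z) \<Longrightarrow> \<exists>k. k \<le> m \<and> k \<le> l \<and> l - k \<le> m \<and> x = 2 * int k - int m"
    "\<And>k. k \<le> l \<Longrightarrow> pmf (mid_law m m z) (2 * int k - int m) = hyp_weight m l k / real (2 * m choose l)"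
    "\<And>k. measure (mid_law m m z) {2 * int k - int m..} = sum (hyp_weight m l) {k..l} / real (2 * m choose l)"
proof -
  obtain l where l: "l \<le> 2 * m" "z = 2 * int l - 2 * int m"
    using z set_walk_law_subset[of z "m + m"] unfolding L_eq by force
  have supp: "\<exists>k. k \<le> m \<and> k \<le> l \<and> l - k \<le> m \<and> x = 2 * int k - int m" if x: "x \<in> set_pmf (mid_law m m z)" for x
  proof -
    obtain k where k: "k \<le> m" "x = 2 * int k - int m"
      using set_mid_law(1)[OF z x] set_walk_law_subset[of x m] unfolding L_eq by auto
    obtain j where j: "j \<le> m" "z - x = 2 * int j - int m"
      using set_mid_law(2)[OF z x] set_walk_law_subset[of "z - x" m] unfolding L_eq by auto
    have "l = k + j" using k j l by linarith
    then show ?thesis using k j by auto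
  qed
  have pmf: "pmf (mid_law m m z) (2 * int k - int m) = hyp_weight m l k / real (2 * m choose l)" if "k \<le> l" for k
  proof -
    have 1: "z - (2 * int k - int m) = 2 * int (l - k) - int m" using that l by (simp add: of_nat_diff)
    have 2: "z = 2 * int l - int (m + m)" using l by simp
    show ?thesis
      unfolding srw_cond_pmf_add(2)[OF z] 1 pmf_walk_law
      unfolding 2 pmf_walk_law using that by (simp add: hyp_weight_def power_add mult_2)
  qed
  have tail: "measure (mid_law m m z) {2 * int k - int m..} = sum (hyp_weight m l) {k..l} / real (2 * m choose l)" for k
  proof -
    have "measure (mid_law m m z) {2 * int k - int m..} = measure (mid_law m m z) ((\<lambda>j. 2 * int j - int m) ` {k..l})"
      using supp by (intro measure_pmf.finite_measure_eq_AE) (force simp: AE_measure_pmf_iff)+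
    also have "\<dots> = (\<Sum>x\<in>(\<lambda>j. 2 * int j - int m) ` {k..l}. pmf (mid_law m m z) x)"
      by (rule measure_measure_pmf_finite) simp
    also have "\<dots> = (\<Sum>j\<in>{k..l}. pmf (mid_law m m z) (2 * int j - int m))"
      by (subst sum.reindex) (auto simp: inj_on_def)
    also have "\<dots> = (\<Sum>j\<in>{k..l}. hyp_weight m l j / real (2 * m choose l))"
      by (intro sum.cong) (auto simp: pmf)
    finally show ?thesis by (simp add: sum_divide_distrib)
  qed
  show ?thesis by (rule that[OF l]) (use supp pmf tail in auto)
qed

section \<open>Exponential moments at the midpoint\<close>

lemma sinh_le_mult_cosh:
  fixes x :: real
  assumes "0 \<le> x"
  shows "sinh x \<le> x * cosh x"
proof -
  have "(\<lambda>x. x * cosh x - sinh x) 0 \<le> (\<lambda>x. x * cosh x - sinh x) x"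
  proof (rule DERIV_nonneg_imp_nondecreasing[OF assms])
    fix y :: real assume "0 \<le> y" "y \<le> x"
    then have "0 \<le> y * sinh y" by simp
    moreover have "((\<lambda>x. x * cosh x - sinh x) has_real_derivative y * sinh y) (at y)"
      by (auto intro!: derivative_eq_intros)
    ultimately show "\<exists>z. ((\<lambda>x. x * cosh x - sinh x) has_real_derivative z) (at y) \<and> 0 \<le> z" by blast
  qed
  then show ?thesis by simp
qed

text \<open>Compare logarithms: the derivative of \<open>x^2 / 2 - ln (cosh x)\<close> is
  \<open>x - sinh x / cosh x\<close>, which is nonnegative for \<open>x \<ge> 0\<close>.\<close>

lemma cosh_le_exp_square:
  fixes x :: real
  shows "cosh x \<le> exp (x\<^sup>2 / 2)"
proof -
  have *: "cosh x \<le> exp (x\<^sup>2 / 2)" if "0 \<le> x" for x :: real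
  proof -
    have "(\<lambda>x. x\<^sup>2 / 2 - ln (cosh x)) 0 \<le> (\<lambda>x. x\<^sup>2 / 2 - ln (cosh x)) x"
    proof (rule DERIV_nonneg_imp_nondecreasing[OF that])
      fix y :: real assume y: "0 \<le> y" "y \<le> x"
      have "0 \<le> y - sinh y / cosh y"
        using sinh_le_mult_cosh[OF y(1)] by (simp add: divide_le_eq)
      moreover have "((\<lambda>x. x\<^sup>2 / 2 - ln (cosh x)) has_real_derivative y - sinh y / cosh y) (at y)"
        by (auto intro!: derivative_eq_intros)
      ultimately show "\<exists>z. ((\<lambda>x. x\<^sup>2 / 2 - ln (cosh x)) has_real_derivative z) (at y) \<and> 0 \<le> z" by blast
    qed
    then have "ln (cosh x) \<le> x\<^sup>2 / 2" by simp
    then have "exp (ln (cosh x)) \<le> exp (x\<^sup>2 / 2)" by (simp only: exp_le_cancel_iff)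
    then show ?thesis by simp
  qed
  show ?thesis using *[of x] *[of "- x"] by (cases "0 \<le> x") auto
qed

lemma coeff_mult_mono:
  fixes p q p' q' :: "real poly"
  assumes "\<And>i. 0 \<le> coeff p i" "\<And>i. coeff p i \<le> coeff q i" "\<And>i. 0 \<le> coeff p' i" "\<And>i. coeff p' i \<le> coeff q' i"
  shows "0 \<le> coeff (p * p') i" "coeff (p * p') i \<le> coeff (q * q') i"
  unfolding coeff_mult using assms by (auto intro!: sum_nonneg sum_mono mult_mono order_trans[OF assms(1,2)])

lemma coeff_power_mono:
  fixes p q :: "real poly"
  assumes "\<And>i. 0 \<le> coeff p i" "\<And>i. coeff p i \<le> coeff q i"
  shows "0 \<le> coeff (p ^ m) i \<and> coeff (p ^ m) i \<le> coeff (q ^ m) i"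
proof (induction m arbitrary: i)
  case 0
  then show ?case by simp
next
  case (Suc m)
  then show ?case using assms coeff_mult_mono[of p q "p ^ m" "q ^ m"] by simp
qed

lemma coeff_one_plus_power: "coeff ([:1, b:] ^ m) i = real (m choose i) * b ^ i"
proof (cases "i \<le> m")
  case True
  then show ?thesis by (simp add: coeff_linear_poly_power)
next
  case False
  have "degree ([:1, b:] ^ m) \<le> degree [:1, b:] * m" by (rule degree_power_le)
  also have "\<dots> \<le> 1 * m" by (rule mult_le_mono1) simp
  finally have "degree ([:1, b:] ^ m) < i" using False by simp
  then show ?thesis using False by (simp add: coeff_eq_0 binomial_eq_0)
qed

text \<open>The left side is the coefficient of \<open>X^l\<close> in \<open>((1 + e^t X)(1 + e^(-t) X))^m\<close>, whose base
  \<open>1 + 2 cosh t X + X^2\<close> is dominated coefficientwise by \<open>cosh t (1 + X)^2\<close>.\<close>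

lemma hyp_weight_mgf:
  "(\<Sum>k\<le>l. hyp_weight m l k * exp (t * (2 * real k - real l))) \<le> cosh t ^ m * real (2 * m choose l)"
proof -
  define P where "P = [:1, exp t:] * [:1, exp (- t):]"
  define Q where "Q = smult (cosh t) ([:1, 1:] * [:1, 1:])"
  have c1: "1 \<le> cosh t" by (rule cosh_real_ge_1)
  have P: "P = [:1, 2 * cosh t, 1:]" unfolding P_def by (simp add: cosh_def exp_minus field_simps)
  have Q: "Q = [:cosh t, 2 * cosh t, cosh t:]" unfolding Q_def by simp
  have "(\<Sum>k\<le>l. hyp_weight m l k * exp (t * (2 * real k - real l)))
      = (\<Sum>k\<le>l. (real (m choose k) * exp t ^ k) * (real (m choose (l - k)) * exp (- t) ^ (l - k)))"
  proof (intro sum.cong refl)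
    fix k assume "k \<in> {..l}"
    then have "exp (t * (2 * real k - real l)) = exp t ^ k * exp (- t) ^ (l - k)"
      by (simp add: of_nat_diff algebra_simps flip: exp_of_nat_mult exp_add)
    then show "hyp_weight m l k * exp (t * (2 * real k - real l))
      = (real (m choose k) * exp t ^ k) * (real (m choose (l - k)) * exp (- t) ^ (l - k))"
      using \<open>k \<in> {..l}\<close> by (simp add: hyp_weight_def)
  qed
  also have "\<dots> = coeff ([:1, exp t:] ^ m * [:1, exp (- t):] ^ m) l"
    unfolding coeff_mult coeff_one_plus_power ..
  also have "\<dots> = coeff (P ^ m) l" by (simp only: P_def power_mult_distrib)
  also have "\<dots> \<le> coeff (Q ^ m) l"
    using c1 by (intro coeff_power_mono[THEN conjunct2]) (auto simp: P Q coeff_pCons split: nat.split)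
  also have "Q ^ m = smult (cosh t ^ m) ([:1, 1:] ^ (2 * m))"
    unfolding Q_def by (simp only: smult_power power2_eq_square[symmetric] power_mult[symmetric])
  finally show ?thesis by (simp add: coeff_one_plus_power)
qed

text \<open>The midpoint is sub-Gaussian around \<open>z / 2\<close> with variance proxy
  \<open>m\<close>. This is twice the variance \<open>m / 2\<close> of the Gaussian it is coupled
  with, but it holds for every endpoint, and the factor is affordable.\<close>

lemma mid_law_mgf:
  assumes z: "z \<in> L (m + m)"
  shows "(\<integral>\<^sup>+x. ennreal (exp (t * of_int x)) \<partial>mid_law m m z) \<le> ennreal (exp (t * of_int z / 2 + real m * t\<^sup>2 / 2))"
proof -
  obtain l where l: "l \<le> 2 * m" "z = 2 * int l - 2 * int m"
    and supp: "\<And>x. x \<in> set_pmf (mid_law m m z) \<Longrightarrow> \<exists>k. k \<le> m \<and> k \<le> l \<and> l - k \<le> m \<and> x = 2 * int k - int m"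
    and pmf: "\<And>k. k \<le> l \<Longrightarrow> pmf (mid_law m m z) (2 * int k - int m) = hyp_weight m l k / real (2 * m choose l)"
    using mid_law_half[OF z] by metis
  have Z0: "real (2 * m choose l) > 0" using l by simp
  define I where "I = (\<lambda>k. 2 * int k - int m) ` {..l}"
  have "(\<integral>\<^sup>+x. ennreal (exp (t * of_int x)) \<partial>mid_law m m z) = (\<Sum>x\<in>I. ennreal (exp (t * of_int x)) * pmf (mid_law m m z) x)"
    by (rule nn_integral_measure_pmf_support) (use supp in \<open>auto simp: I_def\<close>)
  also have "\<dots> = (\<Sum>k\<le>l. ennreal (exp (t * of_int (2 * int k - int m))) * pmf (mid_law m m z) (2 * int k - int m))"
    unfolding I_def by (subst sum.reindex) (auto simp: inj_on_def)
  also have "\<dots> = (\<Sum>k\<le>l. ennreal (exp (t * of_int z / 2) / real (2 * m choose l) * (hyp_weight m l k * exp (t * (2 * real k - real l)))))"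
  proof (intro sum.cong refl)
    fix k assume "k \<in> {..l}"
    have "exp (t * of_int (2 * int k - int m)) = exp (t * of_int z / 2) * exp (t * (2 * real k - real l))"
      unfolding l(2) by (simp add: field_simps flip: exp_add)
    moreover have p: "pmf (mid_law m m z) (2 * int k - int m) = hyp_weight m l k / real (2 * m choose l)"
      using \<open>k \<in> {..l}\<close> by (intro pmf) simp
    ultimately show "ennreal (exp (t * of_int (2 * int k - int m))) * pmf (mid_law m m z) (2 * int k - int m)
        = ennreal (exp (t * of_int z / 2) / real (2 * m choose l) * (hyp_weight m l k * exp (t * (2 * real k - real l))))"
      unfolding p by (simp only:) (simp add: mult_ac flip: ennreal_mult)
  qed
  also have "\<dots> = ennreal (exp (t * of_int z / 2) / real (2 * m choose l) * (\<Sum>k\<le>l. hyp_weight m l k * exp (t * (2 * real k - real l))))"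
    unfolding sum_distrib_left by (rule sum_ennreal) auto
  also have "\<dots> \<le> ennreal (exp (t * of_int z / 2) / real (2 * m choose l) * (cosh t ^ m * real (2 * m choose l)))"
    by (intro ennreal_leI mult_left_mono hyp_weight_mgf) auto
  also have "\<dots> = ennreal (exp (t * of_int z / 2) * cosh t ^ m)" using Z0 by simp
  also have "\<dots> \<le> ennreal (exp (t * of_int z / 2) * exp (t\<^sup>2 / 2) ^ m)"
    using cosh_real_nonneg[of t] by (intro ennreal_leI mult_left_mono power_mono cosh_le_exp_square) auto
  also have "exp (t * of_int z / 2) * exp (t\<^sup>2 / 2) ^ m = exp (t * of_int z / 2 + real m * t\<^sup>2 / 2)"
    by (simp add: exp_add flip: exp_of_nat_mult)
  finally show ?thesis .
qed

text \<open>Writing \<open>exp (\<beta> X^2)\<close> as a Gaussian mixture of exponentials \<open>exp (sqrt (2 \<beta>) g X)\<close> reduces the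
  exponential moment of a square to the moment generating function.\<close>

lemma exp_square_le_of_mgf:
  fixes p :: "int pmf" and f :: "int \<Rightarrow> real"
  assumes mgf: "\<And>t. (\<integral>\<^sup>+x. ennreal (exp (t * f x)) \<partial>p) \<le> ennreal (exp (t * \<mu> + v * t\<^sup>2 / 2))"
    and \<beta>: "0 \<le> \<beta>" "2 * \<beta> * v < 1"
  shows "(\<integral>\<^sup>+x. ennreal (exp (\<beta> * (f x)\<^sup>2)) \<partial>p) \<le> ennreal (exp (\<beta> * \<mu>\<^sup>2 / (1 - 2 * \<beta> * v)) / sqrt (1 - 2 * \<beta> * v))"
proof -
  interpret N: prob_space std_normal by (rule prob_space_std_normal)
  interpret pair_sigma_finite "measure_pmf p" std_normal ..
  define \<theta> where "\<theta> = sqrt (2 * \<beta>)"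
  have \<theta>: "\<theta>\<^sup>2 = 2 * \<beta>" using \<beta> by (simp add: \<theta>_def)
  have "(\<integral>\<^sup>+x. ennreal (exp (\<beta> * (f x)\<^sup>2)) \<partial>p) = (\<integral>\<^sup>+x. \<integral>\<^sup>+g. ennreal (exp (\<theta> * g * f x)) \<partial>std_normal \<partial>p)"
  proof (intro nn_integral_cong)
    fix x
    have "(\<theta> * f x)\<^sup>2 / 2 = \<beta> * (f x)\<^sup>2" by (simp add: power_mult_distrib \<theta>)
    then show "ennreal (exp (\<beta> * (f x)\<^sup>2)) = (\<integral>\<^sup>+g. ennreal (exp (\<theta> * g * f x)) \<partial>std_normal)"
      using std_normal_exp_quadratic[of 0 "\<theta> * f x"] by (simp add: mult_ac)
  qed
  also have "\<dots> = (\<integral>\<^sup>+g. \<integral>\<^sup>+x. ennreal (exp (\<theta> * g * f x)) \<partial>p \<partial>std_normal)"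
  proof (rule Fubini'[symmetric])
    have "(\<lambda>(x, g). ennreal (exp (\<theta> * g * f x))) \<in> borel_measurable (count_space UNIV \<Otimes>\<^sub>M borel)"
      by (rule measurable_pair_measure_countable1) auto
    moreover have "sets (measure_pmf p \<Otimes>\<^sub>M std_normal) = sets (count_space UNIV \<Otimes>\<^sub>M borel)"
      by (intro sets_pair_measure_cong) auto
    ultimately show "(\<lambda>(x, g). ennreal (exp (\<theta> * g * f x))) \<in> borel_measurable (measure_pmf p \<Otimes>\<^sub>M std_normal)"
      using measurable_cong_sets by blast
  qed
  also have "\<dots> \<le> (\<integral>\<^sup>+g. ennreal (exp ((\<theta> * \<mu>) * g + (\<beta> * v) * g\<^sup>2)) \<partial>std_normal)"
  proof (intro nn_integral_mono)
    fix g :: real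
    have "(\<integral>\<^sup>+x. ennreal (exp (\<theta> * g * f x)) \<partial>p) \<le> ennreal (exp (\<theta> * g * \<mu> + v * (\<theta> * g)\<^sup>2 / 2))" by (rule mgf)
    also have "\<theta> * g * \<mu> + v * (\<theta> * g)\<^sup>2 / 2 = (\<theta> * \<mu>) * g + (\<beta> * v) * g\<^sup>2"
      by (simp add: power_mult_distrib \<theta>)
    finally show "(\<integral>\<^sup>+x. ennreal (exp (\<theta> * g * f x)) \<partial>p) \<le> ennreal (exp ((\<theta> * \<mu>) * g + (\<beta> * v) * g\<^sup>2))" .
  qed
  also have "\<dots> = ennreal (exp ((\<theta> * \<mu>)\<^sup>2 / (2 * (1 - 2 * (\<beta> * v)))) / sqrt (1 - 2 * (\<beta> * v)))"
    using \<beta> by (intro std_normal_exp_quadratic) simp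
  also have "(\<theta> * \<mu>)\<^sup>2 / (2 * (1 - 2 * (\<beta> * v))) = \<beta> * \<mu>\<^sup>2 / (1 - 2 * \<beta> * v)"
  proof -
    have "(\<theta> * \<mu>)\<^sup>2 = 2 * (\<beta> * \<mu>\<^sup>2)" unfolding power_mult_distrib \<theta> by simp
    moreover have "2 * x / (2 * y) = x / y" for x y :: real by simp
    ultimately show ?thesis by (simp only: mult.assoc)
  qed
  finally show ?thesis by (simp add: mult_ac)
qed

text \<open>With \<open>\<beta> = 1 / (8 * m)\<close> and proxy \<open>m\<close> the quantity
  \<open>1 - 2 * \<beta> * v\<close> is 3/4, and \<open>(z / 2)^2 / (8 * m)\<close> divided by it is
  \<open>z^2 / (24 * m)\<close>. The exponent is twice that of the inductive claim because AM-GM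
  will double it. The second part holds since \<open>z - x\<close> also has centre
  \<open>z / 2\<close>.\<close>

lemma mid_law_exp_square:
  assumes m: "m \<ge> 1" and z: "z \<in> L (m + m)"
  shows "(\<integral>\<^sup>+x. ennreal (exp ((of_int x)\<^sup>2 / (8 * real m))) \<partial>mid_law m m z) \<le> ennreal (2 * exp ((of_int z)\<^sup>2 / (24 * real m)))" (is ?A)
    and "(\<integral>\<^sup>+x. ennreal (exp ((of_int (z - x))\<^sup>2 / (8 * real m))) \<partial>mid_law m m z) \<le> ennreal (2 * exp ((of_int z)\<^sup>2 / (24 * real m)))" (is ?B)
proof -
  have m0: "real m > 0" using m by simp
  have s: "1 / sqrt (3 / 4) \<le> (2 :: real)"
  proof -
    have "1 / 2 \<le> sqrt (3 / 4 :: real)" by (rule real_le_rsqrt) (simp add: power2_eq_square)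
    then show ?thesis by (simp add: field_simps)
  qed
  have e: "1 - 2 * (1 / (8 * real m)) * real m = 3 / 4" using m0 by simp
  have fin: "exp (1 / (8 * real m) * (of_int z / 2)\<^sup>2 / (1 - 2 * (1 / (8 * real m)) * real m)) / sqrt (1 - 2 * (1 / (8 * real m)) * real m)
     \<le> 2 * exp ((of_int z)\<^sup>2 / (24 * real m))"
  proof -
    have "1 / (8 * real m) * (of_int z / 2)\<^sup>2 / (3 / 4) = (of_int z)\<^sup>2 / (24 * real m)"
      using m0 by (simp add: field_simps power2_eq_square)
    moreover have "exp ((of_int z)\<^sup>2 / (24 * real m)) * (1 / sqrt (3 / 4)) \<le> exp ((of_int z)\<^sup>2 / (24 * real m)) * 2"
      using s by (intro mult_left_mono) auto
    ultimately show ?thesis unfolding e by (simp add: mult_ac)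
  qed
  have "(\<integral>\<^sup>+x. ennreal (exp (1 / (8 * real m) * (of_int x)\<^sup>2)) \<partial>mid_law m m z)
      \<le> ennreal (exp (1 / (8 * real m) * (of_int z / 2)\<^sup>2 / (1 - 2 * (1 / (8 * real m)) * real m)) / sqrt (1 - 2 * (1 / (8 * real m)) * real m))"
    using mid_law_mgf[OF z] m0 by (intro exp_square_le_of_mgf) auto
  also have "\<dots> \<le> ennreal (2 * exp ((of_int z)\<^sup>2 / (24 * real m)))" by (intro ennreal_leI fin)
  finally show ?A by simp
  have "(\<integral>\<^sup>+x. ennreal (exp (t * of_int (z - x))) \<partial>mid_law m m z) \<le> ennreal (exp (t * (of_int z / 2) + real m * t\<^sup>2 / 2))" for t
  proof -
    have "(\<integral>\<^sup>+x. ennreal (exp (t * of_int (z - x))) \<partial>mid_law m m z)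
        = (\<integral>\<^sup>+x. ennreal (exp (t * of_int z)) * ennreal (exp ((- t) * of_int x)) \<partial>mid_law m m z)"
      by (intro nn_integral_cong) (simp add: algebra_simps flip: ennreal_mult exp_add)
    also have "\<dots> = ennreal (exp (t * of_int z)) * (\<integral>\<^sup>+x. ennreal (exp ((- t) * of_int x)) \<partial>mid_law m m z)"
      by (rule nn_integral_cmult) simp
    also have "\<dots> \<le> ennreal (exp (t * of_int z)) * ennreal (exp ((- t) * of_int z / 2 + real m * (- t)\<^sup>2 / 2))"
      by (intro mult_left_mono mid_law_mgf[OF z]) simp
    also have "\<dots> = ennreal (exp (t * (of_int z / 2) + real m * t\<^sup>2 / 2))"
      by (simp add: algebra_simps flip: ennreal_mult exp_add)
    finally show ?thesis .
  qed
  then have "(\<integral>\<^sup>+x. ennreal (exp (1 / (8 * real m) * (of_int (z - x))\<^sup>2)) \<partial>mid_law m m z)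
      \<le> ennreal (exp (1 / (8 * real m) * (of_int z / 2)\<^sup>2 / (1 - 2 * (1 / (8 * real m)) * real m)) / sqrt (1 - 2 * (1 / (8 * real m)) * real m))"
    using m0 by (intro exp_square_le_of_mgf) auto
  also have "\<dots> \<le> ennreal (2 * exp ((of_int z)\<^sup>2 / (24 * real m)))" by (intro ennreal_leI fin)
  finally show ?B by simp
qed

section \<open>The error at the midpoint and its exponential moment\<close>

lemma mid_law_coupling_close:
  assumes m: "m \<ge> 1" and z: "z \<in> L (m + m)" and q: "monotone_coupling (mid_law m m z) q"
  shows "\<bar>of_int (q g) - of_int z / 2 - sqrt (real m / 2) * g\<bar> \<le> 4194304 * (1 + g\<^sup>2 + (of_int z)\<^sup>2 / (4 * real m))"
proof -
  obtain l where l: "l \<le> 2 * m" "z = 2 * int l - 2 * int m"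
    and supp: "\<And>x. x \<in> set_pmf (mid_law m m z) \<Longrightarrow> \<exists>k. k \<le> m \<and> k \<le> l \<and> l - k \<le> m \<and> x = 2 * int k - int m"
    and tail: "\<And>k. measure (mid_law m m z) {2 * int k - int m..} = sum (hyp_weight m l) {k..l} / real (2 * m choose l)"
    using mid_law_half[OF z] by metis
  have Z0: "real (2 * m choose l) > 0" using l by simp
  obtain k where k: "k \<le> m" "k \<le> l" "l - k \<le> m" "q g = 2 * int k - int m"
    using supp q unfolding monotone_coupling_def by metis
  have iff: "d \<le> q g \<longleftrightarrow> normal_tail g \<le> measure_pmf.prob (mid_law m m z) {d..}" for d
    using q unfolding monotone_coupling_def by blast
  have lo: "real (2 * m choose l) * normal_tail g \<le> sum (hyp_weight m l) {k..l}"
    using iff[of "2 * int k - int m"] Z0 k(4) unfolding tail by (simp add: le_divide_eq mult.commute)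
  \<comment> \<open>The possible values have spacing 2, so \<open>k + 1\<close> is the next
    candidate; the Galois connection excludes it and yields the strict upper bound.\<close>
  have "\<not> 2 * int (Suc k) - int m \<le> q g" using k(4) by simp
  then have hi: "sum (hyp_weight m l) {Suc k..l} < real (2 * m choose l) * normal_tail g"
    using Z0 unfolding iff tail by (simp add: le_divide_eq mult.commute)
  have "of_int (q g) - of_int z / 2 = 2 * real k - real l" using k(4) l(2) by (simp add: diff_divide_distrib)
  moreover have "(real l - real m)\<^sup>2 / real m = (of_int z)\<^sup>2 / (4 * real m)"
  proof -
    have "real_of_int z = 2 * (real l - real m)" using l(2) by simp
    then have "(of_int z)\<^sup>2 = 4 * (real l - real m)\<^sup>2" by (simp only: power_mult_distrib) simp
    then show ?thesis by simp
  qed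
  ultimately show ?thesis using hyp_quantile_close[OF m l(1) k(1-3) lo hi] by simp
qed

text \<open>Separates two dependent exponents at the price of doubling each. The tilt
  \<open>\<tau>\<close> moves a deterministic amount of exponent from one to the other.\<close>

lemma exp_add_le_am_gm: "exp (A + B) \<le> (exp (2 * A + \<tau>) + exp (2 * B - \<tau>)) / (2 :: real)"
proof -
  have "0 \<le> (exp (A + \<tau> / 2) - exp (B - \<tau> / 2))\<^sup>2" by simp
  also have "\<dots> = exp (2 * A + \<tau>) + exp (2 * B - \<tau>) - 2 * exp (A + B)"
    by (simp add: power2_eq_square algebra_simps flip: exp_add)
  finally show ?thesis by simp
qed

lemma mid_law_coupling_moment:
  assumes m: "m \<ge> 1" and z: "z \<in> L (m + m)" and q: "monotone_coupling (mid_law m m z) q"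
    and a: "0 \<le> a" "a \<le> 1 / 100663296"
    and h: "h = (\<lambda>x. x) \<or> h = (\<lambda>x. z - x)"
  shows "(\<integral>\<^sup>+g. ennreal (exp (a * \<bar>of_int (q g) - of_int z / 2 - sqrt (real m / 2) * g\<bar> + (of_int (h (q g)))\<^sup>2 / (16 * real m))) \<partial>std_normal)
    \<le> ennreal (2 * exp ((of_int z)\<^sup>2 / (32 * real m)))"
proof -
  define v where "v = (of_int z)\<^sup>2 / real m"
  have v0: "0 \<le> v" by (simp add: v_def)
  have v24: "(of_int z)\<^sup>2 / (24 * real m) = v / 24" "(of_int z)\<^sup>2 / (32 * real m) = v / 32" "(of_int z)\<^sup>2 / (4 * real m) = v / 4"
    by (simp_all add: v_def)
  have qm [measurable]: "q \<in> measurable borel (count_space UNIV)" using q by (simp add: monotone_coupling_def)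
  define \<kappa> :: real where "\<kappa> = 1 / 24"
  \<comment> \<open>As \<open>100663296 = 24 * 4194304\<close>, the term \<open>A\<close> is at most
    \<open>(1 + g^2 + v / 4) / 24\<close>. Thus \<open>2 * A\<close> brings in
    \<open>v / 48\<close>, and the moment of the other doubled term brings in \<open>v / 24\<close>;
    the tilt \<open>v / 96\<close> turns both into \<open>v / 32\<close>, the exponent claimed for
    length \<open>2 * m\<close>.\<close>
  have pt: "exp (a * \<bar>of_int (q g) - of_int z / 2 - sqrt (real m / 2) * g\<bar> + (of_int (h (q g)))\<^sup>2 / (16 * real m))
     \<le> exp (1 / 12 + v / 32) / 2 * exp (0 * g + 1 / 12 * g\<^sup>2) + exp (- v / 96) / 2 * exp ((of_int (h (q g)))\<^sup>2 / (8 * real m))" for g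
  proof -
    define A where "A = a * \<bar>of_int (q g) - of_int z / 2 - sqrt (real m / 2) * g\<bar>"
    define B where "B = (of_int (h (q g)))\<^sup>2 / (16 * real m)"
    have "A \<le> 1 / 100663296 * (4194304 * (1 + g\<^sup>2 + v / 4))"
      unfolding A_def v24(3)[symmetric] using a mid_law_coupling_close[OF m z q, of g] by (intro mult_mono) auto
    then have "2 * A + v / 96 \<le> (1 / 12 + v / 32) + (0 * g + 1 / 12 * g\<^sup>2)" by (simp add: algebra_simps)
    then have "exp (2 * A + v / 96) \<le> exp ((1 / 12 + v / 32) + (0 * g + 1 / 12 * g\<^sup>2))" by (simp only: exp_le_cancel_iff)
    then have 1: "exp (2 * A + v / 96) \<le> exp (1 / 12 + v / 32) * exp (0 * g + 1 / 12 * g\<^sup>2)" by (simp only: exp_add)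
    have "2 * B - v / 96 = - v / 96 + (of_int (h (q g)))\<^sup>2 / (8 * real m)" by (simp add: B_def)
    then have 2: "exp (2 * B - v / 96) = exp (- v / 96) * exp ((of_int (h (q g)))\<^sup>2 / (8 * real m))" by (simp only: exp_add)
    have "exp (A + B) \<le> (exp (1 / 12 + v / 32) * exp (0 * g + 1 / 12 * g\<^sup>2) + exp (- v / 96) * exp ((of_int (h (q g)))\<^sup>2 / (8 * real m))) / 2"
      using exp_add_le_am_gm[of A B "v / 96"] unfolding 2
      by (rule order_trans) (intro divide_right_mono add_right_mono 1, simp)
    then show ?thesis unfolding A_def B_def by (simp only: add_divide_distrib times_divide_eq_left)
  qed
  \<comment> \<open>The budget of constants: the first summand contributes at most
    \<open>4 / 3 * (1 / 2) * (3 / 2) = 1\<close>, the second \<open>1 / 2 * 2 = 1\<close>, each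
    times \<open>exp (v / 32)\<close>.\<close>
  have s: "1 / sqrt (5 / 6) \<le> (3 / 2 :: real)"
  proof -
    have "2 / 3 \<le> sqrt (5 / 6 :: real)" by (rule real_le_rsqrt) (simp add: power2_eq_square)
    then show ?thesis by (simp add: field_simps)
  qed
  have "exp (1 / 12) \<le> (1 :: real) + 1 / 12 + (1 / 12)\<^sup>2" by (rule exp_bound) auto
  then have e12: "exp (1 / 12 :: real) \<le> 4 / 3" by (simp add: power2_eq_square)
  have I1: "(\<integral>\<^sup>+g. ennreal (exp (0 * g + 1 / 12 * g\<^sup>2)) \<partial>std_normal) \<le> ennreal (3 / 2)"
    using std_normal_exp_quadratic[of "1 / 12" 0] s by simp
  have I2: "(\<integral>\<^sup>+g. ennreal (exp ((of_int (h (q g)))\<^sup>2 / (8 * real m))) \<partial>std_normal) \<le> ennreal (2 * exp (v / 24))"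
  proof -
    have "(\<integral>\<^sup>+g. ennreal (exp ((of_int (h (q g)))\<^sup>2 / (8 * real m))) \<partial>std_normal)
       = (\<integral>\<^sup>+x. ennreal (exp ((of_int (h x))\<^sup>2 / (8 * real m))) \<partial>distr std_normal (count_space UNIV) q)"
      by (subst nn_integral_distr) auto
    also have "distr std_normal (count_space UNIV) q = measure_pmf (mid_law m m z)"
      using q by (simp add: monotone_coupling_def)
    also have "(\<integral>\<^sup>+x. ennreal (exp ((of_int (h x))\<^sup>2 / (8 * real m))) \<partial>mid_law m m z) \<le> ennreal (2 * exp ((of_int z)\<^sup>2 / (24 * real m)))"
      using h mid_law_exp_square[OF m z] by auto
    finally show ?thesis unfolding v24 .
  qed
  have "(\<integral>\<^sup>+g. ennreal (exp (a * \<bar>of_int (q g) - of_int z / 2 - sqrt (real m / 2) * g\<bar> + (of_int (h (q g)))\<^sup>2 / (16 * real m))) \<partial>std_normal)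
    \<le> (\<integral>\<^sup>+g. ennreal (exp (1 / 12 + v / 32) / 2) * ennreal (exp (0 * g + 1 / 12 * g\<^sup>2))
         + ennreal (exp (- v / 96) / 2) * ennreal (exp ((of_int (h (q g)))\<^sup>2 / (8 * real m))) \<partial>std_normal)"
    using pt by (intro nn_integral_mono) (simp flip: ennreal_mult ennreal_plus)
  also have "\<dots> = ennreal (exp (1 / 12 + v / 32) / 2) * (\<integral>\<^sup>+g. ennreal (exp (0 * g + 1 / 12 * g\<^sup>2)) \<partial>std_normal)
         + ennreal (exp (- v / 96) / 2) * (\<integral>\<^sup>+g. ennreal (exp ((of_int (h (q g)))\<^sup>2 / (8 * real m))) \<partial>std_normal)"
    by (subst nn_integral_add) (auto simp: nn_integral_cmult)
  also have "\<dots> \<le> ennreal (exp (1 / 12 + v / 32) / 2) * ennreal (3 / 2) + ennreal (exp (- v / 96) / 2) * ennreal (2 * exp (v / 24))"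
    by (intro add_mono mult_left_mono I1 I2) auto
  also have "\<dots> = ennreal (exp (1 / 12 + v / 32) / 2 * (3 / 2) + exp (- v / 96) / 2 * (2 * exp (v / 24)))"
    by (simp flip: ennreal_mult ennreal_plus)
  also have "\<dots> \<le> ennreal (2 * exp (v / 32))"
  proof (rule ennreal_leI)
    have "exp (- v / 96) * exp (v / 24) = exp (v / 32)" by (simp flip: exp_add)
    moreover have "exp (1 / 12) * exp (v / 32) \<le> 4 / 3 * exp (v / 32)" using e12 by (intro mult_right_mono) auto
    ultimately show "exp (1 / 12 + v / 32) / 2 * (3 / 2) + exp (- v / 96) / 2 * (2 * exp (v / 24)) \<le> 2 * exp (v / 32)"
      by (simp add: exp_add)
  qed
  finally show ?thesis unfolding v24 .
qed

section \<open>Gaussian processes on sequence space\<close>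

definition Gauss :: "(nat \<Rightarrow> real) measure" where
  "Gauss = (\<Pi>\<^sub>M i\<in>UNIV. std_normal)"

text \<open>Coordinate 0, the odd and the even coordinates of a sequence of independent standard Gaussians
  provide a Gaussian variable and two further such sequences, all independent.\<close>

definition odds :: "(nat \<Rightarrow> real) \<Rightarrow> nat \<Rightarrow> real" where
  "odds \<omega> = (\<lambda>i. \<omega> (2 * i + 1))"

definition evens :: "(nat \<Rightarrow> real) \<Rightarrow> nat \<Rightarrow> real" where
  "evens \<omega> = (\<lambda>i. \<omega> (2 * i + 2))"

definition unsplit :: "real \<times> (nat \<Rightarrow> real) \<times> (nat \<Rightarrow> real) \<Rightarrow> nat \<Rightarrow> real" where
  "unsplit = (\<lambda>(x, u, v) i. if i = 0 then x else if odd i then u (i div 2) else v (i div 2 - 1))"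

lemma space_Gauss [simp]: "space Gauss = UNIV"
  by (simp add: Gauss_def space_PiM)

interpretation Gauss: prob_space Gauss
  unfolding Gauss_def by (intro prob_space_PiM prob_space_std_normal)

interpretation std_normal: prob_space std_normal
  by (rule prob_space_std_normal)

interpretation Gauss_pair: pair_prob_space Gauss Gauss ..

interpretation Gauss_triple: pair_prob_space std_normal "Gauss \<Otimes>\<^sub>M Gauss"
  ..

lemma measurable_Gauss_component [measurable]: "(\<lambda>\<omega>. \<omega> i) \<in> borel_measurable Gauss"
proof -
  have "(\<lambda>\<omega>. \<omega> i) \<in> measurable Gauss std_normal"
    unfolding Gauss_def by (rule measurable_component_singleton) simp
  then show ?thesis using measurable_cong_sets[OF refl, of std_normal borel Gauss] by simp
qed

lemma measurable_Gauss:
  assumes "\<And>i. (\<lambda>x. f x i) \<in> borel_measurable M"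
  shows "f \<in> measurable M Gauss"
  unfolding Gauss_def using assms
  by (intro measurable_PiM_single') (auto simp: measurable_cong_sets[of M M std_normal borel])

lemma measurable_odds [measurable]: "odds \<in> measurable Gauss Gauss"
  by (rule measurable_Gauss) (simp add: odds_def)

lemma measurable_evens [measurable]: "evens \<in> measurable Gauss Gauss"
  by (rule measurable_Gauss) (simp add: evens_def)

lemma measurable_unsplit [measurable]: "unsplit \<in> measurable (std_normal \<Otimes>\<^sub>M (Gauss \<Otimes>\<^sub>M Gauss)) Gauss"
proof (rule measurable_Gauss)
  fix i
  have [measurable]: "(\<lambda>x. fst x) \<in> borel_measurable (std_normal \<Otimes>\<^sub>M (Gauss \<Otimes>\<^sub>M Gauss))"
    using measurable_fst[of std_normal "Gauss \<Otimes>\<^sub>M Gauss"] by (simp add: measurable_cong_sets[of _ _ std_normal borel])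
  show "(\<lambda>x. unsplit x i) \<in> borel_measurable (std_normal \<Otimes>\<^sub>M (Gauss \<Otimes>\<^sub>M Gauss))"
    unfolding unsplit_def case_prod_beta by measurable
qed

lemma odds_unsplit [simp]: "odds (unsplit (x, u, v)) = u"
  by (simp add: odds_def unsplit_def fun_eq_iff)

lemma evens_unsplit [simp]: "evens (unsplit (x, u, v)) = v"
  by (simp add: evens_def unsplit_def fun_eq_iff)

lemma unsplit_0 [simp]: "unsplit (x, u, v) 0 = x"
  by (simp add: unsplit_def)

lemma emeasure_Gauss_Collect:
  assumes "finite J" "\<And>j. j \<in> J \<Longrightarrow> F j \<in> sets borel"
  shows "emeasure Gauss {\<omega>. \<forall>j\<in>J. \<omega> j \<in> F j} = (\<Prod>j\<in>J. emeasure std_normal (F j))"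
proof -
  interpret product_prob_space "\<lambda>_. std_normal" "UNIV :: nat set"
    by unfold_locales
  show ?thesis
    using emeasure_PiM_Collect[of J F] assms by (simp add: Gauss_def space_PiM)
qed

text \<open>A product measure is determined by its finite cylinders, and a cylinder over
  \<open>J\<close> factors into conditions on coordinate 0, on the odd and on the positive even
  coordinates.\<close>

lemma distr_unsplit: "distr (std_normal \<Otimes>\<^sub>M (Gauss \<Otimes>\<^sub>M Gauss)) Gauss unsplit = Gauss"
proof -
  interpret product_prob_space "\<lambda>_. std_normal" "UNIV :: nat set"
    by unfold_locales
  let ?P = "std_normal \<Otimes>\<^sub>M (Gauss \<Otimes>\<^sub>M Gauss)"
  have "distr ?P Gauss unsplit = (\<Pi>\<^sub>M i\<in>UNIV. std_normal)"
  proof (rule PiM_eq)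
    show "sets (distr ?P Gauss unsplit) = sets (\<Pi>\<^sub>M i\<in>UNIV. std_normal)" by (simp add: Gauss_def)
    fix J :: "nat set" and F :: "nat \<Rightarrow> real set"
    assume J: "finite J" "J \<subseteq> UNIV" and F: "\<And>j. j \<in> J \<Longrightarrow> F j \<in> sets std_normal"
    define F0 where "F0 = (if 0 \<in> J then F 0 else UNIV)"
    define J1 where "J1 = (\<lambda>j. 2 * j + 1) -` J"
    define J2 where "J2 = (\<lambda>j. 2 * j + 2) -` J"
    have fin: "finite J1" "finite J2"
      unfolding J1_def J2_def using J by (auto intro!: finite_vimageI simp: inj_on_def)
    have emb: "prod_emb UNIV (\<lambda>_. std_normal) J (Pi\<^sub>E J F) = {\<omega>. \<forall>j\<in>J. \<omega> j \<in> F j}"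
      by (simp add: set_eq_iff prod_emb_iff restrict_PiE_iff Pi_iff)
    have meas: "{\<omega>. \<forall>j\<in>J. \<omega> j \<in> F j} \<in> sets Gauss"
    proof -
      have "{\<omega>. \<forall>j\<in>J. \<omega> j \<in> F j} = {\<omega> \<in> space Gauss. \<forall>j\<in>J. \<omega> j \<in> F j}" by simp
      also have "\<dots> \<in> sets Gauss"
        using F J by (intro sets.sets_Collect_finite_All measurable_sets_Collect[OF measurable_Gauss_component]) auto
      finally show ?thesis .
    qed
    have "(\<forall>j\<in>J. unsplit (x, u, v) j \<in> F j) \<longleftrightarrow> x \<in> F0 \<and> (\<forall>j\<in>J1. u j \<in> F (2 * j + 1)) \<and> (\<forall>j\<in>J2. v j \<in> F (2 * j + 2))" for x u v
    proof -
      have split: "(\<forall>j. P j) \<longleftrightarrow> P 0 \<and> (\<forall>j. P (2 * j + 1)) \<and> (\<forall>j. P (2 * j + 2))" for P :: "nat \<Rightarrow> bool"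
      proof (intro iffI allI)
        fix j :: nat assume *: "P 0 \<and> (\<forall>j. P (2 * j + 1)) \<and> (\<forall>j. P (2 * j + 2))"
        have "j = 0 \<or> (\<exists>i. j = 2 * i + 1) \<or> (\<exists>i. j = 2 * i + 2)" by presburger
        then show "P j" using * by auto
      qed auto
      show ?thesis
        unfolding Ball_def split[of "\<lambda>j. j \<in> J \<longrightarrow> unsplit (x, u, v) j \<in> F j"]
        by (auto simp: F0_def J1_def J2_def unsplit_def)
    qed
    note iff = this
    have vim: "unsplit -` {\<omega>. \<forall>j\<in>J. \<omega> j \<in> F j} \<inter> space ?P
       = F0 \<times> ({u. \<forall>j\<in>J1. u j \<in> F (2 * j + 1)} \<times> {v. \<forall>j\<in>J2. v j \<in> F (2 * j + 2)})"
      by (simp add: set_eq_iff space_pair_measure iff)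
    have m1: "{u. \<forall>j\<in>J1. u j \<in> F (2 * j + 1)} \<in> sets Gauss"
    proof -
      have "{\<omega> \<in> space Gauss. \<forall>j\<in>J1. \<omega> j \<in> F (2 * j + 1)} \<in> sets Gauss"
        using F fin by (intro sets.sets_Collect_finite_All measurable_sets_Collect[OF measurable_Gauss_component]) (auto simp: J1_def)
      then show ?thesis by simp
    qed
    have m2: "{u. \<forall>j\<in>J2. u j \<in> F (2 * j + 2)} \<in> sets Gauss"
    proof -
      have "{\<omega> \<in> space Gauss. \<forall>j\<in>J2. \<omega> j \<in> F (2 * j + 2)} \<in> sets Gauss"
        using F fin by (intro sets.sets_Collect_finite_All measurable_sets_Collect[OF measurable_Gauss_component]) (auto simp: J2_def)
      then show ?thesis by simp
    qed
    have "emeasure (distr ?P Gauss unsplit) {\<omega>. \<forall>j\<in>J. \<omega> j \<in> F j}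
       = emeasure std_normal F0 * (emeasure Gauss {u. \<forall>j\<in>J1. u j \<in> F (2 * j + 1)} * emeasure Gauss {v. \<forall>j\<in>J2. v j \<in> F (2 * j + 2)})"
    proof -
      have F0: "F0 \<in> sets std_normal" using F by (simp add: F0_def)
      have "emeasure (distr ?P Gauss unsplit) {\<omega>. \<forall>j\<in>J. \<omega> j \<in> F j}
        = emeasure ?P (F0 \<times> ({u. \<forall>j\<in>J1. u j \<in> F (2 * j + 1)} \<times> {v. \<forall>j\<in>J2. v j \<in> F (2 * j + 2)}))"
        unfolding vim[symmetric] by (rule emeasure_distr[OF measurable_unsplit meas])
      also have "\<dots> = emeasure std_normal F0 * emeasure (Gauss \<Otimes>\<^sub>M Gauss) ({u. \<forall>j\<in>J1. u j \<in> F (2 * j + 1)} \<times> {v. \<forall>j\<in>J2. v j \<in> F (2 * j + 2)})"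
        using m1 m2 by (intro Gauss_pair.P.emeasure_pair_measure_Times F0 pair_measureI)
      also have "emeasure (Gauss \<Otimes>\<^sub>M Gauss) ({u. \<forall>j\<in>J1. u j \<in> F (2 * j + 1)} \<times> {v. \<forall>j\<in>J2. v j \<in> F (2 * j + 2)})
        = emeasure Gauss {u. \<forall>j\<in>J1. u j \<in> F (2 * j + 1)} * emeasure Gauss {v. \<forall>j\<in>J2. v j \<in> F (2 * j + 2)}"
        by (rule Gauss.emeasure_pair_measure_Times[OF m1 m2])
      finally show ?thesis .
    qed
    also have "emeasure Gauss {u. \<forall>j\<in>J1. u j \<in> F (2 * j + 1)} = (\<Prod>j\<in>J1. emeasure std_normal (F (2 * j + 1)))"
      using F by (intro emeasure_Gauss_Collect fin) (auto simp: J1_def)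
    also have "\<dots> = (\<Prod>j\<in>(\<lambda>j. 2 * j + 1) ` J1. emeasure std_normal (F j))"
      by (subst prod.reindex) (auto simp: inj_on_def)
    also have "emeasure Gauss {u. \<forall>j\<in>J2. u j \<in> F (2 * j + 2)} = (\<Prod>j\<in>J2. emeasure std_normal (F (2 * j + 2)))"
      using F by (intro emeasure_Gauss_Collect fin) (auto simp: J2_def)
    also have "\<dots> = (\<Prod>j\<in>(\<lambda>j. 2 * j + 2) ` J2. emeasure std_normal (F j))"
      by (subst prod.reindex) (auto simp: inj_on_def)
    also have "emeasure std_normal F0 = (\<Prod>j\<in>J \<inter> {0}. emeasure std_normal (F j))"
      using std_normal.emeasure_space_1 by (auto simp: F0_def)
    also have "(\<Prod>j\<in>J \<inter> {0}. emeasure std_normal (F j)) * ((\<Prod>j\<in>(\<lambda>j. 2 * j + 1) ` J1. emeasure std_normal (F j)) * (\<Prod>j\<in>(\<lambda>j. 2 * j + 2) ` J2. emeasure std_normal (F j)))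
      = (\<Prod>j\<in>(J \<inter> {0}) \<union> ((\<lambda>j. 2 * j + 1) ` J1 \<union> (\<lambda>j. 2 * j + 2) ` J2). emeasure std_normal (F j))"
    proof -
      have "2 * i + 1 \<noteq> 2 * j + 2" for i j :: nat by presburger
      then have d: "(\<lambda>j. 2 * j + 1) ` J1 \<inter> (\<lambda>j. 2 * j + 2) ` J2 = {}" by auto
      have "(\<Prod>j\<in>(\<lambda>j. 2 * j + 1) ` J1. emeasure std_normal (F j)) * (\<Prod>j\<in>(\<lambda>j. 2 * j + 2) ` J2. emeasure std_normal (F j))
        = (\<Prod>j\<in>(\<lambda>j. 2 * j + 1) ` J1 \<union> (\<lambda>j. 2 * j + 2) ` J2. emeasure std_normal (F j))"
        by (rule prod.union_disjoint[symmetric]) (use fin d in auto)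
      moreover have "(\<Prod>j\<in>J \<inter> {0}. emeasure std_normal (F j)) * (\<Prod>j\<in>(\<lambda>j. 2 * j + 1) ` J1 \<union> (\<lambda>j. 2 * j + 2) ` J2. emeasure std_normal (F j))
        = (\<Prod>j\<in>(J \<inter> {0}) \<union> ((\<lambda>j. 2 * j + 1) ` J1 \<union> (\<lambda>j. 2 * j + 2) ` J2). emeasure std_normal (F j))"
        by (rule prod.union_disjoint[symmetric]) (use fin J in auto)
      ultimately show ?thesis by (simp only:)
    qed
    also have "(J \<inter> {0}) \<union> ((\<lambda>j. 2 * j + 1) ` J1 \<union> (\<lambda>j. 2 * j + 2) ` J2) = J"
    proof -
      have "j \<in> (J \<inter> {0}) \<union> ((\<lambda>j. 2 * j + 1) ` J1 \<union> (\<lambda>j. 2 * j + 2) ` J2)" if "j \<in> J" for j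
      proof -
        have "j = 0 \<or> (\<exists>i. j = 2 * i + 1) \<or> (\<exists>i. j = 2 * i + 2)" by presburger
        then consider "j = 0" | i where "j = 2 * i + 1" | i where "j = 2 * i + 2" by blast
        then show ?thesis using that by cases (simp_all add: J1_def J2_def image_iff)
      qed
      then show ?thesis by (auto simp: J1_def J2_def)
    qed
    finally show "emeasure (distr ?P Gauss unsplit) (prod_emb UNIV (\<lambda>_. std_normal) J (Pi\<^sub>E J F)) = (\<Prod>j\<in>J. emeasure std_normal (F j))"
      unfolding emb .
  qed
  then show ?thesis by (simp add: Gauss_def)
qed

lemma nn_integral_Gauss_split:
  assumes [measurable]: "(\<lambda>(x, u, v). F x u v) \<in> borel_measurable (borel \<Otimes>\<^sub>M (Gauss \<Otimes>\<^sub>M Gauss))"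
  shows "(\<integral>\<^sup>+\<omega>. F (\<omega> 0) (odds \<omega>) (evens \<omega>) \<partial>Gauss) = (\<integral>\<^sup>+x. \<integral>\<^sup>+u. \<integral>\<^sup>+v. F x u v \<partial>Gauss \<partial>Gauss \<partial>std_normal)"
proof -
  let ?P = "std_normal \<Otimes>\<^sub>M (Gauss \<Otimes>\<^sub>M Gauss)"
  have sP: "sets ?P = sets (borel \<Otimes>\<^sub>M (Gauss \<Otimes>\<^sub>M Gauss))" by (intro sets_pair_measure_cong) auto
  have mP: "(\<lambda>(x, u, v). F x u v) \<in> borel_measurable ?P"
    using assms measurable_cong_sets[OF sP refl] by blast
  have m: "(\<lambda>\<omega>. F (\<omega> 0) (odds \<omega>) (evens \<omega>)) \<in> borel_measurable Gauss"
  proof -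
    have "(\<lambda>\<omega>. (\<omega> 0, odds \<omega>, evens \<omega>)) \<in> measurable Gauss (borel \<Otimes>\<^sub>M (Gauss \<Otimes>\<^sub>M Gauss))" by measurable
    from measurable_compose[OF this assms] show ?thesis by simp
  qed
  have "(\<integral>\<^sup>+\<omega>. F (\<omega> 0) (odds \<omega>) (evens \<omega>) \<partial>Gauss) = (\<integral>\<^sup>+\<omega>. F (\<omega> 0) (odds \<omega>) (evens \<omega>) \<partial>distr ?P Gauss unsplit)"
    by (simp only: distr_unsplit)
  also have "\<dots> = (\<integral>\<^sup>+y. (case y of (x, u, v) \<Rightarrow> F x u v) \<partial>?P)"
    using m by (subst nn_integral_distr[OF measurable_unsplit]) (auto intro!: nn_integral_cong simp: case_prod_beta)
  also have "\<dots> = (\<integral>\<^sup>+x. \<integral>\<^sup>+uv. (case uv of (u, v) \<Rightarrow> F x u v) \<partial>(Gauss \<Otimes>\<^sub>M Gauss) \<partial>std_normal)"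
    using Gauss_pair.P.nn_integral_fst[OF mP] by (simp add: case_prod_beta')
  also have "\<dots> = (\<integral>\<^sup>+x. \<integral>\<^sup>+u. \<integral>\<^sup>+v. F x u v \<partial>Gauss \<partial>Gauss \<partial>std_normal)"
  proof (intro nn_integral_cong)
    fix x :: real
    have "(\<lambda>uv. (x, uv)) \<in> measurable (Gauss \<Otimes>\<^sub>M Gauss) (borel \<Otimes>\<^sub>M (Gauss \<Otimes>\<^sub>M Gauss))" by measurable
    from measurable_compose[OF this assms] have "(\<lambda>(u, v). F x u v) \<in> borel_measurable (Gauss \<Otimes>\<^sub>M Gauss)"
      by (simp add: case_prod_beta)
    then show "(\<integral>\<^sup>+uv. (case uv of (u, v) \<Rightarrow> F x u v) \<partial>(Gauss \<Otimes>\<^sub>M Gauss)) = (\<integral>\<^sup>+u. \<integral>\<^sup>+v. F x u v \<partial>Gauss \<partial>Gauss)"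
      using Gauss.nn_integral_fst[of "\<lambda>(u, v). F x u v" Gauss] by simp
  qed
  finally show ?thesis .
qed

lemma distr_odds: "distr Gauss Gauss odds = Gauss"
proof (rule measure_eqI)
  fix A assume "A \<in> sets (distr Gauss Gauss odds)"
  then have [measurable]: "A \<in> sets Gauss" by simp
  have "emeasure (distr Gauss Gauss odds) A = emeasure Gauss (odds -` A)"
    by (simp add: emeasure_distr)
  also have "\<dots> = (\<integral>\<^sup>+\<omega>. indicator (odds -` A) \<omega> \<partial>Gauss)"
    using measurable_sets[OF measurable_odds, of A] by simp
  also have "\<dots> = (\<integral>\<^sup>+\<omega>. indicator A (odds \<omega>) \<partial>Gauss)"
    by (intro nn_integral_cong) (simp add: indicator_def)
  also have "\<dots> = (\<integral>\<^sup>+x. \<integral>\<^sup>+u. \<integral>\<^sup>+v. indicator A u \<partial>Gauss \<partial>Gauss \<partial>std_normal)"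
    by (rule nn_integral_Gauss_split[where F="\<lambda>_ u _. indicator A u"]) measurable
  also have "\<dots> = emeasure Gauss A" by (simp add: Gauss.emeasure_space_1[simplified] std_normal.emeasure_space_1[simplified])
  finally show "emeasure (distr Gauss Gauss odds) A = emeasure Gauss A" .
qed simp

section \<open>Gaussian processes through characteristic functions\<close>

lemma integral_iexp_split:
  assumes [measurable]: "X \<in> borel_measurable Gauss" "Y \<in> borel_measurable Gauss"
  shows "(CLINT \<omega>|Gauss. iexp (a * \<omega> 0 + X (odds \<omega>) + Y (evens \<omega>)))
     = of_real (exp (- a\<^sup>2 / 2)) * (CLINT \<omega>|Gauss. iexp (X \<omega>)) * (CLINT \<omega>|Gauss. iexp (Y \<omega>))"
proof -
  let ?P = "std_normal \<Otimes>\<^sub>M (Gauss \<Otimes>\<^sub>M Gauss)"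
  have [measurable]: "(\<lambda>x. fst x) \<in> borel_measurable ?P"
    using measurable_fst[of std_normal "Gauss \<Otimes>\<^sub>M Gauss"] by (simp add: measurable_cong_sets[of _ _ std_normal borel])
  have [measurable]: "iexp \<in> borel_measurable borel" by (intro borel_measurable_continuous_onI continuous_intros)
  have int: "integrable ?P (\<lambda>(x, uv). iexp (a * x) * (iexp (X (fst uv)) * iexp (Y (snd uv))))"
    by (rule Gauss_triple.P.integrable_const_bound[where B=1]) (auto simp: norm_mult case_prod_beta)
  have int2: "integrable (Gauss \<Otimes>\<^sub>M Gauss) (\<lambda>(u, v). iexp (X u) * iexp (Y v))"
    by (rule Gauss_pair.P.integrable_const_bound[where B=1]) (auto simp: norm_mult case_prod_beta)
  have "(CLINT \<omega>|Gauss. iexp (a * \<omega> 0 + X (odds \<omega>) + Y (evens \<omega>)))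
      = (CLINT \<omega>|distr ?P Gauss unsplit. iexp (a * \<omega> 0 + X (odds \<omega>) + Y (evens \<omega>)))"
    by (simp only: distr_unsplit)
  also have "\<dots> = (CLINT y|?P. (case y of (x, uv) \<Rightarrow> iexp (a * x) * (iexp (X (fst uv)) * iexp (Y (snd uv)))))"
    by (subst integral_distr) (auto intro!: Bochner_Integration.integral_cong simp: case_prod_beta exp_add distrib_left mult_ac)
  also have "\<dots> = (CLINT x|std_normal. CLINT uv|Gauss \<Otimes>\<^sub>M Gauss. iexp (a * x) * (iexp (X (fst uv)) * iexp (Y (snd uv))))"
    using Gauss_triple.integral_fst'[OF int] by simp
  also have "\<dots> = (CLINT x|std_normal. iexp (a * x)) * (CLINT uv|Gauss \<Otimes>\<^sub>M Gauss. iexp (X (fst uv)) * iexp (Y (snd uv)))"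
    by simp
  also have "(CLINT uv|Gauss \<Otimes>\<^sub>M Gauss. iexp (X (fst uv)) * iexp (Y (snd uv))) = (CLINT u|Gauss. CLINT v|Gauss. iexp (X u) * iexp (Y v))"
    using Gauss_pair.integral_fst'[OF int2] by (simp add: case_prod_beta')
  also have "\<dots> = (CLINT \<omega>|Gauss. iexp (X \<omega>)) * (CLINT \<omega>|Gauss. iexp (Y \<omega>))" by simp
  also have "(CLINT x|std_normal. iexp (a * x)) = of_real (exp (- a\<^sup>2 / 2))"
    using fun_cong[OF char_std_normal_distribution, of a] by (simp add: char_def)
  finally show ?thesis by (simp add: mult_ac)
qed

text \<open>Centred Gaussian processes with covariance \<open>K\<close>, encoded by the
  characteristic functions of finite linear combinations. This form includes degenerate values, such
  as the ends of a bridge, and passes to pointwise limits.\<close>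

definition gaussian_process :: "real set \<Rightarrow> (real \<Rightarrow> real \<Rightarrow> real) \<Rightarrow> (real \<Rightarrow> (nat \<Rightarrow> real) \<Rightarrow> real) \<Rightarrow> bool" where
  "gaussian_process T K B \<longleftrightarrow> (\<forall>t\<in>T. B t \<in> borel_measurable Gauss) \<and>
     (\<forall>n cs ts. (\<forall>i<n. ts i \<in> T) \<longrightarrow> (CLINT \<omega>|Gauss. iexp (\<Sum>i<(n::nat). cs i * B (ts i) \<omega>))
        = of_real (exp (- (\<Sum>i<n. \<Sum>j<n. cs i * cs j * K (ts i) (ts j)) / 2)))"

lemma gaussian_process_iexp:
  fixes n :: nat
  assumes "gaussian_process T K B" "\<And>i. i < n \<Longrightarrow> ts i \<in> T"
  shows "(CLINT \<omega>|Gauss. iexp (\<Sum>i<n. cs i * B (ts i) \<omega>))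
        = of_real (exp (- (\<Sum>i<n. \<Sum>j<n. cs i * cs j * K (ts i) (ts j)) / 2))"
  using assms(1)[unfolded gaussian_process_def, THEN conjunct2, rule_format, of n ts cs] assms(2) by blast

text \<open>The three summands are independent, so characteristic functions multiply and covariances
  add. Coefficients and time changes are arbitrary, which lets the lemma serve both for
  concatenating bridges and for extending a bridge to a Brownian motion.\<close>

lemma gaussian_process_split:
  assumes B1: "gaussian_process T1 K1 B1" and B2: "gaussian_process T2 K2 B2"
    and ts: "\<And>t. t \<in> T \<Longrightarrow> \<tau>l t \<in> T1" "\<And>t. t \<in> T \<Longrightarrow> \<tau>r t \<in> T2"
    and K: "\<And>s t. s \<in> T \<Longrightarrow> t \<in> T \<Longrightarrow>
      K s t = \<rho> s * \<rho> t + cl s * cl t * K1 (\<tau>l s) (\<tau>l t) + cr s * cr t * K2 (\<tau>r s) (\<tau>r t)"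
    and B: "\<And>t \<omega>. t \<in> T \<Longrightarrow> B t \<omega> = \<rho> t * \<omega> 0 + cl t * B1 (\<tau>l t) (odds \<omega>) + cr t * B2 (\<tau>r t) (evens \<omega>)"
  shows "gaussian_process T K B"
  unfolding gaussian_process_def
proof (intro conjI ballI allI impI)
  fix t assume t: "t \<in> T"
  have [measurable]: "B1 (\<tau>l t) \<in> borel_measurable Gauss" "B2 (\<tau>r t) \<in> borel_measurable Gauss"
    using t ts B1 B2 by (auto simp: gaussian_process_def)
  have "(\<lambda>\<omega>. \<rho> t * \<omega> 0 + cl t * B1 (\<tau>l t) (odds \<omega>) + cr t * B2 (\<tau>r t) (evens \<omega>)) \<in> borel_measurable Gauss"
    by measurable
  then show "B t \<in> borel_measurable Gauss" using B[OF t] by (simp cong: measurable_cong)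
next
  fix n :: nat and cs ts :: "nat \<Rightarrow> real" assume T: "\<forall>i<n. ts i \<in> T"
  define a where "a = (\<Sum>i<n. cs i * \<rho> (ts i))"
  define X where "X \<omega> = (\<Sum>i<n. (cs i * cl (ts i)) * B1 (\<tau>l (ts i)) \<omega>)" for \<omega>
  define Y where "Y \<omega> = (\<Sum>i<n. (cs i * cr (ts i)) * B2 (\<tau>r (ts i)) \<omega>)" for \<omega>
  have [measurable]: "X \<in> borel_measurable Gauss" "Y \<in> borel_measurable Gauss"
    unfolding X_def Y_def using T ts B1 B2
    by (auto simp: gaussian_process_def intro!: borel_measurable_sum borel_measurable_times)
  have eq: "(\<Sum>i<n. cs i * B (ts i) \<omega>) = a * \<omega> 0 + X (odds \<omega>) + Y (evens \<omega>)" for \<omega>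
    unfolding a_def X_def Y_def sum_distrib_right sum.distrib[symmetric]
    using T B by (intro sum.cong) (auto simp: algebra_simps)
  have X: "(CLINT \<omega>|Gauss. iexp (X \<omega>)) = of_real (exp (- (\<Sum>i<n. \<Sum>j<n. (cs i * cl (ts i)) * (cs j * cl (ts j)) * K1 (\<tau>l (ts i)) (\<tau>l (ts j))) / 2))"
    unfolding X_def by (rule gaussian_process_iexp[OF B1]) (use T ts in auto)
  have Y: "(CLINT \<omega>|Gauss. iexp (Y \<omega>)) = of_real (exp (- (\<Sum>i<n. \<Sum>j<n. (cs i * cr (ts i)) * (cs j * cr (ts j)) * K2 (\<tau>r (ts i)) (\<tau>r (ts j))) / 2))"
    unfolding Y_def by (rule gaussian_process_iexp[OF B2]) (use T ts in auto)
  have "a\<^sup>2 = (\<Sum>i<n. \<Sum>j<n. (cs i * \<rho> (ts i)) * (cs j * \<rho> (ts j)))"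
    unfolding a_def power2_eq_square sum_product ..
  then have "(\<Sum>i<n. \<Sum>j<n. cs i * cs j * K (ts i) (ts j)) = a\<^sup>2
     + (\<Sum>i<n. \<Sum>j<n. (cs i * cl (ts i)) * (cs j * cl (ts j)) * K1 (\<tau>l (ts i)) (\<tau>l (ts j)))
     + (\<Sum>i<n. \<Sum>j<n. (cs i * cr (ts i)) * (cs j * cr (ts j)) * K2 (\<tau>r (ts i)) (\<tau>r (ts j)))"
  proof -
    have "(\<Sum>i<n. \<Sum>j<n. cs i * cs j * K (ts i) (ts j)) = (\<Sum>i<n. \<Sum>j<n. (cs i * \<rho> (ts i)) * (cs j * \<rho> (ts j))
     + (cs i * cl (ts i)) * (cs j * cl (ts j)) * K1 (\<tau>l (ts i)) (\<tau>l (ts j))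
     + (cs i * cr (ts i)) * (cs j * cr (ts j)) * K2 (\<tau>r (ts i)) (\<tau>r (ts j)))"
      by (intro sum.cong refl) (use T K in \<open>auto simp: algebra_simps\<close>)
    then show ?thesis using \<open>a\<^sup>2 = _\<close> by (simp add: sum.distrib)
  qed
  then show "(CLINT \<omega>|Gauss. iexp (\<Sum>i<n. cs i * B (ts i) \<omega>)) = of_real (exp (- (\<Sum>i<n. \<Sum>j<n. cs i * cs j * K (ts i) (ts j)) / 2))"
    unfolding eq by (subst integral_iexp_split) (simp_all add: X Y add_divide_distrib flip: exp_add of_real_mult)
qed

section \<open>Concatenation and construction of Brownian bridges\<close>

definition bridge_kernel :: "real \<Rightarrow> real \<Rightarrow> real" where
  "bridge_kernel s t = min s t - s * t"

text \<open>The tent function with value 1 at \<open>p\<close>, times the standard deviation of the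
  Brownian bridge at \<open>p\<close>.\<close>

definition mid_coeff :: "real \<Rightarrow> real \<Rightarrow> real" where
  "mid_coeff p t = (if t \<le> p then t / p else (1 - t) / (1 - p)) * sqrt (p * (1 - p))"

text \<open>Brownian scaling of a unit bridge to an interval of length \<open>p\<close>.\<close>

definition left_coeff :: "real \<Rightarrow> real \<Rightarrow> real" where
  "left_coeff p t = (if t \<le> p then sqrt p else 0)"

definition right_coeff :: "real \<Rightarrow> real \<Rightarrow> real" where
  "right_coeff p t = (if t \<le> p then 0 else sqrt (1 - p))"

text \<open>The default 0 keeps the time inside the unit interval; it is only ever read with
  coefficient 0.\<close>

definition left_time :: "real \<Rightarrow> real \<Rightarrow> real" where
  "left_time p t = (if t \<le> p then t / p else 0)"

definition right_time :: "real \<Rightarrow> real \<Rightarrow> real" where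
  "right_time p t = (if t \<le> p then 0 else (t - p) / (1 - p))"

definition bridge_concat :: "real \<Rightarrow> real \<Rightarrow> (real \<Rightarrow> real) \<Rightarrow> (real \<Rightarrow> real) \<Rightarrow> real \<Rightarrow> real" where
  "bridge_concat p x f g t =
     mid_coeff p t * x + left_coeff p t * f (left_time p t) + right_coeff p t * g (right_time p t)"

definition concat_kernel :: "real \<Rightarrow> (real \<Rightarrow> real \<Rightarrow> real) \<Rightarrow> (real \<Rightarrow> real \<Rightarrow> real) \<Rightarrow> real \<Rightarrow> real \<Rightarrow> real" where
  "concat_kernel p K1 K2 s t = mid_coeff p s * mid_coeff p t
     + left_coeff p s * left_coeff p t * K1 (left_time p s) (left_time p t)
     + right_coeff p s * right_coeff p t * K2 (right_time p s) (right_time p t)"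

lemmas concat_defs = mid_coeff_def left_coeff_def right_coeff_def left_time_def right_time_def

definition random_concat :: "real \<Rightarrow> (real \<Rightarrow> (nat \<Rightarrow> real) \<Rightarrow> real) \<Rightarrow> (real \<Rightarrow> (nat \<Rightarrow> real) \<Rightarrow> real)
    \<Rightarrow> real \<Rightarrow> (nat \<Rightarrow> real) \<Rightarrow> real" where
  "random_concat p B1 B2 t \<omega> = bridge_concat p (\<omega> 0) (\<lambda>s. B1 s (odds \<omega>)) (\<lambda>s. B2 s (evens \<omega>)) t"

lemma concat_time_in:
  assumes "0 < p" "p < 1" "t \<in> {0..1}"
  shows "left_time p t \<in> {0..1}" "right_time p t \<in> {0..1}"
  using assms by (auto simp: left_time_def right_time_def divide_le_eq)

lemma gaussian_process_concat:
  assumes p: "0 < p" "p < 1"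
    and B1: "gaussian_process {0..1} K1 B1" and B2: "gaussian_process {0..1} K2 B2"
  shows "gaussian_process {0..1} (concat_kernel p K1 K2) (random_concat p B1 B2)"
  by (rule gaussian_process_split[OF B1 B2])
     (use p concat_time_in in \<open>auto simp: concat_kernel_def random_concat_def bridge_concat_def\<close>)

text \<open>The Brownian bridge is a fixed point of concatenation: its value at \<open>p\<close>,
  interpolated linearly, plus two independent scaled bridges. Across the cut only the tent
  contributes to the covariance.\<close>

lemma concat_bridge_kernel:
  assumes p: "0 < p" "p < 1"
  shows "concat_kernel p bridge_kernel bridge_kernel s t = bridge_kernel s t"
proof -
  define q where "q = 1 - p"
  have q: "q > 0" "p = 1 - q" using p by (auto simp: q_def)
  have s1: "sqrt (p * q) * sqrt (p * q) = p * q" "sqrt p * sqrt p = p" "sqrt q * sqrt q = q"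
    using p q by auto
  have s2: "x * sqrt (p * q) * (y * sqrt (p * q)) = x * y * (p * q)" for x y
    using s1(1) by (simp add: mult_ac)
  have m1: "min (s / p) (t / p) = min s t / p" using p by (simp add: min_def divide_le_cancel)
  have m2: "min ((s - p) / q) ((t - p) / q) = (min s t - p) / q" using q by (auto simp: min_def divide_le_cancel)
  consider "s \<le> p" "t \<le> p" | "s \<le> p" "p < t" | "p < s" "t \<le> p" | "p < s" "p < t" by linarith
  then show ?thesis
  proof cases
    case 1
    have "concat_kernel p bridge_kernel bridge_kernel s t = s / p * (t / p) * (p * q) + p * (min s t / p - s / p * (t / p))"
      using 1 p by (simp add: concat_kernel_def concat_defs bridge_kernel_def q_def[symmetric] s2 s1 m1)
    also have "\<dots> = min s t - s * t" using p unfolding q_def by (simp add: field_simps power2_eq_square)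
    finally show ?thesis by (simp add: bridge_kernel_def)
  next
    case 2
    have "concat_kernel p bridge_kernel bridge_kernel s t = s / p * ((1 - t) / q) * (p * q)"
      using 2 by (simp add: concat_kernel_def concat_defs q_def[symmetric] s2)
    also have "\<dots> = s - s * t" using p q(1) by (simp add: field_simps)
    finally show ?thesis using 2 by (simp add: bridge_kernel_def min_def)
  next
    case 3
    have "concat_kernel p bridge_kernel bridge_kernel s t = (1 - s) / q * (t / p) * (p * q)"
      using 3 by (simp add: concat_kernel_def concat_defs q_def[symmetric] s2)
    also have "\<dots> = t - s * t" using p q(1) by (simp add: field_simps)
    finally show ?thesis using 3 by (simp add: bridge_kernel_def min_def)
  next
    case 4
    have "concat_kernel p bridge_kernel bridge_kernel s t = (1 - s) / q * ((1 - t) / q) * (p * q) + q * ((min s t - p) / q - (s - p) / q * ((t - p) / q))"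
      using 4 q(1) by (simp add: concat_kernel_def concat_defs bridge_kernel_def q_def[symmetric] s2 s1 m2)
    also have "\<dots> = ((1 - s) * (1 - t) * p + q * (min s t - p) - (s - p) * (t - p)) / q"
      using q(1) by (simp add: field_simps)
    also have "(1 - s) * (1 - t) * p + q * (min s t - p) - (s - p) * (t - p) = (min s t - s * t) * q"
      unfolding q_def by (simp add: algebra_simps)
    finally show ?thesis using q(1) by (simp add: bridge_kernel_def[of s t])
  qed
qed

text \<open>Continuity and end values are required for every \<open>\<omega>\<close>: the paths of a
  Brownian motion are continuous without exception here, and pasting needs matching ends on each
  path.\<close>

definition gaussian_bridge :: "(real \<Rightarrow> (nat \<Rightarrow> real) \<Rightarrow> real) \<Rightarrow> bool" where
  "gaussian_bridge B \<longleftrightarrow> gaussian_process {0..1} bridge_kernel B \<and>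
     (\<forall>\<omega>. continuous_on {0..1} (\<lambda>t. B t \<omega>) \<and> B 0 \<omega> = 0 \<and> B 1 \<omega> = 0)"

lemma bridge_concat_ends:
  assumes "0 < p" "p < 1" "f 0 = 0" "g 1 = 0"
  shows "bridge_concat p x f g 0 = 0" "bridge_concat p x f g 1 = 0"
  using assms by (auto simp: bridge_concat_def concat_defs)

lemma continuous_on_bridge_concat:
  assumes p: "0 < p" "p < 1"
    and f: "continuous_on {0..1} f" "f 1 = 0" and g: "continuous_on {0..1} g" "g 0 = 0"
  shows "continuous_on {0..1} (bridge_concat p x f g)"
proof -
  have eq: "bridge_concat p x f g = (\<lambda>t. if t \<le> p then t / p * sqrt (p * (1 - p)) * x + sqrt p * f (t / p)
      else (1 - t) / (1 - p) * sqrt (p * (1 - p)) * x + sqrt (1 - p) * g ((t - p) / (1 - p)))"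
    by (auto simp: bridge_concat_def concat_defs fun_eq_iff)
  have f': "continuous_on {0..p} (\<lambda>t. f (t / p))"
    by (rule continuous_on_compose2[OF f(1)]) (use p in \<open>auto intro!: continuous_intros simp: divide_le_eq\<close>)
  have g': "continuous_on {p..1} (\<lambda>t. g ((t - p) / (1 - p)))"
    by (rule continuous_on_compose2[OF g(1)]) (use p in \<open>auto intro!: continuous_intros simp: divide_le_eq\<close>)
  have "continuous_on ({0..p} \<union> {p..1}) (\<lambda>t. if t \<le> p then t / p * sqrt (p * (1 - p)) * x + sqrt p * f (t / p)
      else (1 - t) / (1 - p) * sqrt (p * (1 - p)) * x + sqrt (1 - p) * g ((t - p) / (1 - p)))"
  proof (rule continuous_on_cases)
    show "\<forall>t. (t \<in> {0..p} \<and> \<not> t \<le> p) \<or> (t \<in> {p..1} \<and> t \<le> p) \<longrightarrow>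
      t / p * sqrt (p * (1 - p)) * x + sqrt p * f (t / p)
      = (1 - t) / (1 - p) * sqrt (p * (1 - p)) * x + sqrt (1 - p) * g ((t - p) / (1 - p))"
    proof (intro allI impI)
      fix t assume "(t \<in> {0..p} \<and> \<not> t \<le> p) \<or> (t \<in> {p..1} \<and> t \<le> p)"
      then have "t = p" by auto
      then show "t / p * sqrt (p * (1 - p)) * x + sqrt p * f (t / p)
        = (1 - t) / (1 - p) * sqrt (p * (1 - p)) * x + sqrt (1 - p) * g ((t - p) / (1 - p))"
        using p f g by simp
    qed
  qed (use p f' g' in \<open>auto intro!: continuous_intros\<close>)
  moreover have "{0..p} \<union> {p..1} = {0..1::real}" using p by auto
  ultimately show ?thesis by (simp add: eq)
qed

lemma gaussian_process_cong_kernel: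
  assumes "gaussian_process T K B" "\<And>s t. s \<in> T \<Longrightarrow> t \<in> T \<Longrightarrow> K s t = K' s t"
  shows "gaussian_process T K' B"
proof -
  have "(\<Sum>i<n. \<Sum>j<n. cs i * cs j * K (ts i) (ts j)) = (\<Sum>i<n. \<Sum>j<n. cs i * cs j * K' (ts i) (ts j))"
    if "\<forall>i<n. ts i \<in> T" for n :: nat and cs ts :: "nat \<Rightarrow> real"
    using that assms(2) by (intro sum.cong) auto
  with assms(1) show ?thesis unfolding gaussian_process_def by simp
qed

lemma gaussian_bridge_concat:
  assumes p: "0 < p" "p < 1" and B: "gaussian_bridge B1" "gaussian_bridge B2"
  shows "gaussian_bridge (random_concat p B1 B2)"
  unfolding gaussian_bridge_def
proof (intro conjI allI)
  show "gaussian_process {0..1} bridge_kernel (random_concat p B1 B2)"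
    using gaussian_process_concat[OF p, of bridge_kernel B1 bridge_kernel B2] B
    unfolding gaussian_bridge_def by (auto intro: gaussian_process_cong_kernel simp: concat_bridge_kernel[OF p])
  fix \<omega>
  show "continuous_on {0..1} (\<lambda>t. random_concat p B1 B2 t \<omega>)"
    using continuous_on_bridge_concat[OF p, of "\<lambda>s. B1 s (odds \<omega>)" "\<lambda>s. B2 s (evens \<omega>)" "\<omega> 0"] B
    unfolding gaussian_bridge_def random_concat_def by auto
  show "random_concat p B1 B2 0 \<omega> = 0" "random_concat p B1 B2 1 \<omega> = 0"
    using bridge_concat_ends[OF p] B unfolding gaussian_bridge_def random_concat_def by auto
qed

text \<open>Levy's construction: the bridge is the limit of the iterates of midpoint concatenation. The
  iteration halves the distance of the covariance to that of the Brownian bridge, and its increments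
  at stage k only involve coordinates below 2^(k+1).\<close>

primrec levy :: "nat \<Rightarrow> real \<Rightarrow> (nat \<Rightarrow> real) \<Rightarrow> real" where
  "levy 0 = (\<lambda>t \<omega>. 0)"
| "levy (Suc k) = random_concat (1 / 2) (levy k) (levy k)"

primrec levy_kernel :: "nat \<Rightarrow> real \<Rightarrow> real \<Rightarrow> real" where
  "levy_kernel 0 = (\<lambda>s t. 0)"
| "levy_kernel (Suc k) = concat_kernel (1 / 2) (levy_kernel k) (levy_kernel k)"

lemma gaussian_process_levy: "gaussian_process {0..1} (levy_kernel k) (levy k)"
proof (induction k)
  case 0
  then show ?case by (simp add: gaussian_process_def Gauss.prob_space[simplified])
next
  case (Suc k)
  then show ?case by (simp add: gaussian_process_concat)
qed

lemma levy_ends: "levy k 0 \<omega> = 0 \<and> levy k 1 \<omega> = 0"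
  by (induction k arbitrary: \<omega>) (auto simp: random_concat_def bridge_concat_ends)

lemma continuous_on_levy: "continuous_on {0..1} (\<lambda>t. levy k t \<omega>)"
proof (induction k arbitrary: \<omega>)
  case (Suc k)
  then show ?case
    using continuous_on_bridge_concat[of "1/2" "\<lambda>s. levy k s (odds \<omega>)" "\<lambda>s. levy k s (evens \<omega>)" "\<omega> 0"]
    by (simp add: random_concat_def levy_ends)
qed simp

text \<open>The midpoint terms of the two kernels cancel. If both times lie in the same half, the
  coefficient of the remaining difference is 1/2; otherwise nothing remains.\<close>

lemma levy_kernel_close:
  "s \<in> {0..1} \<Longrightarrow> t \<in> {0..1} \<Longrightarrow> \<bar>levy_kernel k s t - bridge_kernel s t\<bar> \<le> (1 / 2) ^ k"
proof (induction k arbitrary: s t)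
  case 0
  have "0 \<le> s * t" "s * t \<le> s" "s * t \<le> t" using 0 by (auto simp: mult_left_le mult_left_le_one_le)
  then have "0 \<le> min s t - s * t" "min s t - s * t \<le> 1" using 0 by auto
  then show ?case by (simp add: bridge_kernel_def)
next
  case (Suc k)
  have "levy_kernel (Suc k) s t - bridge_kernel s t = concat_kernel (1 / 2) (levy_kernel k) (levy_kernel k) s t - concat_kernel (1 / 2) bridge_kernel bridge_kernel s t"
    by (simp add: concat_bridge_kernel)
  also have "\<dots> = left_coeff (1 / 2) s * left_coeff (1 / 2) t * (levy_kernel k (left_time (1 / 2) s) (left_time (1 / 2) t) - bridge_kernel (left_time (1 / 2) s) (left_time (1 / 2) t))
    + right_coeff (1 / 2) s * right_coeff (1 / 2) t * (levy_kernel k (right_time (1 / 2) s) (right_time (1 / 2) t) - bridge_kernel (right_time (1 / 2) s) (right_time (1 / 2) t))"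
    unfolding concat_kernel_def by (simp add: algebra_simps)
  finally have eq: "levy_kernel (Suc k) s t - bridge_kernel s t = \<dots>" .
  have L: "\<bar>levy_kernel k (left_time (1 / 2) s) (left_time (1 / 2) t) - bridge_kernel (left_time (1 / 2) s) (left_time (1 / 2) t)\<bar> \<le> (1 / 2) ^ k"
    and R: "\<bar>levy_kernel k (right_time (1 / 2) s) (right_time (1 / 2) t) - bridge_kernel (right_time (1 / 2) s) (right_time (1 / 2) t)\<bar> \<le> (1 / 2) ^ k"
    using Suc.prems by (intro Suc.IH concat_time_in; simp)+
  show ?case unfolding eq using L R by (auto simp: left_coeff_def right_coeff_def abs_mult)
qed

lemma mid_coeff_half: "t \<in> {0..1} \<Longrightarrow> \<bar>mid_coeff (1 / 2) t\<bar> \<le> 1"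
proof -
  assume t: "t \<in> {0..1}"
  have "sqrt (1 / 2 * (1 - 1 / 2)) = (1 / 2 :: real)" by (rule real_sqrt_unique) (auto simp: power2_eq_square)
  then have "mid_coeff (1 / 2) t = (if t \<le> 1 / 2 then t else 1 - t)" by (simp only: mid_coeff_def) simp
  then show ?thesis using t by auto
qed

text \<open>Consecutive stages share the midpoint term, so their difference is passed down to the
  halves and gains a factor \<open>sqrt (1 / 2)\<close> each time. Writing the index condition with
  \<open>i + 1\<close> makes it stable under the maps to \<open>2 * i + 1\<close> and
  \<open>2 * i + 2\<close> as \<open>k\<close> grows by one.\<close>

lemma levy_diff:
  assumes "t \<in> {0..1}" "\<And>i. i + 1 < 2 ^ (k + 1) \<Longrightarrow> \<bar>\<omega> i\<bar> \<le> R"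
  shows "\<bar>levy (Suc k) t \<omega> - levy k t \<omega>\<bar> \<le> sqrt (1 / 2) ^ k * R"
  using assms
proof (induction k arbitrary: t \<omega>)
  case 0
  have "\<bar>mid_coeff (1 / 2) t * \<omega> 0\<bar> \<le> 1 * R"
    unfolding abs_mult using 0 mid_coeff_half by (intro mult_mono) auto
  then show ?case by (simp add: random_concat_def bridge_concat_def)
next
  case (Suc k)
  let ?l = "levy (Suc k) (left_time (1/2) t) (odds \<omega>) - levy k (left_time (1/2) t) (odds \<omega>)"
  let ?r = "levy (Suc k) (right_time (1/2) t) (evens \<omega>) - levy k (right_time (1/2) t) (evens \<omega>)"
  have eq: "levy (Suc (Suc k)) t \<omega> - levy (Suc k) t \<omega> = left_coeff (1/2) t * ?l + right_coeff (1/2) t * ?r"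
    unfolding levy.simps(2)[of "Suc k"] unfolding levy.simps(2)[of k, THEN fun_cong, THEN fun_cong, of t \<omega>]
    by (simp only: random_concat_def bridge_concat_def) (simp add: algebra_simps)
  have lt: "left_time (1/2) t \<in> {0..1}" "right_time (1/2) t \<in> {0..1}"
    using Suc.prems(1) by (intro concat_time_in; simp)+
  have l: "\<bar>?l\<bar> \<le> sqrt (1 / 2) ^ k * R"
    using lt(1) by (rule Suc.IH) (use Suc.prems(2) in \<open>simp add: odds_def\<close>)
  have r: "\<bar>?r\<bar> \<le> sqrt (1 / 2) ^ k * R"
    using lt(2) by (rule Suc.IH) (use Suc.prems(2) in \<open>simp add: evens_def\<close>)
  show ?case
  proof (cases "t \<le> 1 / 2")
    case True
    then show ?thesis unfolding eq using mult_left_mono[OF l, of "sqrt (1/2)"]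
      by (simp add: left_coeff_def right_coeff_def abs_mult)
  next
    case False
    then show ?thesis unfolding eq using mult_left_mono[OF r, of "sqrt (1/2)"]
      by (simp add: left_coeff_def right_coeff_def abs_mult)
  qed
qed

section \<open>The limit of Levy's construction and the moment of its supremum\<close>

lemma nn_integral_Gauss_component:
  assumes "f \<in> borel_measurable borel"
  shows "(\<integral>\<^sup>+\<omega>. f (\<omega> i) \<partial>Gauss) = (\<integral>\<^sup>+x. f x \<partial>std_normal)"
proof -
  have "distr Gauss std_normal (\<lambda>\<omega>. \<omega> i) = std_normal"
    unfolding Gauss_def by (rule distr_PiM_component) (auto intro: prob_space_std_normal)
  then have "(\<integral>\<^sup>+x. f x \<partial>std_normal) = (\<integral>\<^sup>+x. f x \<partial>distr Gauss std_normal (\<lambda>\<omega>. \<omega> i))" by simp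
  also have "\<dots> = (\<integral>\<^sup>+\<omega>. f (\<omega> i) \<partial>Gauss)"
    using assms by (intro nn_integral_distr) (auto simp: measurable_cong_sets[OF refl, of std_normal borel Gauss])
  finally show ?thesis ..
qed

lemma std_normal_exp_abs: "(\<integral>\<^sup>+g. ennreal (exp \<bar>g\<bar>) \<partial>std_normal) \<le> ennreal (2 * exp (1 / 2))"
proof -
  have "(\<integral>\<^sup>+g. ennreal (exp \<bar>g\<bar>) \<partial>std_normal)
      \<le> (\<integral>\<^sup>+g. ennreal (exp (1 * g + 0 * g\<^sup>2)) + ennreal (exp ((- 1) * g + 0 * g\<^sup>2)) \<partial>std_normal)"
    by (intro nn_integral_mono) (auto simp: abs_if simp flip: ennreal_plus)
  also have "\<dots> = ennreal (exp (1 / 2)) + ennreal (exp (1 / 2))"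
    by (subst nn_integral_add) (auto simp: std_normal_exp_quadratic[of 0 1, simplified] std_normal_exp_quadratic[of 0 "- 1", simplified])
  finally show ?thesis by (simp flip: ennreal_plus)
qed

text \<open>The series \<open>Q\<close> controls all coordinates at once: the absolute value of
  coordinate \<open>i\<close> is at most \<open>2 * ln (i + 1) + ln Q\<close>. Stage
  \<open>k\<close> hence contributes at most \<open>r ^ k * (2 * (k + 1) + ln Q)\<close>, the
  supremum is at most \<open>A1 + A2 * ln Q\<close>, and an exponential moment of this majorant
  reduces to the mean of \<open>Q\<close>, finite because \<open>exp \<bar>g\<bar>\<close> is
  integrable.\<close>

lemma exists_gaussian_bridge:
  "\<exists>B R a C. gaussian_bridge B \<and> R \<in> borel_measurable Gauss \<and> (\<forall>\<omega>. \<forall>t\<in>{0..1}. \<bar>B t \<omega>\<bar> \<le> R \<omega>) \<and>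
     (\<forall>\<omega>. 0 \<le> R \<omega>) \<and> 0 < a \<and> (\<integral>\<^sup>+\<omega>. ennreal (exp (a * R \<omega>)) \<partial>Gauss) \<le> ennreal C"
proof -
  define Q where "Q \<omega> = (\<Sum>i. ennreal (exp \<bar>\<omega> i\<bar> / (real i + 1)\<^sup>2))" for \<omega> :: "nat \<Rightarrow> real"
  define q where "q \<omega> = enn2real (Q \<omega>)" for \<omega>
  define r where "r = sqrt (1 / 2 :: real)"
  have r: "0 < r" "r < 1" unfolding r_def by (auto intro!: real_less_lsqrt)
  \<comment> \<open>Where \<open>Q\<close> is infinite, a null event, \<open>B\<close> and
    \<open>R\<close> are set to 0, so that continuity, end values and the bound hold for every
    \<open>\<omega>\<close>.\<close>
  define good where "good \<omega> \<longleftrightarrow> Q \<omega> < \<top>" for \<omega>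
  define f where "f \<omega> k t = levy (Suc k) t \<omega> - levy k t \<omega>" for \<omega> k t
  define A1 where "A1 = (\<Sum>k. r ^ k * (2 * (real k + 1)))"
  define A2 where "A2 = (\<Sum>k. r ^ k)"
  define B where "B t \<omega> = (if good \<omega> then \<Sum>k. f \<omega> k t else 0)" for t \<omega>
  define R where "R \<omega> = (if good \<omega> then A1 + A2 * ln (q \<omega>) else 0)" for \<omega>
  have s2: "summable (\<lambda>k. r ^ k)" using r by (intro summable_geometric) auto
  have s1: "summable (\<lambda>k. r ^ k * (2 * (real k + 1)))"
  proof -
    have "summable (\<lambda>k. real (Suc k) * r ^ k)"
      using sums_summable[OF geometric_deriv_sums[of r]] r by simp
    then have "summable (\<lambda>k. 2 * (real (Suc k) * r ^ k))" by (rule summable_mult)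
    then show ?thesis by (rule back_subst[of summable]) (auto simp: fun_eq_iff algebra_simps)
  qed
  have "sum (\<lambda>k. r ^ k) {0} \<le> A2" unfolding A2_def by (rule sum_le_suminf[OF s2]) (use r in auto)
  then have A2: "1 \<le> A2" by simp
  have A1: "0 \<le> A1" unfolding A1_def using s1 r by (intro suminf_nonneg) auto
  have Qm [measurable]: "Q \<in> borel_measurable Gauss" unfolding Q_def by measurable
  have Qq: "Q \<omega> = ennreal (q \<omega>)" if "good \<omega>" for \<omega>
    using that ennreal_enn2real[of "Q \<omega>"] unfolding q_def good_def by metis
  have le_suminf: "g i \<le> (\<Sum>i. g i)" for g :: "nat \<Rightarrow> ennreal" and i
    using sum_le_suminf[of g "{i}"] by (simp add: summableI)
  have term_le: "exp \<bar>\<omega> i\<bar> \<le> (real i + 1)\<^sup>2 * q \<omega>" if "good \<omega>" for \<omega> i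
  proof -
    have "ennreal (exp \<bar>\<omega> i\<bar> / (real i + 1)\<^sup>2) \<le> Q \<omega>"
      unfolding Q_def by (rule le_suminf)
    also have "Q \<omega> = ennreal (q \<omega>)" by (rule Qq[OF that])
    finally have "exp \<bar>\<omega> i\<bar> / (real i + 1)\<^sup>2 \<le> q \<omega>"
      using ennreal_le_iff[of "q \<omega>"] enn2real_nonneg[of "Q \<omega>"] unfolding q_def by blast
    then show ?thesis by (simp add: divide_le_eq mult.commute)
  qed
  have q1: "1 \<le> q \<omega>" if "good \<omega>" for \<omega>
  proof -
    have "1 \<le> exp \<bar>\<omega> 0\<bar>" by simp
    also have "\<dots> \<le> q \<omega>" using term_le[OF that, of 0] by simp
    finally show ?thesis .
  qed
  \<comment> \<open>The index range is that of the coordinates used up to stage \<open>k\<close>, so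
    \<open>ln (i + 1)\<close> is at most linear in \<open>k\<close>; this growth is beaten by the
    geometric factor.\<close>
  have comp: "\<bar>\<omega> i\<bar> \<le> 2 * (real k + 1) + ln (q \<omega>)" if "good \<omega>" "i + 1 < 2 ^ (k + 1)" for \<omega> i k
  proof -
    have "\<bar>\<omega> i\<bar> = ln (exp \<bar>\<omega> i\<bar>)" by simp
    also have "\<dots> \<le> ln ((real i + 1)\<^sup>2 * q \<omega>)" using term_le[OF that(1), of i] q1[OF that(1)] by (subst ln_le_cancel_iff) auto
    also have "\<dots> = 2 * ln (real i + 1) + ln (q \<omega>)" using q1[OF that(1)] by (simp add: ln_mult ln_realpow)
    also have "ln (real i + 1) \<le> real k + 1"
    proof -
      have "real (i + 1) \<le> real (2 ^ (k + 1))" using that(2) by (intro of_nat_mono) simp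
      then have "ln (real i + 1) \<le> ln (2 ^ (k + 1))" by (subst ln_le_cancel_iff) auto
      also have "\<dots> = real (k + 1) * ln 2" by (rule ln_realpow)
      also have "\<dots> = (real k + 1) * ln 2" by simp
      also have "\<dots> \<le> (real k + 1) * 1" using ln_2_less_1 by (intro mult_left_mono) auto
      finally show ?thesis by simp
    qed
    finally show ?thesis by simp
  qed
  have f_le: "norm (f \<omega> k t) \<le> r ^ k * (2 * (real k + 1)) + ln (q \<omega>) * r ^ k" if "good \<omega>" "t \<in> {0..1}" for \<omega> k t
  proof -
    have "\<bar>f \<omega> k t\<bar> \<le> r ^ k * (2 * (real k + 1) + ln (q \<omega>))"
      unfolding f_def r_def by (rule levy_diff[OF that(2) comp[OF that(1)]]) simp
    then show ?thesis by (simp add: algebra_simps)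
  qed
  have sM: "summable (\<lambda>k. r ^ k * (2 * (real k + 1)) + ln (q \<omega>) * r ^ k)" for \<omega>
    by (intro summable_add s1 summable_mult s2)
  have part: "(\<Sum>k<n. f \<omega> k t) = levy n t \<omega>" for n \<omega> t
    unfolding f_def by (subst sum_lessThan_telescope) simp
  have B_le: "\<bar>B t \<omega>\<bar> \<le> R \<omega>" if "t \<in> {0..1}" for t \<omega>
  proof (cases "good \<omega>")
    case True
    have "norm (\<Sum>k. f \<omega> k t) \<le> (\<Sum>k. r ^ k * (2 * (real k + 1)) + ln (q \<omega>) * r ^ k)"
      by (rule norm_suminf_le[OF f_le[OF True that] sM])
    also have "\<dots> = A1 + ln (q \<omega>) * A2"
      unfolding A1_def A2_def suminf_mult[OF s2, symmetric]
      by (rule suminf_add[OF s1 summable_mult[OF s2], symmetric])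
    finally show ?thesis using True by (simp add: B_def R_def mult.commute)
  qed (simp add: B_def R_def)
  have R0: "0 \<le> R \<omega>" for \<omega> using q1[of \<omega>] A1 A2 by (auto simp: R_def intro!: add_nonneg_nonneg mult_nonneg_nonneg)
  have good_m [measurable]: "Measurable.pred Gauss good" unfolding good_def by measurable
  have q_m [measurable]: "q \<in> borel_measurable Gauss" unfolding q_def by measurable
  have R_m: "R \<in> borel_measurable Gauss" unfolding R_def by measurable
  define EQ where "EQ = 2 * exp (1 / 2) * (\<Sum>i. 1 / (real i + 1)\<^sup>2)"
  have sq: "summable (\<lambda>i. 1 / (real i + 1)\<^sup>2)"
    using summable_Suc_iff[of "\<lambda>n. inverse (real n ^ 2)"] inverse_power_summable[of 2, where 'a=real]
    by (simp add: inverse_eq_divide add.commute)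
  have EQ: "(\<integral>\<^sup>+\<omega>. Q \<omega> \<partial>Gauss) \<le> ennreal EQ"
  proof -
    have "(\<integral>\<^sup>+\<omega>. Q \<omega> \<partial>Gauss) = (\<Sum>i. \<integral>\<^sup>+\<omega>. ennreal (exp \<bar>\<omega> i\<bar> / (real i + 1)\<^sup>2) \<partial>Gauss)"
      unfolding Q_def by (rule nn_integral_suminf) measurable
    also have "\<dots> \<le> (\<Sum>i. ennreal (2 * exp (1 / 2) * (1 / (real i + 1)\<^sup>2)))"
    proof (intro suminf_le)
      fix i
      have "(\<integral>\<^sup>+\<omega>. ennreal (exp \<bar>\<omega> i\<bar> / (real i + 1)\<^sup>2) \<partial>Gauss) = (\<integral>\<^sup>+g. ennreal (exp \<bar>g\<bar> / (real i + 1)\<^sup>2) \<partial>std_normal)"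
        by (rule nn_integral_Gauss_component) measurable
      also have "\<dots> = (\<integral>\<^sup>+g. ennreal (1 / (real i + 1)\<^sup>2) * ennreal (exp \<bar>g\<bar>) \<partial>std_normal)"
        by (intro nn_integral_cong) (simp flip: ennreal_mult)
      also have "\<dots> = ennreal (1 / (real i + 1)\<^sup>2) * (\<integral>\<^sup>+g. ennreal (exp \<bar>g\<bar>) \<partial>std_normal)"
        by (rule nn_integral_cmult) simp
      also have "\<dots> \<le> ennreal (1 / (real i + 1)\<^sup>2) * ennreal (2 * exp (1 / 2))"
        by (intro mult_left_mono std_normal_exp_abs) simp
      also have "\<dots> = ennreal (2 * exp (1 / 2) * (1 / (real i + 1)\<^sup>2))"
        by (simp add: mult.commute flip: ennreal_mult)
      finally show "(\<integral>\<^sup>+\<omega>. ennreal (exp \<bar>\<omega> i\<bar> / (real i + 1)\<^sup>2) \<partial>Gauss) \<le> ennreal (2 * exp (1 / 2) * (1 / (real i + 1)\<^sup>2))" .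
    qed auto
    also have "\<dots> = ennreal (\<Sum>i. 2 * exp (1 / 2) * (1 / (real i + 1)\<^sup>2))"
      by (rule suminf_ennreal2[OF _ summable_mult[OF sq]]) simp
    also have "(\<Sum>i. 2 * exp (1 / 2) * (1 / (real i + 1)\<^sup>2)) = EQ"
      unfolding EQ_def by (rule suminf_mult[OF sq])
    finally show ?thesis .
  qed
  have EQ0: "0 \<le> EQ" unfolding EQ_def using sq by (auto intro!: mult_nonneg_nonneg suminf_nonneg)
  have AE_good: "AE \<omega> in Gauss. good \<omega>"
  proof -
    have "(\<integral>\<^sup>+\<omega>. Q \<omega> \<partial>Gauss) \<noteq> \<infinity>" using EQ by (metis ennreal_less_top infinity_ennreal_def not_le order.strict_trans1 top.extremum_uniqueI top_neq_ennreal)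
    then have "AE \<omega> in Gauss. Q \<omega> \<noteq> \<infinity>" by (rule nn_integral_noteq_infinite[OF Qm])
    then show ?thesis by eventually_elim (simp add: good_def less_top)
  qed
  have conv: "(\<lambda>n. levy n t \<omega>) \<longlonglongrightarrow> B t \<omega>" if "good \<omega>" "t \<in> {0..1}" for t \<omega>
  proof -
    have "summable (\<lambda>k. f \<omega> k t)" by (rule summable_comparison_test'[OF sM f_le[OF that]])
    from summable_LIMSEQ[OF this] show ?thesis using that by (simp add: part B_def)
  qed
  have lm: "levy k t \<in> borel_measurable Gauss" if "t \<in> {0..1}" for k t
    using gaussian_process_levy[of k] that unfolding gaussian_process_def by blast
  have Bm: "B t \<in> borel_measurable Gauss" if "t \<in> {0..1}" for t
  proof -
    have [measurable]: "(\<lambda>\<omega>. f \<omega> k t) \<in> borel_measurable Gauss" for k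
      unfolding f_def by (rule borel_measurable_diff[OF lm lm]) (rule that)+
    show ?thesis unfolding B_def by measurable
  qed
  have gp: "gaussian_process {0..1} bridge_kernel B"
    unfolding gaussian_process_def
  proof (intro conjI ballI allI impI)
    fix n :: nat and cs ts :: "nat \<Rightarrow> real" assume ts: "\<forall>i<n. ts i \<in> {0..1}"
    define V where "V K = (\<Sum>i<n. \<Sum>j<n. cs i * cs j * K (ts i) (ts j))" for K
    \<comment> \<open>The integrands are bounded by 1 and converge almost surely, so the
      characteristic functions of the stages converge to those of \<open>B\<close>; the covariances
      converge separately.\<close>
    have lim1: "(\<lambda>k. CLINT \<omega>|Gauss. iexp (\<Sum>i<n. cs i * levy k (ts i) \<omega>)) \<longlonglongrightarrow> (CLINT \<omega>|Gauss. iexp (\<Sum>i<n. cs i * B (ts i) \<omega>))"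
    proof (rule integral_dominated_convergence[where w="\<lambda>_. 1"])
      have im: "iexp \<in> borel_measurable borel" by (intro borel_measurable_continuous_onI continuous_intros)
      have "(\<lambda>\<omega>. \<Sum>i<n. cs i * B (ts i) \<omega>) \<in> borel_measurable Gauss"
        using ts Bm by (intro borel_measurable_sum borel_measurable_times) auto
      then show "(\<lambda>\<omega>. iexp (\<Sum>i<n. cs i * B (ts i) \<omega>)) \<in> borel_measurable Gauss"
        by (rule measurable_compose[OF _ im])
      have "(\<lambda>\<omega>. \<Sum>i<n. cs i * levy k (ts i) \<omega>) \<in> borel_measurable Gauss" for k
        using ts lm by (intro borel_measurable_sum borel_measurable_times) auto
      then show "(\<lambda>\<omega>. iexp (\<Sum>i<n. cs i * levy k (ts i) \<omega>)) \<in> borel_measurable Gauss" for k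
        by (rule measurable_compose[OF _ im])
      show "AE \<omega> in Gauss. (\<lambda>k. iexp (\<Sum>i<n. cs i * levy k (ts i) \<omega>)) \<longlonglongrightarrow> iexp (\<Sum>i<n. cs i * B (ts i) \<omega>)"
        using AE_good
      proof eventually_elim
        case (elim \<omega>)
        have "(\<lambda>k. \<Sum>i<n. cs i * levy k (ts i) \<omega>) \<longlonglongrightarrow> (\<Sum>i<n. cs i * B (ts i) \<omega>)"
          using ts conv[OF elim] by (intro tendsto_sum tendsto_mult tendsto_const) auto
        then show ?case by (intro tendsto_exp tendsto_mult tendsto_const tendsto_of_real)
      qed
    qed auto
    have "(\<lambda>k. V (levy_kernel k)) \<longlonglongrightarrow> V bridge_kernel"
      unfolding V_def
    proof (intro tendsto_sum tendsto_mult tendsto_const)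
      fix i j assume "i \<in> {..<n}" "j \<in> {..<n}"
      then have "norm (levy_kernel k (ts i) (ts j) - bridge_kernel (ts i) (ts j)) \<le> (1 / 2) ^ k" for k
        using ts levy_kernel_close[of "ts i" "ts j" k] by simp
      then have "\<forall>\<^sub>F k in sequentially. norm (levy_kernel k (ts i) (ts j) - bridge_kernel (ts i) (ts j)) \<le> (1 / 2) ^ k"
        by (intro always_eventually allI)
      moreover have "(\<lambda>k. (1 / 2 :: real) ^ k) \<longlonglongrightarrow> 0" by (intro LIMSEQ_power_zero) simp
      ultimately have "(\<lambda>k. levy_kernel k (ts i) (ts j) - bridge_kernel (ts i) (ts j)) \<longlonglongrightarrow> 0"
        by (rule Lim_null_comparison)
      then show "(\<lambda>k. levy_kernel k (ts i) (ts j)) \<longlonglongrightarrow> bridge_kernel (ts i) (ts j)" by (simp add: LIM_zero_iff)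
    qed
    then have "(\<lambda>k. complex_of_real (exp (- V (levy_kernel k) / 2))) \<longlonglongrightarrow> of_real (exp (- V bridge_kernel / 2))"
      by (intro tendsto_of_real tendsto_exp tendsto_divide tendsto_minus tendsto_const) auto
    moreover have "(CLINT \<omega>|Gauss. iexp (\<Sum>i<n. cs i * levy k (ts i) \<omega>)) = of_real (exp (- V (levy_kernel k) / 2))" for k
      unfolding V_def by (rule gaussian_process_iexp[OF gaussian_process_levy]) (use ts in auto)
    ultimately show "(CLINT \<omega>|Gauss. iexp (\<Sum>i<n. cs i * B (ts i) \<omega>)) = of_real (exp (- (\<Sum>i<n. \<Sum>j<n. cs i * cs j * bridge_kernel (ts i) (ts j)) / 2))"
      using LIMSEQ_unique[OF lim1] by (simp add: V_def)
  qed (rule Bm)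
  have contB: "continuous_on {0..1} (\<lambda>t. B t \<omega>)" for \<omega>
  proof (cases "good \<omega>")
    case True
    have "uniform_limit {0..1} (\<lambda>n t. \<Sum>k<n. f \<omega> k t) (\<lambda>t. \<Sum>k. f \<omega> k t) sequentially"
      by (rule Weierstrass_m_test[OF f_le[OF True] sM])
    then have "continuous_on {0..1} (\<lambda>t. \<Sum>k. f \<omega> k t)"
      by (rule uniform_limit_theorem[rotated]) (auto simp: part continuous_on_levy)
    then show ?thesis using True by (simp add: B_def)
  qed (simp add: B_def)
  have ends: "B 0 \<omega> = 0" "B 1 \<omega> = 0" for \<omega>
    using levy_ends by (auto simp: B_def f_def simp del: levy.simps)
  have "(\<integral>\<^sup>+\<omega>. ennreal (exp (1 / A2 * R \<omega>)) \<partial>Gauss) \<le> (\<integral>\<^sup>+\<omega>. ennreal (exp (A1 / A2)) * Q \<omega> + 1 \<partial>Gauss)"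
  proof (intro nn_integral_mono)
    fix \<omega>
    show "ennreal (exp (1 / A2 * R \<omega>)) \<le> ennreal (exp (A1 / A2)) * Q \<omega> + 1"
    proof (cases "good \<omega>")
      case True
      \<comment> \<open>The rate \<open>1 / A2\<close> is chosen to turn
        \<open>exp (A2 * ln q)\<close> back into \<open>q\<close> itself; the summand 1 in the bound
        covers the exceptional event.\<close>
      have "exp (1 / A2 * R \<omega>) = exp (A1 / A2) * q \<omega>"
        using True A2 q1[OF True] by (simp add: R_def add_divide_distrib exp_add)
      moreover have "0 \<le> q \<omega>" using q1[OF True] by simp
      ultimately show ?thesis unfolding Qq[OF True] by (simp add: ennreal_mult)
    qed (simp add: R_def)
  qed
  also have "\<dots> = ennreal (exp (A1 / A2)) * (\<integral>\<^sup>+\<omega>. Q \<omega> \<partial>Gauss) + 1"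
    by (subst nn_integral_add) (auto simp: nn_integral_cmult Gauss.emeasure_space_1[simplified])
  also have "\<dots> \<le> ennreal (exp (A1 / A2)) * ennreal EQ + 1" by (intro add_right_mono mult_left_mono EQ) auto
  also have "\<dots> = ennreal (exp (A1 / A2) * EQ + 1)" using EQ0 by (simp add: ennreal_mult ennreal_plus)
  finally have mom: "(\<integral>\<^sup>+\<omega>. ennreal (exp (1 / A2 * R \<omega>)) \<partial>Gauss) \<le> ennreal (exp (A1 / A2) * EQ + 1)" .
  have "gaussian_bridge B" unfolding gaussian_bridge_def using gp contB ends by blast
  moreover have "0 < 1 / A2" using A2 by simp
  ultimately show ?thesis using R_m B_le R0 mom by blast
qed

section \<open>Independence from characteristic functions\<close>

context prob_space
begin

text \<open>Normalised by its mean, \<open>Y\<close> is a probability density. The hypothesis says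
  that \<open>X\<close> has the same characteristic function under the weighted measure as under
  \<open>M\<close>, so by Levy's uniqueness theorem it has the same law.\<close>

lemma integral_indicator_of_char_nonneg:
  fixes X Y :: "'a \<Rightarrow> real"
  assumes X [measurable]: "random_variable borel X" and Y [measurable]: "random_variable borel Y"
    and Y0: "\<And>\<omega>. 0 \<le> Y \<omega>" and YC: "\<And>\<omega>. Y \<omega> \<le> C"
    and char: "\<And>u. (CLINT \<omega>|M. of_real (Y \<omega>) * iexp (u * X \<omega>)) = of_real (expectation Y) * (CLINT \<omega>|M. iexp (u * X \<omega>))"
    and A [measurable]: "A \<in> sets borel"
  shows "(\<integral>\<omega>. Y \<omega> * indicator A (X \<omega>) \<partial>M) = expectation Y * prob (X -` A \<inter> space M)"
proof -
  have intY: "integrable M Y"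
    by (rule integrable_const_bound[where B=C]) (use Y0 YC in auto)
  define m where "m = expectation Y"
  have m0: "0 \<le> m" unfolding m_def using Y0 by (intro Bochner_Integration.integral_nonneg)
  show ?thesis
  proof (cases "m = 0")
    case True
    then have "AE \<omega> in M. Y \<omega> = 0"
      using integral_nonneg_eq_0_iff_AE[OF intY] Y0 by (simp add: m_def)
    then have "(\<integral>\<omega>. Y \<omega> * indicator A (X \<omega>) \<partial>M) = (\<integral>\<omega>. 0 \<partial>M)" by (intro integral_cong_AE) auto
    then show ?thesis using True by (simp add: m_def)
  next
    case False
    then have m: "m > 0" using m0 by simp
    define D where "D = density M (\<lambda>\<omega>. ennreal (Y \<omega> / m))"
    have D: "prob_space D"
    proof
      have "emeasure D (space D) = (\<integral>\<^sup>+\<omega>. ennreal (Y \<omega> / m) \<partial>M)"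
        by (simp add: D_def emeasure_density cong: nn_integral_cong)
      also have "\<dots> = ennreal (\<integral>\<omega>. Y \<omega> / m \<partial>M)"
        using m Y0 intY by (intro nn_integral_eq_integral) auto
      also have "(\<integral>\<omega>. Y \<omega> / m \<partial>M) = 1" using m by (simp add: m_def)
      finally show "emeasure D (space D) = 1" by simp
    qed
    interpret D: prob_space D by (rule D)
    have XD [measurable]: "X \<in> borel_measurable D" by (simp add: D_def)
    have iexp_m: "iexp \<in> borel_measurable borel" by (intro borel_measurable_continuous_onI continuous_intros)
    have "char (distr D borel X) = char (distr M borel X)"
    proof
      fix u
      have m1: "(\<lambda>x. iexp (u * x)) \<in> borel_measurable borel"
        by (intro borel_measurable_continuous_onI continuous_intros)
      have m2: "(\<lambda>\<omega>. iexp (u * X \<omega>)) \<in> borel_measurable M" by (rule measurable_compose[OF X m1])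
      have "char (distr D borel X) u = (CLINT \<omega>|D. iexp (u * X \<omega>))"
        unfolding char_def by (rule integral_distr[OF XD m1])
      also have "\<dots> = (CLINT \<omega>|M. (Y \<omega> / m) *\<^sub>R iexp (u * X \<omega>))"
        unfolding D_def using m Y0 by (intro integral_density m2) auto
      also have "\<dots> = (CLINT \<omega>|M. of_real (1 / m) * (of_real (Y \<omega>) * iexp (u * X \<omega>)))"
        by (intro Bochner_Integration.integral_cong refl) (simp add: scaleR_conv_of_real)
      also have "\<dots> = of_real (1 / m) * (of_real m * (CLINT \<omega>|M. iexp (u * X \<omega>)))"
        unfolding integral_mult_right_zero char m_def ..
      also have "\<dots> = char (distr M borel X) u"
        unfolding char_def using m by (subst integral_distr[OF X m1]) simp
      finally show "char (distr D borel X) u = char (distr M borel X) u" .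
    qed
    then have eq: "distr D borel X = distr M borel X"
      by (intro Levy_uniqueness D.real_distribution_distr real_distribution_distr XD X)
    have "(\<integral>\<omega>. Y \<omega> * indicator A (X \<omega>) \<partial>M) = m * (\<integral>\<omega>. (Y \<omega> / m) *\<^sub>R indicator (X -` A \<inter> space M) \<omega> \<partial>M)"
      unfolding integral_mult_right_zero[symmetric] using m
      by (intro Bochner_Integration.integral_cong refl) (auto simp: indicator_def)
    also have "(\<integral>\<omega>. (Y \<omega> / m) *\<^sub>R indicator (X -` A \<inter> space M) \<omega> \<partial>M) = (\<integral>\<omega>. (indicator (X -` A \<inter> space M) \<omega> :: real) \<partial>D)"
    proof -
      have "(\<integral>\<omega>. (indicator (X -` A \<inter> space M) \<omega> :: real) \<partial>D) = (\<integral>\<omega>. (Y \<omega> / m) *\<^sub>R (indicator (X -` A \<inter> space M) \<omega> :: real) \<partial>M)"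
        unfolding D_def by (rule integral_density) (use m Y0 in auto)
      then show ?thesis by simp
    qed
    also have "\<dots> = measure D (X -` A \<inter> space D)"
      by (simp add: D_def)
    also have "\<dots> = measure (distr D borel X) A" by (simp add: measure_distr)
    also have "\<dots> = prob (X -` A \<inter> space M)" unfolding eq by (simp add: measure_distr)
    finally show ?thesis by (simp add: m_def)
  qed
qed

text \<open>Adding the constant \<open>C\<close> makes \<open>Y\<close> nonnegative; hypothesis and
  conclusion are linear in \<open>Y\<close> and clearly hold for constants.\<close>

lemma integral_indicator_of_char_real:
  fixes X Y :: "'a \<Rightarrow> real"
  assumes X [measurable]: "random_variable borel X" and Y [measurable]: "random_variable borel Y"
    and YC: "\<And>\<omega>. \<bar>Y \<omega>\<bar> \<le> C"
    and char: "\<And>u. (CLINT \<omega>|M. of_real (Y \<omega>) * iexp (u * X \<omega>)) = of_real (expectation Y) * (CLINT \<omega>|M. iexp (u * X \<omega>))"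
    and A [measurable]: "A \<in> sets borel"
  shows "(\<integral>\<omega>. Y \<omega> * indicator A (X \<omega>) \<partial>M) = expectation Y * prob (X -` A \<inter> space M)"
proof -
  have intY: "integrable M Y"
    by (rule integrable_const_bound[where B=C]) (use YC in auto)
  have intYA: "integrable M (\<lambda>\<omega>. Y \<omega> * indicator A (X \<omega>))"
    by (rule integrable_const_bound[where B=C]) (use YC order_trans[OF abs_ge_zero YC] in \<open>auto simp: indicator_def\<close>)
  have intA: "integrable M (\<lambda>\<omega>. C * indicator A (X \<omega>))"
    by (intro integrable_mult_right integrable_const_bound[where B=1]) (auto simp: indicator_def)
  have e: "expectation (\<lambda>\<omega>. Y \<omega> + C) = expectation Y + C" using intY by (simp add: prob_space)
  have "(\<integral>\<omega>. (Y \<omega> + C) * indicator A (X \<omega>) \<partial>M) = expectation (\<lambda>\<omega>. Y \<omega> + C) * prob (X -` A \<inter> space M)"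
  proof (rule integral_indicator_of_char_nonneg[where C="2 * C"])
    fix u
    have m1: "(\<lambda>x. iexp (u * x)) \<in> borel_measurable borel"
      by (intro borel_measurable_continuous_onI continuous_intros)
    have [measurable]: "(\<lambda>\<omega>. iexp (u * X \<omega>)) \<in> borel_measurable M" by (rule measurable_compose[OF X m1])
    have i1: "integrable M (\<lambda>\<omega>. of_real (Y \<omega>) * iexp (u * X \<omega>))"
      by (rule integrable_const_bound[where B=C]) (use YC in \<open>auto simp: norm_mult\<close>)
    have i2: "integrable M (\<lambda>\<omega>. complex_of_real C * iexp (u * X \<omega>))"
      by (intro integrable_mult_right integrable_const_bound[where B=1]) auto
    have "(CLINT \<omega>|M. of_real (Y \<omega> + C) * iexp (u * X \<omega>)) = (CLINT \<omega>|M. of_real (Y \<omega>) * iexp (u * X \<omega>) + of_real C * iexp (u * X \<omega>))"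
      by (simp add: distrib_right)
    also have "\<dots> = (CLINT \<omega>|M. of_real (Y \<omega>) * iexp (u * X \<omega>)) + (CLINT \<omega>|M. of_real C * iexp (u * X \<omega>))"
      by (rule Bochner_Integration.integral_add[OF i1 i2])
    also have "\<dots> = of_real (expectation Y + C) * (CLINT \<omega>|M. iexp (u * X \<omega>))"
      unfolding char by (simp add: distrib_right)
    finally show "(CLINT \<omega>|M. of_real (Y \<omega> + C) * iexp (u * X \<omega>)) = of_real (expectation (\<lambda>\<omega>. Y \<omega> + C)) * (CLINT \<omega>|M. iexp (u * X \<omega>))"
      unfolding e .
  next
    fix \<omega> show "0 \<le> Y \<omega> + C" "Y \<omega> + C \<le> 2 * C" using YC[of \<omega>] by linarith+
  qed auto
  moreover have "(\<integral>\<omega>. (Y \<omega> + C) * indicator A (X \<omega>) \<partial>M) = (\<integral>\<omega>. Y \<omega> * indicator A (X \<omega>) \<partial>M) + C * prob (X -` A \<inter> space M)"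
  proof -
    have "(\<integral>\<omega>. (Y \<omega> + C) * indicator A (X \<omega>) \<partial>M) = (\<integral>\<omega>. Y \<omega> * indicator A (X \<omega>) + C * indicator A (X \<omega>) \<partial>M)"
      by (simp add: distrib_right)
    also have "\<dots> = (\<integral>\<omega>. Y \<omega> * indicator A (X \<omega>) \<partial>M) + (\<integral>\<omega>. C * indicator A (X \<omega>) \<partial>M)"
      by (rule Bochner_Integration.integral_add[OF intYA intA])
    also have "(\<integral>\<omega>. C * indicator A (X \<omega>) \<partial>M) = C * (\<integral>\<omega>. indicator (X -` A \<inter> space M) \<omega> \<partial>M)"
      unfolding integral_mult_right_zero[symmetric] by (intro Bochner_Integration.integral_cong refl) (auto simp: indicator_def)
    finally show ?thesis by simp
  qed
  ultimately show ?thesis unfolding e by (simp add: algebra_simps)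
qed

text \<open>Real and imaginary part are combinations of \<open>Y\<close> and \<open>cnj Y\<close>.
  Since the hypothesis covers all frequencies, conjugating it at \<open>- u\<close> gives the same
  factorisation for \<open>cnj Y\<close> at \<open>u\<close>.\<close>

lemma integral_indicator_of_char:
  fixes X :: "'a \<Rightarrow> real" and Y :: "'a \<Rightarrow> complex"
  assumes X [measurable]: "random_variable borel X" and Y [measurable]: "random_variable borel Y"
    and YC: "\<And>\<omega>. norm (Y \<omega>) \<le> C"
    and char: "\<And>u. (CLINT \<omega>|M. Y \<omega> * iexp (u * X \<omega>)) = (CLINT \<omega>|M. Y \<omega>) * (CLINT \<omega>|M. iexp (u * X \<omega>))"
    and A [measurable]: "A \<in> sets borel"
  shows "(CLINT \<omega>|M. Y \<omega> * of_real (indicator A (X \<omega>))) = (CLINT \<omega>|M. Y \<omega>) * of_real (prob (X -` A \<inter> space M))"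
proof -
  have intY: "integrable M Y"
    by (rule integrable_const_bound[where B=C]) (use YC in auto)
  have iexp_m [measurable]: "(\<lambda>\<omega>. iexp (u * X \<omega>)) \<in> borel_measurable M" for u
  proof -
    have m1: "(\<lambda>x. iexp (u * x)) \<in> borel_measurable borel"
      by (intro borel_measurable_continuous_onI continuous_intros)
    show ?thesis by (rule measurable_compose[OF X m1])
  qed
  have intYe: "integrable M (\<lambda>\<omega>. Y \<omega> * iexp (u * X \<omega>))" for u
    by (rule integrable_const_bound[where B=C]) (use YC in \<open>auto simp: norm_mult\<close>)
  have cnj_iexp: "cnj (iexp x) = iexp (- x)" for x by (simp add: exp_cnj)
  have [measurable]: "(\<lambda>\<omega>. cnj (Y \<omega>)) \<in> borel_measurable M"
    by (rule measurable_compose[OF Y]) (intro borel_measurable_continuous_onI continuous_intros)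
  have intcY: "integrable M (\<lambda>\<omega>. cnj (Y \<omega>) * iexp (u * X \<omega>))" for u
    by (rule integrable_const_bound[where B=C]) (use YC in \<open>auto simp: norm_mult\<close>)
  have cchar: "(CLINT \<omega>|M. cnj (Y \<omega>) * iexp (u * X \<omega>)) = cnj (CLINT \<omega>|M. Y \<omega>) * (CLINT \<omega>|M. iexp (u * X \<omega>))" for u
  proof -
    have "(CLINT \<omega>|M. cnj (Y \<omega>) * iexp (u * X \<omega>)) = (CLINT \<omega>|M. cnj (Y \<omega> * iexp ((- u) * X \<omega>)))"
      unfolding complex_cnj_mult cnj_iexp by simp
    also have "\<dots> = cnj (CLINT \<omega>|M. Y \<omega> * iexp ((- u) * X \<omega>))" by (rule Bochner_Integration.integral_cnj)
    also have "\<dots> = cnj (CLINT \<omega>|M. Y \<omega>) * cnj (CLINT \<omega>|M. iexp ((- u) * X \<omega>))" unfolding char by simp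
    also have "cnj (CLINT \<omega>|M. iexp ((- u) * X \<omega>)) = (CLINT \<omega>|M. cnj (iexp ((- u) * X \<omega>)))" by (rule Bochner_Integration.integral_cnj[symmetric])
    also have "\<dots> = (CLINT \<omega>|M. iexp (u * X \<omega>))" unfolding cnj_iexp by simp
    finally show ?thesis .
  qed
  have intE: "expectation (\<lambda>\<omega>. Re (Y \<omega>)) = Re (CLINT \<omega>|M. Y \<omega>)" "expectation (\<lambda>\<omega>. Im (Y \<omega>)) = Im (CLINT \<omega>|M. Y \<omega>)"
    using integral_Re[OF intY] integral_Im[OF intY] by auto
  have re: "(\<integral>\<omega>. Re (Y \<omega>) * indicator A (X \<omega>) \<partial>M) = expectation (\<lambda>\<omega>. Re (Y \<omega>)) * prob (X -` A \<inter> space M)"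
  proof (rule integral_indicator_of_char_real[where C=C])
    fix u
    have "(CLINT \<omega>|M. of_real (Re (Y \<omega>)) * iexp (u * X \<omega>)) = (CLINT \<omega>|M. (Y \<omega> * iexp (u * X \<omega>) + cnj (Y \<omega>) * iexp (u * X \<omega>)) / 2)"
      by (intro Bochner_Integration.integral_cong refl) (simp add: complex_add_cnj flip: distrib_right)
    also have "\<dots> = ((CLINT \<omega>|M. Y \<omega>) * (CLINT \<omega>|M. iexp (u * X \<omega>)) + cnj (CLINT \<omega>|M. Y \<omega>) * (CLINT \<omega>|M. iexp (u * X \<omega>))) / 2"
      unfolding integral_divide_zero Bochner_Integration.integral_add[OF intYe intcY] char cchar ..
    also have "\<dots> = of_real (Re (CLINT \<omega>|M. Y \<omega>)) * (CLINT \<omega>|M. iexp (u * X \<omega>))"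
      by (simp add: complex_add_cnj flip: distrib_right)
    finally show "(CLINT \<omega>|M. of_real (Re (Y \<omega>)) * iexp (u * X \<omega>)) = of_real (expectation (\<lambda>\<omega>. Re (Y \<omega>))) * (CLINT \<omega>|M. iexp (u * X \<omega>))"
      unfolding intE .
    show "\<bar>Re (Y \<omega>)\<bar> \<le> C" for \<omega> using abs_Re_le_cmod YC by (rule order_trans)
  qed auto
  have Im_eq: "complex_of_real (Im z) = (z - cnj z) / (2 * \<i>)" for z
    by (simp add: complex_diff_cnj mult.left_commute mult.commute)
  have im: "(\<integral>\<omega>. Im (Y \<omega>) * indicator A (X \<omega>) \<partial>M) = expectation (\<lambda>\<omega>. Im (Y \<omega>)) * prob (X -` A \<inter> space M)"
  proof (rule integral_indicator_of_char_real[where C=C])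
    fix u
    have "(CLINT \<omega>|M. of_real (Im (Y \<omega>)) * iexp (u * X \<omega>)) = (CLINT \<omega>|M. (Y \<omega> * iexp (u * X \<omega>) - cnj (Y \<omega>) * iexp (u * X \<omega>)) / (2 * \<i>))"
      by (simp only: Im_eq left_diff_distrib diff_divide_distrib times_divide_eq_left)
    also have "\<dots> = ((CLINT \<omega>|M. Y \<omega>) * (CLINT \<omega>|M. iexp (u * X \<omega>)) - cnj (CLINT \<omega>|M. Y \<omega>) * (CLINT \<omega>|M. iexp (u * X \<omega>))) / (2 * \<i>)"
      unfolding integral_divide_zero Bochner_Integration.integral_diff[OF intYe intcY] char cchar ..
    also have "\<dots> = of_real (Im (CLINT \<omega>|M. Y \<omega>)) * (CLINT \<omega>|M. iexp (u * X \<omega>))"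
      by (simp only: Im_eq left_diff_distrib diff_divide_distrib times_divide_eq_left)
    finally show "(CLINT \<omega>|M. of_real (Im (Y \<omega>)) * iexp (u * X \<omega>)) = of_real (expectation (\<lambda>\<omega>. Im (Y \<omega>))) * (CLINT \<omega>|M. iexp (u * X \<omega>))"
      unfolding intE .
    show "\<bar>Im (Y \<omega>)\<bar> \<le> C" for \<omega> using abs_Im_le_cmod YC by (rule order_trans)
  qed auto
  have intYA: "integrable M (\<lambda>\<omega>. Y \<omega> * of_real (indicator A (X \<omega>)))"
    by (rule integrable_const_bound[where B=C]) (use YC order_trans[OF norm_ge_zero YC] in \<open>auto simp: indicator_def norm_mult\<close>)
  show ?thesis
  proof (rule complex_eqI)
    show "Re (CLINT \<omega>|M. Y \<omega> * of_real (indicator A (X \<omega>))) = Re ((CLINT \<omega>|M. Y \<omega>) * of_real (prob (X -` A \<inter> space M)))"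
      using re unfolding intE by (simp add: integral_Re[OF intYA, symmetric])
    show "Im (CLINT \<omega>|M. Y \<omega> * of_real (indicator A (X \<omega>))) = Im ((CLINT \<omega>|M. Y \<omega>) * of_real (prob (X -` A \<inter> space M)))"
      using im unfolding intE by (simp add: integral_Im[OF intYA, symmetric])
  qed
qed

text \<open>The exponentials are traded for indicators one variable at a time, with the uniqueness
  theorem applied to the law of that variable weighted by the remaining factors.\<close>

lemma indep_vars_of_char:
  fixes X :: "nat \<Rightarrow> 'a \<Rightarrow> real"
  assumes X: "\<And>i. i < k \<Longrightarrow> random_variable borel (X i)"
    and char: "\<And>\<theta>. (CLINT \<omega>|M. iexp (\<Sum>i<k. \<theta> i * X i \<omega>)) = (\<Prod>i<k. CLINT \<omega>|M. iexp (\<theta> i * X i \<omega>))"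
  shows "indep_vars (\<lambda>_. borel) X {..<k}"
proof (cases "k = 0")
  case True
  then show ?thesis by (simp add: indep_vars_def indep_sets_def)
next
  case False
  have iexp_m: "(\<lambda>\<omega>. iexp (u * X i \<omega>)) \<in> borel_measurable M" if "i < k" for u i
  proof -
    have m1: "(\<lambda>x. iexp (u * x)) \<in> borel_measurable borel"
      by (intro borel_measurable_continuous_onI continuous_intros)
    show ?thesis by (rule measurable_compose[OF X[OF that] m1])
  qed
  \<comment> \<open>Induction on the number \<open>j\<close> of exponentials already replaced by
    indicators. The frequencies stay arbitrary, because the step lets entry \<open>j\<close> run
    through all values.\<close>
  have claim: "(CLINT \<omega>|M. (\<Prod>i<j. of_real (indicator (A i) (X i \<omega>))) * (\<Prod>i\<in>{j..<k}. iexp (\<theta> i * X i \<omega>)))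
      = (\<Prod>i<j. of_real (prob (X i -` A i \<inter> space M))) * (\<Prod>i\<in>{j..<k}. CLINT \<omega>|M. iexp (\<theta> i * X i \<omega>))"
    if "j \<le> k" "\<And>i. A i \<in> sets borel" for j A \<theta>
    using that
  proof (induction j arbitrary: \<theta>)
    case 0
    have "(\<Prod>i\<in>{0..<k}. iexp (\<theta> i * X i \<omega>)) = iexp (\<Sum>i<k. \<theta> i * X i \<omega>)" for \<omega>
      by (simp add: sum_distrib_left exp_sum atLeast0LessThan)
    then show ?case using char[of \<theta>] by (simp add: atLeast0LessThan)
  next
    case (Suc j)
    define Y where "Y \<omega> = (\<Prod>i<j. complex_of_real (indicator (A i) (X i \<omega>))) * (\<Prod>i\<in>{Suc j..<k}. iexp (\<theta> i * X i \<omega>))" for \<omega>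
    define P where "P = (\<Prod>i<j. complex_of_real (prob (X i -` A i \<inter> space M))) * (\<Prod>i\<in>{Suc j..<k}. CLINT \<omega>|M. iexp (\<theta> i * X i \<omega>))"
    have jk: "j < k" using Suc.prems by simp
    have ins: "{j..<k} = insert j {Suc j..<k}" using jk by auto
    have *: "(CLINT \<omega>|M. Y \<omega> * iexp (u * X j \<omega>)) = P * (CLINT \<omega>|M. iexp (u * X j \<omega>))" for u
    proof -
      have "(CLINT \<omega>|M. Y \<omega> * iexp (u * X j \<omega>)) = (CLINT \<omega>|M. (\<Prod>i<j. of_real (indicator (A i) (X i \<omega>))) * (\<Prod>i\<in>{j..<k}. iexp ((\<theta>(j := u)) i * X i \<omega>)))"
        unfolding ins Y_def by (intro Bochner_Integration.integral_cong refl) (simp add: mult_ac)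
      also have "\<dots> = (\<Prod>i<j. of_real (prob (X i -` A i \<inter> space M))) * (\<Prod>i\<in>{j..<k}. CLINT \<omega>|M. iexp ((\<theta>(j := u)) i * X i \<omega>))"
        using Suc.prems by (intro Suc.IH) auto
      also have "\<dots> = P * (CLINT \<omega>|M. iexp (u * X j \<omega>))"
        unfolding ins P_def by (simp add: mult_ac)
      finally show ?thesis .
    qed
    \<comment> \<open>At frequency 0 the exponential in question is 1, which identifies
      \<open>P\<close> as the mean of \<open>Y\<close>.\<close>
    have EY: "(CLINT \<omega>|M. Y \<omega>) = P" using *[of 0] by (simp add: prob_space)
    have "(CLINT \<omega>|M. Y \<omega> * of_real (indicator (A j) (X j \<omega>))) = (CLINT \<omega>|M. Y \<omega>) * of_real (prob (X j -` A j \<inter> space M))"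
    proof (rule integral_indicator_of_char[where C=1])
      have "(\<lambda>\<omega>. complex_of_real (indicator (A i) (X i \<omega>))) \<in> borel_measurable M" if "i < k" for i
        using X[OF that] Suc.prems(2)[of i] by measurable
      then show "random_variable borel Y" unfolding Y_def using jk iexp_m
        by (intro borel_measurable_times borel_measurable_prod) auto
      show "norm (Y \<omega>) \<le> 1" for \<omega>
        unfolding Y_def norm_mult prod_norm[symmetric]
        by (intro mult_le_one prod_le_1 prod_nonneg) (auto simp: indicator_def)
    qed (use X jk Suc.prems * EY in auto)
    then show ?case unfolding EY by (simp add: Y_def P_def mult_ac)
  qed
  show ?thesis
  proof (subst indep_vars_finite[where E="\<lambda>_. sets borel"])
    show "\<forall>A\<in>\<Pi> i\<in>{..<k}. sets borel. prob (\<Inter>j\<in>{..<k}. X j -` A j \<inter> space M) = (\<Prod>j\<in>{..<k}. prob (X j -` A j \<inter> space M))"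
    proof
      fix A :: "nat \<Rightarrow> real set" assume A: "A \<in> (\<Pi> i\<in>{..<k}. sets borel)"
      define A' where "A' i = (if i < k then A i else UNIV)" for i
      have "(CLINT \<omega>|M. (\<Prod>i<k. of_real (indicator (A' i) (X i \<omega>)))) = (\<Prod>i<k. of_real (prob (X i -` A' i \<inter> space M)))"
      proof -
        have "A' i \<in> sets borel" for i using A by (auto simp: A'_def)
        then show ?thesis using claim[of k A' "\<lambda>_. 0"] by simp
      qed
      also have "(CLINT \<omega>|M. (\<Prod>i<k. complex_of_real (indicator (A' i) (X i \<omega>)))) = (CLINT \<omega>|M. of_real (indicator (\<Inter>j\<in>{..<k}. X j -` A j \<inter> space M) \<omega>))"
      proof (intro Bochner_Integration.integral_cong refl)
        fix \<omega> assume "\<omega> \<in> space M"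
        then have "(\<Prod>i<k. indicator (A' i) (X i \<omega>) :: real) = indicator (\<Inter>j\<in>{..<k}. X j -` A j \<inter> space M) \<omega>"
          by (auto simp: A'_def indicator_def prod_zero_iff split: if_splits)
        then show "(\<Prod>i<k. complex_of_real (indicator (A' i) (X i \<omega>))) = of_real (indicator (\<Inter>j\<in>{..<k}. X j -` A j \<inter> space M) \<omega>)"
          by (simp flip: of_real_prod)
      qed
      also have "\<dots> = of_real (prob (\<Inter>j\<in>{..<k}. X j -` A j \<inter> space M))"
      proof -
        have "(\<Inter>j\<in>{..<k}. X j -` A j \<inter> space M) \<subseteq> X 0 -` A 0 \<inter> space M" using False by (intro INT_lower) simp
        then have "(\<Inter>j\<in>{..<k}. X j -` A j \<inter> space M) \<inter> space M = (\<Inter>j\<in>{..<k}. X j -` A j \<inter> space M)" by blast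
        then show ?thesis unfolding integral_complex_of_real Bochner_Integration.integral_indicator by (simp only:)
      qed
      finally have "complex_of_real (prob (\<Inter>j\<in>{..<k}. X j -` A j \<inter> space M)) = of_real (\<Prod>i<k. prob (X i -` A' i \<inter> space M))"
        by simp
      then have "prob (\<Inter>j\<in>{..<k}. X j -` A j \<inter> space M) = (\<Prod>i<k. prob (X i -` A' i \<inter> space M))"
        by (simp only: of_real_eq_iff)
      then show "prob (\<Inter>j\<in>{..<k}. X j -` A j \<inter> space M) = (\<Prod>j\<in>{..<k}. prob (X j -` A j \<inter> space M))"
        unfolding A'_def by (simp only:) (rule prod.cong, auto)
    qed
    show "\<And>i. i \<in> {..<k} \<Longrightarrow> Int_stable (sets borel)" by (auto simp: Int_stable_def)
    show "\<And>i. i \<in> {..<k} \<Longrightarrow> random_variable borel (X i)" using X by simp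
    show "\<And>i. i \<in> {..<k} \<Longrightarrow> sets borel \<subseteq> Pow (space borel)" by simp
    show "\<And>i. i \<in> {..<k} \<Longrightarrow> sets borel = sigma_sets (space borel) (sets borel)"
      using sets.sigma_sets_eq[of borel] by auto
  qed (use False in auto)
qed

end

section \<open>Brownian motion from a Gaussian bridge\<close>

lemma sum_lessThan_add:
  fixes f :: "nat \<Rightarrow> 'b :: comm_monoid_add"
  shows "(\<Sum>i<m + n. f i) = (\<Sum>i<m. f i) + (\<Sum>i<n. f (m + i))"
  by (induction n) (auto simp: add_ac)

lemma gaussian_process_increments:
  fixes k :: nat
  assumes W: "gaussian_process T K W" and a: "\<And>i. i < k \<Longrightarrow> a i \<in> T" and b: "\<And>i. i < k \<Longrightarrow> b i \<in> T"
  shows "(CLINT \<omega>|Gauss. iexp (\<Sum>i<k. \<theta> i * (W (b i) \<omega> - W (a i) \<omega>)))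
    = of_real (exp (- (\<Sum>i<k. \<Sum>j<k. \<theta> i * \<theta> j * (K (b i) (b j) - K (b i) (a j) - K (a i) (b j) + K (a i) (a j))) / 2))"
proof -
  \<comment> \<open>The \<open>k\<close> increments are read as a linear combination of
    \<open>2 * k\<close> values: right ends with weight \<open>\<theta>\<close>, left ends with
    weight \<open>- \<theta>\<close>.\<close>
  define ts where "ts j = (if j < k then b j else a (j - k))" for j
  define cs where "cs j = (if j < k then \<theta> j else - \<theta> (j - k))" for j
  have "(CLINT \<omega>|Gauss. iexp (\<Sum>i<k + k. cs i * W (ts i) \<omega>))
     = of_real (exp (- (\<Sum>i<k + k. \<Sum>j<k + k. cs i * cs j * K (ts i) (ts j)) / 2))"
    by (rule gaussian_process_iexp[OF W]) (use a b in \<open>auto simp: ts_def\<close>)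
  moreover have "(\<Sum>i<k + k. cs i * W (ts i) \<omega>) = (\<Sum>i<k. \<theta> i * (W (b i) \<omega> - W (a i) \<omega>))" for \<omega>
    by (simp add: sum_lessThan_add cs_def ts_def right_diff_distrib sum_subtractf sum_negf)
  moreover have "(\<Sum>i<k + k. \<Sum>j<k + k. cs i * cs j * K (ts i) (ts j))
     = (\<Sum>i<k. \<Sum>j<k. \<theta> i * \<theta> j * (K (b i) (b j) - K (b i) (a j) - K (a i) (b j) + K (a i) (a j)))"
    by (simp add: sum_lessThan_add cs_def ts_def sum.distrib sum_subtractf sum_negf algebra_simps)
  ultimately show ?thesis by simp
qed

text \<open>Law and independence of the increments are read off the characteristic functions: the
  second difference of \<open>min\<close> vanishes for non-overlapping intervals and is the length
  for a single one.\<close>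

lemma brownian_motion_of_gaussian_process:
  assumes W: "gaussian_process {0..} min W" and W0: "\<And>\<omega>. W 0 \<omega> = 0"
    and cont: "\<And>\<omega>. continuous_on {0..} (\<lambda>t. W t \<omega>)"
  shows "brownian_motion Gauss W"
  unfolding brownian_motion_def
proof (intro conjI allI impI ballI)
  have Wm: "W t \<in> borel_measurable Gauss" if "0 \<le> t" for t
    using W that unfolding gaussian_process_def by simp
  fix t :: real assume "0 \<le> t"
  then show "W t \<in> borel_measurable Gauss" by (rule Wm)
next
  fix \<omega> show "W 0 \<omega> = 0" by (rule W0)
next
  fix \<omega> show "continuous_on {0..} (\<lambda>t. W t \<omega>)" by (rule cont)
next
  fix s t :: real assume st: "0 \<le> s \<and> s < t"
  have Wm: "W t \<in> borel_measurable Gauss" if "0 \<le> t" for t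
    using W that unfolding gaussian_process_def by simp
  define \<sigma> where "\<sigma> = sqrt (t - s)"
  have \<sigma>: "\<sigma> > 0" "\<sigma>\<^sup>2 = t - s" using st by (auto simp: \<sigma>_def)
  \<comment> \<open>Normalised, so that the uniqueness theorem is applied to the standard normal
    law.\<close>
  define Z where "Z \<omega> = (W t \<omega> - W s \<omega> - 0) / \<sigma>" for \<omega>
  have Zm [measurable]: "Z \<in> borel_measurable Gauss"
    unfolding Z_def using Wm[of t] Wm[of s] st by (intro borel_measurable_divide borel_measurable_diff) auto
  have "char (distr Gauss borel Z) = char std_normal"
  proof
    fix u
    have m1: "(\<lambda>x. iexp (u * x)) \<in> borel_measurable borel"
      by (intro borel_measurable_continuous_onI continuous_intros)
    have "char (distr Gauss borel Z) u = (CLINT \<omega>|Gauss. iexp (u * Z \<omega>))"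
      unfolding char_def by (rule integral_distr[OF Zm m1])
    also have "\<dots> = (CLINT \<omega>|Gauss. iexp (\<Sum>i<Suc 0. (\<lambda>_. u / \<sigma>) i * (W ((\<lambda>_. t) i) \<omega> - W ((\<lambda>_. s) i) \<omega>)))"
      by (simp add: Z_def)
    also have "\<dots> = of_real (exp (- ((u / \<sigma>)\<^sup>2 * (t - s)) / 2))"
      using st by (subst gaussian_process_increments[OF W]) (auto simp: power2_eq_square algebra_simps)
    also have "(u / \<sigma>)\<^sup>2 * (t - s) = u\<^sup>2" using \<sigma> by (simp add: power_divide flip: \<sigma>(2))
    also have "of_real (exp (- u\<^sup>2 / 2)) = char std_normal u"
      by (simp add: char_std_normal_distribution)
    finally show "char (distr Gauss borel Z) u = char std_normal u" .
  qed
  then have "distr Gauss borel Z = std_normal"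
    by (intro Levy_uniqueness Gauss.real_distribution_distr real_dist_normal_dist Zm)
  moreover have "distr Gauss lborel Z = distr Gauss borel Z"
    by (rule distr_cong) auto
  ultimately have "distributed Gauss lborel Z std_normal_density"
    unfolding distributed_def by simp
  then show "distributed Gauss lborel (\<lambda>\<omega>. W t \<omega> - W s \<omega>) (normal_density 0 (sqrt (t - s)))"
    unfolding \<sigma>_def[symmetric] Gauss.normal_standard_normal_convert[OF \<sigma>(1), of "\<lambda>\<omega>. W t \<omega> - W s \<omega>" 0] Z_def .
next
  fix k :: nat and ts :: "nat \<Rightarrow> real" assume ts: "0 \<le> ts 0 \<and> strict_mono ts"
  have mono: "ts i \<le> ts j" if "i \<le> j" for i j using ts that by (simp add: strict_mono_less_eq)
  have pos: "0 \<le> ts i" for i using mono[of 0 i] ts by simp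
  have Wm: "W t \<in> borel_measurable Gauss" if "0 \<le> t" for t
    using W that unfolding gaussian_process_def by simp
  define X where "X i \<omega> = W (ts (Suc i)) \<omega> - W (ts i) \<omega>" for i \<omega>
  have ker: "min (ts (Suc i)) (ts (Suc j)) - min (ts (Suc i)) (ts j) - min (ts i) (ts (Suc j)) + min (ts i) (ts j)
     = (if i = j then ts (Suc i) - ts i else 0)" for i j
  proof (cases i j rule: linorder_cases)
    case less
    then show ?thesis using mono[of "Suc i" j] mono[of i "Suc i"] mono[of j "Suc j"] by (simp add: min_def)
  next
    case equal
    then show ?thesis using mono[of i "Suc i"] by (simp add: min_def)
  next
    case greater
    then show ?thesis using mono[of "Suc j" i] mono[of i "Suc i"] mono[of j "Suc j"] by (simp add: min_def)
  qed
  \<comment> \<open>With an injection \<open>g\<close> the same formula serves the joint law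
    (\<open>g = id\<close>) and each single increment (\<open>l = 1\<close>, \<open>g\<close> a
    translation).\<close>
  have cf: "(CLINT \<omega>|Gauss. iexp (\<Sum>i<l. \<theta> i * (W (ts (Suc (g i))) \<omega> - W (ts (g i)) \<omega>)))
     = of_real (exp (- (\<Sum>i<l. (\<theta> i)\<^sup>2 * (ts (Suc (g i)) - ts (g i))) / 2))" if "inj g" for l :: nat and \<theta> and g :: "nat \<Rightarrow> nat"
  proof -
    have "(\<Sum>i<l. \<Sum>j<l. \<theta> i * \<theta> j * (min (ts (Suc (g i))) (ts (Suc (g j))) - min (ts (Suc (g i))) (ts (g j)) - min (ts (g i)) (ts (Suc (g j))) + min (ts (g i)) (ts (g j))))
      = (\<Sum>i<l. \<Sum>j<l. if i = j then (\<theta> i)\<^sup>2 * (ts (Suc (g i)) - ts (g i)) else 0)"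
      unfolding ker using that by (intro sum.cong refl) (auto simp: power2_eq_square inj_eq)
    also have "\<dots> = (\<Sum>i<l. (\<theta> i)\<^sup>2 * (ts (Suc (g i)) - ts (g i)))" by simp
    finally show ?thesis using pos by (subst gaussian_process_increments[OF W]) auto
  qed
  have "Gauss.indep_vars (\<lambda>_. borel) X {..<k}"
  proof (rule Gauss.indep_vars_of_char)
    show "X i \<in> borel_measurable Gauss" for i unfolding X_def by (intro borel_measurable_diff Wm pos)
    fix \<theta> :: "nat \<Rightarrow> real"
    have "(CLINT \<omega>|Gauss. iexp (\<Sum>i<k. \<theta> i * X i \<omega>)) = of_real (exp (- (\<Sum>i<k. (\<theta> i)\<^sup>2 * (ts (Suc i) - ts i)) / 2))"
      unfolding X_def using cf[where g=id and l=k and \<theta>=\<theta>] by simp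
    also have "\<dots> = (\<Prod>i<k. of_real (exp (- ((\<theta> i)\<^sup>2 * (ts (Suc i) - ts i)) / 2)))"
      by (simp add: sum_negf[symmetric] sum_divide_distrib exp_sum)
    also have "\<dots> = (\<Prod>i<k. CLINT \<omega>|Gauss. iexp (\<theta> i * X i \<omega>))"
    proof (intro prod.cong refl)
      fix i
      show "of_real (exp (- ((\<theta> i)\<^sup>2 * (ts (Suc i) - ts i)) / 2)) = (CLINT \<omega>|Gauss. iexp (\<theta> i * X i \<omega>))"
        using cf[where g="\<lambda>j. i + j" and l="Suc 0" and \<theta>="\<lambda>_. \<theta> i"] by (simp add: X_def inj_def)
    qed
    finally show "(CLINT \<omega>|Gauss. iexp (\<Sum>i<k. \<theta> i * X i \<omega>)) = (\<Prod>i<k. CLINT \<omega>|Gauss. iexp (\<theta> i * X i \<omega>))" .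
  qed
  then show "Gauss.indep_vars (\<lambda>_. borel) (\<lambda>i \<omega>. W (ts (Suc i)) \<omega> - W (ts i) \<omega>) {..<k}"
    unfolding X_def[abs_def] .
qed

text \<open>After time 1 the Brownian motion is continued by \<open>s \<mapsto> (1 + s) B'(s / (1 + s))\<close>, a Brownian
  motion obtained from an independent bridge \<open>B'\<close>.\<close>

lemma brownian_bridge_of_gaussian_bridge:
  assumes B: "gaussian_bridge B"
  shows "brownian_bridge Gauss (\<lambda>t \<omega>. B t (odds \<omega>))"
proof -
  \<comment> \<open>The value at time 1 is coordinate 0, so subtracting \<open>t * W 1\<close>
    leaves exactly the bridge on the odd coordinates. For \<open>t > 1\<close> put
    \<open>s = t - 1\<close>: then \<open>t = 1 + s\<close> and
    \<open>(t - 1) / t = s / (1 + s)\<close>. The default times and coefficients bring the formula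
    into the shape of \<open>gaussian_process_split\<close>.\<close>
  define W where "W t \<omega> = (if t \<le> 1 then t else 1) * \<omega> 0 + (if t \<le> 1 then 1 else 0) * B (if t \<le> 1 then t else 0) (odds \<omega>)
     + (if t \<le> 1 then 0 else t) * B (if t \<le> 1 then 0 else (t - 1) / t) (evens \<omega>)" for t and \<omega> :: "nat \<Rightarrow> real"
  have gp: "gaussian_process {0..1} bridge_kernel B" and cont: "\<And>\<omega>. continuous_on {0..1} (\<lambda>t. B t \<omega>)"
    and ends: "\<And>\<omega>. B 0 \<omega> = 0" "\<And>\<omega>. B 1 \<omega> = 0"
    using B by (auto simp: gaussian_bridge_def)
  have "gaussian_process {0..} min W"
  proof (rule gaussian_process_split[OF gp gp, where \<rho>="\<lambda>t. if t \<le> 1 then t else 1"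
      and cl="\<lambda>t. if t \<le> 1 then 1 else 0" and \<tau>l="\<lambda>t. if t \<le> 1 then t else 0"
      and cr="\<lambda>t. if t \<le> 1 then 0 else t" and \<tau>r="\<lambda>t. if t \<le> 1 then 0 else (t - 1) / t"])
    fix s t :: real assume "s \<in> {0..}" "t \<in> {0..}"
    have far: "min s t = 1 + s * t * (min ((s - 1) / s) ((t - 1) / t) - (s - 1) / s * ((t - 1) / t))"
      if "1 < s" "1 < t" for s t :: real
    proof -
      have *: "s = 1 + s * t * ((s - 1) / s - (s - 1) / s * ((t - 1) / t))" if "1 < s" "1 < t" for s t :: real
        using that by (simp add: field_simps)
      have "min ((s - 1) / s) ((t - 1) / t) = (if s \<le> t then (s - 1) / s else (t - 1) / t)"
      proof -
        have "(s - 1) / s \<le> (t - 1) / t \<longleftrightarrow> s \<le> t" using that by (simp add: field_simps)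
        then show ?thesis by (simp add: min_def)
      qed
      then show ?thesis using *[OF that] *[OF that(2,1)] by (auto simp: min_def mult_ac)
    qed
    show "min s t = (if s \<le> 1 then s else 1) * (if t \<le> 1 then t else 1)
      + (if s \<le> 1 then 1 else 0) * (if t \<le> 1 then 1 else 0) * bridge_kernel (if s \<le> 1 then s else 0) (if t \<le> 1 then t else 0)
      + (if s \<le> 1 then 0 else s) * (if t \<le> 1 then 0 else t) * bridge_kernel (if s \<le> 1 then 0 else (s - 1) / s) (if t \<le> 1 then 0 else (t - 1) / t)"
    proof (cases "s \<le> 1 \<or> t \<le> 1")
      case True
      then show ?thesis by (auto simp: bridge_kernel_def)
    next
      case False
      then show ?thesis using far[of s t] by (simp add: bridge_kernel_def)
    qed
  qed (auto simp: W_def divide_le_eq)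
  moreover have "W 0 \<omega> = 0" for \<omega> by (simp add: W_def ends)
  moreover have "continuous_on {0..} (\<lambda>t. W t \<omega>)" for \<omega>
  proof -
    have c1: "continuous_on {0..1} (\<lambda>t. t * \<omega> 0 + B t (odds \<omega>))"
      by (intro continuous_intros cont)
    have "continuous_on {1..} (\<lambda>t. B ((t - 1) / t) (evens \<omega>))"
      by (rule continuous_on_compose2[OF cont]) (auto intro!: continuous_intros simp: divide_le_eq)
    then have c2: "continuous_on {1..} (\<lambda>t. \<omega> 0 + t * B ((t - 1) / t) (evens \<omega>))"
      by (intro continuous_intros)
    have "continuous_on ({0..1} \<union> {1..}) (\<lambda>t. if t \<le> 1 then t * \<omega> 0 + B t (odds \<omega>) else \<omega> 0 + t * B ((t - 1) / t) (evens \<omega>))"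
    proof (rule continuous_on_cases[OF _ _ c1 c2])
      show "\<forall>t. (t \<in> {0..1} \<and> \<not> t \<le> 1) \<or> (t \<in> {1..} \<and> t \<le> 1) \<longrightarrow>
        t * \<omega> 0 + B t (odds \<omega>) = \<omega> 0 + t * B ((t - 1) / t) (evens \<omega>)"
      proof (intro allI impI)
        fix t :: real assume "(t \<in> {0..1} \<and> \<not> t \<le> 1) \<or> (t \<in> {1..} \<and> t \<le> 1)"
        then have "t = 1" by auto
        then show "t * \<omega> 0 + B t (odds \<omega>) = \<omega> 0 + t * B ((t - 1) / t) (evens \<omega>)" by (simp add: ends)
      qed
    qed auto
    moreover have "{0..1} \<union> {1..} = {0::real..}" by auto
    moreover have "(\<lambda>t. W t \<omega>) = (\<lambda>t. if t \<le> 1 then t * \<omega> 0 + B t (odds \<omega>) else \<omega> 0 + t * B ((t - 1) / t) (evens \<omega>))"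
      by (auto simp: W_def fun_eq_iff)
    ultimately show ?thesis by (simp only:)
  qed
  ultimately have "brownian_motion Gauss W" by (rule brownian_motion_of_gaussian_process)
  then show ?thesis
    unfolding brownian_bridge_def by (intro exI[of _ W]) (auto simp: W_def ends)
qed

section \<open>Recursive coupling\<close>

text \<open>\<open>R\<close> is a measurable majorant of the discrepancy; it spares the measurability of the supremum
  during the recursion.\<close>

definition coupling_at :: "real \<Rightarrow> nat \<Rightarrow> real \<Rightarrow> (real \<Rightarrow> (nat \<Rightarrow> real) \<Rightarrow> real) \<Rightarrow> int
    \<Rightarrow> ((nat \<Rightarrow> real) \<Rightarrow> nat \<Rightarrow> int) \<Rightarrow> ((nat \<Rightarrow> real) \<Rightarrow> real) \<Rightarrow> bool" where
  "coupling_at a n G B z S R \<longleftrightarrow>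
     S \<in> measurable Gauss (count_space UNIV) \<and> (\<forall>\<omega>. S \<omega> \<in> set_pmf (srw_cond_pmf n z)) \<and>
     distr Gauss (count_space UNIV) S = measure_pmf (srw_cond_pmf n z) \<and>
     R \<in> borel_measurable Gauss \<and>
     (\<forall>\<omega>. \<forall>t\<in>{0..real n}. \<bar>sqrt (real n) * B (t / real n) \<omega> + t / real n * real_of_int z - interp (S \<omega>) t\<bar> \<le> R \<omega>) \<and>
     (\<integral>\<^sup>+\<omega>. ennreal (exp (a * R \<omega>)) \<partial>Gauss) \<le> ennreal (G * exp ((of_int z)\<^sup>2 / (16 * real n)))"

text \<open>The order of the quantifiers carries the uniformity: a single bridge drives the walks of
  all endpoints.\<close>

definition coupled :: "real \<Rightarrow> nat \<Rightarrow> real \<Rightarrow> bool" where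
  "coupled a n G \<longleftrightarrow> (\<exists>B S R. gaussian_bridge B \<and> (\<forall>z\<in>L n. coupling_at a n G B z (S z) (R z)))"

lemma coupling_atD:
  assumes "coupling_at a n G B z S R"
  shows "S \<in> measurable Gauss (count_space UNIV)" "S \<omega> \<in> set_pmf (srw_cond_pmf n z)"
    "distr Gauss (count_space UNIV) S = measure_pmf (srw_cond_pmf n z)"
    "R \<in> borel_measurable Gauss"
    "t \<in> {0..real n} \<Longrightarrow> \<bar>sqrt (real n) * B (t / real n) \<omega> + t / real n * real_of_int z - interp (S \<omega>) t\<bar> \<le> R \<omega>"
    "(\<integral>\<^sup>+\<omega>. ennreal (exp (a * R \<omega>)) \<partial>Gauss) \<le> ennreal (G * exp ((of_int z)\<^sup>2 / (16 * real n)))"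
  using assms unfolding coupling_at_def by simp_all

lemma coupling_at_mono:
  assumes "coupling_at a n G B z S R" "G \<le> G'"
  shows "coupling_at a n G' B z S R"
proof -
  have "ennreal (G * exp ((of_int z)\<^sup>2 / (16 * real n))) \<le> ennreal (G' * exp ((of_int z)\<^sup>2 / (16 * real n)))"
    using assms(2) by (intro ennreal_leI mult_right_mono) auto
  note order_trans[OF coupling_atD(6)[OF assms(1)] this]
  then show ?thesis using assms(1) unfolding coupling_at_def by simp
qed

lemma coupled_mono: "coupled a n G \<Longrightarrow> G \<le> G' \<Longrightarrow> coupled a n G'"
  unfolding coupled_def using coupling_at_mono by blast

text \<open>With one step the walk is determined by its endpoint and its interpolation is the
  straight line, so the discrepancy is the bridge itself. This is where the exponential moment of
  the supremum enters.\<close>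

lemma coupled_1:
  assumes B: "gaussian_bridge B" "R \<in> borel_measurable Gauss" "\<And>\<omega> t. t \<in> {0..1} \<Longrightarrow> \<bar>B t \<omega>\<bar> \<le> R \<omega>"
      "\<And>\<omega>. 0 \<le> R \<omega>"
    and mom: "(\<integral>\<^sup>+\<omega>. ennreal (exp (a' * R \<omega>)) \<partial>Gauss) \<le> ennreal G" and G: "0 \<le> G" and a: "a \<le> a'"
  shows "coupled a 1 G"
proof -
  define S where "S z = (\<lambda>\<omega>::nat \<Rightarrow> real. \<lambda>k::nat. if k = 0 then 0 else z)" for z :: int
  show ?thesis
    unfolding coupled_def coupling_at_def
  proof (intro exI[of _ B] exI[of _ S] exI[of _ "\<lambda>_. R"] conjI ballI allI)
    fix z :: int assume z: "z \<in> L 1"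
    define path where "path = (\<lambda>k::nat. if k = 0 then 0 else z)"
    have S: "S z = (\<lambda>\<omega>. path)" by (simp add: S_def path_def)
    have "P = path" if "P \<in> set_pmf (srw_cond_pmf 1 z)" for P
    proof
      fix k :: nat
      have P: "P \<in> set_pmf (srw_pmf 1)" "P 1 = z" using that unfolding set_srw_cond_pmf[OF z] by auto
      show "P k = path k"
        using srw_pmf_0[OF P(1)] srw_pmf_const[OF P(1), of k] P(2) by (cases "k = 0") (auto simp: path_def)
    qed
    then have ret: "srw_cond_pmf 1 z = return_pmf path"
      by (intro set_pmf_subset_singleton[THEN iffD1]) auto
    show "S z \<in> measurable Gauss (count_space UNIV)" unfolding S by simp
    show "S z \<omega> \<in> set_pmf (srw_cond_pmf 1 z)" for \<omega> unfolding S ret by simp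
    show "distr Gauss (count_space UNIV) (S z) = measure_pmf (srw_cond_pmf 1 z)"
      unfolding S ret by (simp add: Gauss.distr_const return_pmf.rep_eq)
    show "\<bar>sqrt (real 1) * B (t / real 1) \<omega> + t / real 1 * real_of_int z - interp (S z \<omega>) t\<bar> \<le> R \<omega>"
      if "t \<in> {0..real 1}" for \<omega> t
    proof -
      have "interp path t = t * z"
      proof (cases "t = 1")
        case True
        then show ?thesis by (simp add: interp_def path_def)
      next
        case False
        then have "\<lfloor>t\<rfloor> = 0" using that by (intro floor_unique) auto
        then show ?thesis by (simp add: interp_def path_def frac_def)
      qed
      then show ?thesis using B(3)[of t \<omega>] that by (simp add: S)
    qed
    have "(\<integral>\<^sup>+\<omega>. ennreal (exp (a * R \<omega>)) \<partial>Gauss) \<le> (\<integral>\<^sup>+\<omega>. ennreal (exp (a' * R \<omega>)) \<partial>Gauss)"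
      using a B(4) by (intro nn_integral_mono ennreal_leI) (simp add: mult_right_mono)
    also have "\<dots> \<le> ennreal (G * 1)" using mom by simp
    also have "\<dots> \<le> ennreal (G * exp ((of_int z)\<^sup>2 / (16 * real 1)))"
      using G by (intro ennreal_leI mult_left_mono) auto
    finally show "(\<integral>\<^sup>+\<omega>. ennreal (exp (a * R \<omega>)) \<partial>Gauss) \<le> ennreal (G * exp ((of_int z)\<^sup>2 / (16 * real 1)))" .
  qed (use B in auto)
qed

section \<open>Gluing two couplings at the cut\<close>

lemma measurable_count_space_subset:
  assumes "f \<in> measurable M (count_space UNIV)" "\<And>x. x \<in> space M \<Longrightarrow> f x \<in> I"
  shows "f \<in> measurable M (count_space I)"
  using assms unfolding measurable_def by auto

lemma interp_glue_left:
  assumes v: "v 0 = 0" and t: "0 \<le> t" "t \<le> real m"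
  shows "interp (glue m u v) t = interp u t"
proof (cases "t = real m")
  case True
  then show ?thesis using v by (simp add: interp_def glue_def)
next
  case False
  then have "nat \<lfloor>t\<rfloor> < m" using t by linarith
  then show ?thesis using v by (simp add: interp_def glue_def)
qed

lemma interp_glue_right:
  assumes u: "\<And>j. m \<le> j \<Longrightarrow> u j = u m" and t: "real m \<le> t"
  shows "interp (glue m u v) t = of_int (u m) + interp v (t - real m)"
proof -
  have fl: "\<lfloor>t - real m\<rfloor> = \<lfloor>t\<rfloor> - int m" using floor_diff_of_int[of t "int m"] by simp
  have f: "frac (t - real m) = frac t" by (simp add: frac_def fl)
  have n: "nat \<lfloor>t - real m\<rfloor> = nat \<lfloor>t\<rfloor> - m" unfolding fl using t by (simp add: nat_diff_distrib')
  have le: "m \<le> nat \<lfloor>t\<rfloor>" using t by (simp add: le_nat_floor)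
  then have "Suc (nat \<lfloor>t\<rfloor>) - m = Suc (nat \<lfloor>t\<rfloor> - m)" by simp
  then show ?thesis
    unfolding interp_def glue_def f n using u[OF le] u[of "Suc (nat \<lfloor>t\<rfloor>)"] le
    by (simp add: algebra_simps)
qed

text \<open>At the cut the two sides differ by \<open>x - m / n * z - sqrt (m * k / n) * g\<close>;
  away from it this difference enters with a linear weight of at most 1. At each time only one of
  the parts is active, which gives the maximum of \<open>R1\<close> and \<open>R2\<close> instead of
  their sum.\<close>

lemma glue_error:
  fixes z x :: int and B1 B2 :: "real \<Rightarrow> real" and R1 R2 :: real
  assumes m: "m \<ge> 1" and k: "k \<ge> 1" and n: "n = m + k"
    and u: "\<And>j. m \<le> j \<Longrightarrow> u j = x" and v: "v 0 = 0"
    and 1: "\<And>t. t \<in> {0..real m} \<Longrightarrow> \<bar>sqrt (real m) * B1 (t / real m) + t / real m * x - interp u t\<bar> \<le> R1"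
    and 2: "\<And>t. t \<in> {0..real k} \<Longrightarrow> \<bar>sqrt (real k) * B2 (t / real k) + t / real k * (z - x) - interp v t\<bar> \<le> R2"
    and t: "t \<in> {0..real n}"
  shows "\<bar>sqrt (real n) * bridge_concat (real m / real n) g B1 B2 (t / real n) + t / real n * z - interp (glue m u v) t\<bar>
    \<le> \<bar>x - real m / real n * z - sqrt (real m * real k / real n) * g\<bar> + max R1 R2"
proof -
  define N where "N = real n"
  have N: "N > 0" "N = real m + real k" using m n by (auto simp: N_def)
  have m0: "real m > 0" and k0: "real k > 0" using m k by auto
  define p where "p = real m / N"
  have p: "1 - p = real k / N" using N m0 k0 by (simp add: p_def field_simps)
  define E where "E = x - p * z - sqrt (real m * real k / N) * g"
  have s0: "sqrt N * sqrt (p * (1 - p)) = sqrt (real m * real k / N)"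
    unfolding p unfolding p_def using N(1) by (simp flip: real_sqrt_mult)
  have s1: "sqrt N * sqrt p = sqrt (real m)" unfolding p_def using N(1) by (simp flip: real_sqrt_mult)
  have s2: "sqrt N * sqrt (1 - p) = sqrt (real k)" unfolding p using N(1) by (simp flip: real_sqrt_mult)
  show ?thesis
  proof (cases "t \<le> real m")
    case True
    then have tp: "t / N \<le> p" unfolding p_def using N(1) by (simp add: divide_right_mono)
    have lt: "t / N / p = t / real m" unfolding p_def using N(1) by simp
    have "bridge_concat p g B1 B2 (t / N) = t / real m * sqrt (p * (1 - p)) * g + sqrt p * B1 (t / real m)"
    proof -
      have "left_time p (t / N) = t / real m" "mid_coeff p (t / N) = t / real m * sqrt (p * (1 - p))"
        "left_coeff p (t / N) = sqrt p" "right_coeff p (t / N) = 0"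
        unfolding concat_defs using tp lt by (simp_all only: if_True)
      then show ?thesis by (simp add: bridge_concat_def)
    qed
    then have "sqrt N * bridge_concat p g B1 B2 (t / N) = t / real m * (sqrt N * sqrt (p * (1 - p))) * g + (sqrt N * sqrt p) * B1 (t / real m)"
      by (simp add: algebra_simps)
    then have "sqrt N * bridge_concat p g B1 B2 (t / N) = t / real m * sqrt (real m * real k / N) * g + sqrt (real m) * B1 (t / real m)"
      unfolding s0 s1 .
    moreover have "t / N = t / real m * p" unfolding p_def using m0 by simp
    ultimately have "sqrt N * bridge_concat p g B1 B2 (t / N) + t / N * z - interp (glue m u v) t
      = (sqrt (real m) * B1 (t / real m) + t / real m * x - interp u t) - t / real m * E"
      using interp_glue_left[of v t m u] v t True unfolding E_def by (simp add: algebra_simps)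
    also have "\<bar>\<dots>\<bar> \<le> \<bar>sqrt (real m) * B1 (t / real m) + t / real m * x - interp u t\<bar> + \<bar>t / real m * E\<bar>"
      by (rule abs_triangle_ineq4)
    also have "\<dots> \<le> R1 + 1 * \<bar>E\<bar>"
      unfolding abs_mult using t True m0 by (intro add_mono 1 mult_right_mono) auto
    also have "R1 + 1 * \<bar>E\<bar> \<le> \<bar>E\<bar> + max R1 R2" by simp
    finally show ?thesis unfolding E_def p_def N_def .
  next
    case False
    then have tp: "\<not> t / N \<le> p" unfolding p_def using N(1) by (simp add: divide_le_cancel)
    have rt: "(t / N - p) / (1 - p) = (t - real m) / real k"
      unfolding p unfolding p_def using N(1) k0 by (simp add: field_simps)
    have rc: "(1 - t / N) / (1 - p) = (N - t) / real k"
      unfolding p using N(1) k0 by (simp add: field_simps)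
    have "bridge_concat p g B1 B2 (t / N) = (N - t) / real k * sqrt (p * (1 - p)) * g + sqrt (1 - p) * B2 ((t - real m) / real k)"
    proof -
      have "right_time p (t / N) = (t - real m) / real k" "mid_coeff p (t / N) = (N - t) / real k * sqrt (p * (1 - p))"
        "left_coeff p (t / N) = 0" "right_coeff p (t / N) = sqrt (1 - p)"
        unfolding concat_defs using tp rt rc by (simp_all only: if_False)
      then show ?thesis by (simp add: bridge_concat_def)
    qed
    then have "sqrt N * bridge_concat p g B1 B2 (t / N) = (N - t) / real k * (sqrt N * sqrt (p * (1 - p))) * g + (sqrt N * sqrt (1 - p)) * B2 ((t - real m) / real k)"
      by (simp add: algebra_simps)
    then have a: "sqrt N * bridge_concat p g B1 B2 (t / N) = (N - t) / real k * sqrt (real m * real k / N) * g + sqrt (real k) * B2 ((t - real m) / real k)"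
      unfolding s0 s2 .
    \<comment> \<open>The line to \<open>z\<close> exceeds the broken line through \<open>x\<close>
      by a tent, which is \<open>p * z - x\<close> at the cut and 0 at the end.\<close>
    have b: "t / N * z = (t - real m) / real k * (z - x) + x + (N - t) / real k * (p * z - x)"
    proof -
      have k': "real k = N - real m" using N by simp
      have "N - real m \<noteq> 0" using k0 N by simp
      then show ?thesis unfolding p_def k' using N(1) by (simp add: divide_simps) (simp add: algebra_simps)
    qed
    have "interp (glue m u v) t = x + interp v (t - real m)"
      using interp_glue_right[of m u t v] u False by simp
    then have "sqrt N * bridge_concat p g B1 B2 (t / N) + t / N * z - interp (glue m u v) t
      = (sqrt (real k) * B2 ((t - real m) / real k) + (t - real m) / real k * (z - x) - interp v (t - real m)) - (N - t) / real k * E"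
      unfolding a b E_def by (simp add: algebra_simps)
    also have "\<bar>\<dots>\<bar> \<le> \<bar>sqrt (real k) * B2 ((t - real m) / real k) + (t - real m) / real k * (z - x) - interp v (t - real m)\<bar> + \<bar>(N - t) / real k * E\<bar>"
      by (rule abs_triangle_ineq4)
    also have "\<dots> \<le> R2 + 1 * \<bar>E\<bar>"
      unfolding abs_mult using t False k0 N n by (intro add_mono 2 mult_right_mono) (auto simp: N_def)
    also have "R2 + 1 * \<bar>E\<bar> \<le> \<bar>E\<bar> + max R1 R2" by simp
    finally show ?thesis unfolding E_def p_def N_def .
  qed
qed

text \<open>Settles everything except the quality of the cut: given the Gaussian \<open>g\<close> at
  the cut, the parts are independent of it and the inductive moment bounds may be inserted, so that
  only the one-dimensional Gaussian integral \<open>mom\<close> remains to be estimated.\<close>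

lemma coupled_add:
  assumes m: "m \<ge> 1" and k: "k \<ge> 1" and a: "0 \<le> a" and G: "0 \<le> G1" "0 \<le> G2"
    and C1: "coupled a m G1" and C2: "coupled a k G2"
    and mom: "\<And>z q. z \<in> L (m + k) \<Longrightarrow> monotone_coupling (mid_law m k z) q \<Longrightarrow>
      (\<integral>\<^sup>+g. ennreal (exp (a * \<bar>of_int (q g) - real m / real (m + k) * of_int z - sqrt (real m * real k / real (m + k)) * g\<bar>)
         * (G1 * exp ((of_int (q g))\<^sup>2 / (16 * real m)) + G2 * exp ((of_int (z - q g))\<^sup>2 / (16 * real k)))) \<partial>std_normal)
      \<le> ennreal (G * exp ((of_int z)\<^sup>2 / (16 * real (m + k))))"
  shows "coupled a (m + k) G"
proof -
  obtain B1 S1 R1 where B1: "gaussian_bridge B1" and H1: "\<And>z. z \<in> L m \<Longrightarrow> coupling_at a m G1 B1 z (S1 z) (R1 z)"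
    using C1 unfolding coupled_def by blast
  obtain B2 S2 R2 where B2: "gaussian_bridge B2" and H2: "\<And>z. z \<in> L k \<Longrightarrow> coupling_at a k G2 B2 z (S2 z) (R2 z)"
    using C2 unfolding coupled_def by blast
  note S1 = coupling_atD(1)[OF H1] and S1s = coupling_atD(2)[OF H1] and S1d = coupling_atD(3)[OF H1]
    and R1 = coupling_atD(4)[OF H1] and E1 = coupling_atD(5)[OF H1] and M1 = coupling_atD(6)[OF H1]
  note S2 = coupling_atD(1)[OF H2] and S2s = coupling_atD(2)[OF H2] and S2d = coupling_atD(3)[OF H2]
    and R2 = coupling_atD(4)[OF H2] and E2 = coupling_atD(5)[OF H2] and M2 = coupling_atD(6)[OF H2]
  define p where "p = real m / real (m + k)"
  have p: "0 < p" "p < 1" using m k by (auto simp: p_def)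
  have "\<forall>z\<in>L (m + k). \<exists>q. monotone_coupling (mid_law m k z) q"
    using exists_monotone_coupling finite_set_mid_law by blast
  then obtain q where q: "\<And>z. z \<in> L (m + k) \<Longrightarrow> monotone_coupling (mid_law m k z) (q z)" by metis
  define err where "err z g = \<bar>of_int (q z g) - p * of_int z - sqrt (real m * real k / real (m + k)) * g\<bar>" for z g
  define S where "S z \<omega> = glue m (S1 (q z (\<omega> 0)) (odds \<omega>)) (S2 (z - q z (\<omega> 0)) (evens \<omega>))" for z \<omega>
  define R where "R z \<omega> = err z (\<omega> 0) + max (R1 (q z (\<omega> 0)) (odds \<omega>)) (R2 (z - q z (\<omega> 0)) (evens \<omega>))" for z \<omega>
  let ?T = "borel \<Otimes>\<^sub>M (Gauss \<Otimes>\<^sub>M Gauss) :: (real \<times> (nat \<Rightarrow> real) \<times> (nat \<Rightarrow> real)) measure"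
  have split_m: "(\<lambda>\<omega>. (\<omega> 0, odds \<omega>, evens \<omega>)) \<in> measurable Gauss ?T" by measurable
  show ?thesis
    unfolding coupled_def coupling_at_def
  proof (intro exI[of _ "random_concat p B1 B2"] exI[of _ S] exI[of _ R] conjI ballI allI)
    show "gaussian_bridge (random_concat p B1 B2)" by (rule gaussian_bridge_concat[OF p B1 B2])
    fix z assume z: "z \<in> L (m + k)"
    note qz = q[OF z, unfolded monotone_coupling_def]
    have qs: "q z g \<in> set_pmf (mid_law m k z)" for g using qz by blast
    have q1: "q z g \<in> L m" and q2: "z - q z g \<in> L k" for g using set_mid_law[OF z qs] by auto
    have qm [measurable]: "q z \<in> measurable borel (count_space UNIV)" using qz by blast
    have qd: "distr std_normal (count_space UNIV) (q z) = measure_pmf (mid_law m k z)" using qz by blast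
    let ?I = "set_pmf (mid_law m k z)"
    have xI: "x \<in> L m" "z - x \<in> L k" if "x \<in> ?I" for x using set_mid_law[OF z that] by auto
    have qI: "(\<lambda>y. q z (fst y)) \<in> measurable ?T (count_space ?I)"
      by (rule measurable_count_space_subset) (use qs in auto)
    have err_m [measurable]: "err z \<in> borel_measurable borel" unfolding err_def by measurable
    have SP: "(\<lambda>y. glue m (S1 (q z (fst y)) (fst (snd y))) (S2 (z - q z (fst y)) (snd (snd y)))) \<in> measurable ?T (count_space UNIV)"
    proof (rule measurable_compose_countable'[OF _ qI])
      fix x assume x: "x \<in> ?I"
      have [measurable]: "S1 x \<in> measurable Gauss (count_space UNIV)" "S2 (z - x) \<in> measurable Gauss (count_space UNIV)"
        using S1 S2 xI[OF x] by auto
      \<comment> \<open>The path space is uncountable and carries the discrete \<sigma>-algebra, so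
        joint measurability of two paths is not automatic. As \<open>S1 x\<close> takes values in a
        finite support for every argument, it is enough to treat each fixed first path
        \<open>w\<close>.\<close>
      show "(\<lambda>y. glue m (S1 x (fst (snd y))) (S2 (z - x) (snd (snd y)))) \<in> measurable ?T (count_space UNIV)"
      proof (rule measurable_compose_countable'[where I="set_pmf (srw_cond_pmf m x)" and g="\<lambda>y. S1 x (fst (snd y))"
            and f="\<lambda>w y. glue m w (S2 (z - x) (snd (snd y)))"])
        show "(\<lambda>y. S1 x (fst (snd y))) \<in> measurable ?T (count_space (set_pmf (srw_cond_pmf m x)))"
          by (rule measurable_count_space_subset) (use S1s xI[OF x] in auto)
        fix w assume "w \<in> set_pmf (srw_cond_pmf m x)"
        have "(\<lambda>y. S2 (z - x) (snd (snd y))) \<in> measurable ?T (count_space UNIV)" by measurable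
        then show "(\<lambda>y. glue m w (S2 (z - x) (snd (snd y)))) \<in> measurable ?T (count_space UNIV)"
          by (rule measurable_compose) simp
      qed simp
    qed simp
    show Sm: "S z \<in> measurable Gauss (count_space UNIV)"
      using measurable_compose[OF split_m SP] by (simp add: S_def[abs_def])
    show "S z \<omega> \<in> set_pmf (srw_cond_pmf (m + k) z)" for \<omega>
      unfolding srw_cond_pmf_add(1)[OF z] S_def
      using qs[of "\<omega> 0"] S1s[OF q1] S2s[OF q2] by (auto intro!: bexI[of _ "q z (\<omega> 0)"])
    show "distr Gauss (count_space UNIV) (S z) = measure_pmf (srw_cond_pmf (m + k) z)"
    proof (rule measure_eqI)
      fix A :: "(nat \<Rightarrow> int) set"
      define f where "f x = (\<integral>\<^sup>+c. \<integral>\<^sup>+d. indicator A (glue m c d) \<partial>srw_cond_pmf k (z - x) \<partial>srw_cond_pmf m x)" for x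
      have "emeasure (distr Gauss (count_space UNIV) (S z)) A = emeasure Gauss (S z -` A)"
        using emeasure_distr[OF Sm, of A] by simp
      also have "\<dots> = (\<integral>\<^sup>+\<omega>. indicator (S z -` A) \<omega> \<partial>Gauss)"
        using measurable_sets[OF Sm, of A] by simp
      also have "\<dots> = (\<integral>\<^sup>+\<omega>. indicator A (glue m (S1 (q z (\<omega> 0)) (odds \<omega>)) (S2 (z - q z (\<omega> 0)) (evens \<omega>))) \<partial>Gauss)"
        by (intro nn_integral_cong) (simp add: indicator_def S_def)
      also have "\<dots> = (\<integral>\<^sup>+g. \<integral>\<^sup>+u. \<integral>\<^sup>+v. indicator A (glue m (S1 (q z g) u) (S2 (z - q z g) v)) \<partial>Gauss \<partial>Gauss \<partial>std_normal)"
      proof (rule nn_integral_Gauss_split[where F="\<lambda>g u v. indicator A (glue m (S1 (q z g) u) (S2 (z - q z g) v))"])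
        have "(indicator A :: _ \<Rightarrow> ennreal) \<in> borel_measurable (count_space UNIV)" by simp
        from measurable_compose[OF SP this]
        show "(\<lambda>(g, u, v). indicator A (glue m (S1 (q z g) u) (S2 (z - q z g) v)) :: ennreal) \<in> borel_measurable ?T"
          by (simp add: case_prod_beta')
      qed
      also have "\<dots> = (\<integral>\<^sup>+g. f (q z g) \<partial>std_normal)"
      proof (intro nn_integral_cong)
        fix g
        have "(\<integral>\<^sup>+v. indicator A (glue m c (S2 (z - q z g) v)) \<partial>Gauss) = (\<integral>\<^sup>+d. indicator A (glue m c d) \<partial>srw_cond_pmf k (z - q z g))" for c
          unfolding S2d[OF q2, symmetric] by (rule nn_integral_distr[OF S2[OF q2], symmetric]) simp
        then have "(\<integral>\<^sup>+u. \<integral>\<^sup>+v. indicator A (glue m (S1 (q z g) u) (S2 (z - q z g) v)) \<partial>Gauss \<partial>Gauss)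
          = (\<integral>\<^sup>+u. \<integral>\<^sup>+d. indicator A (glue m (S1 (q z g) u) d) \<partial>srw_cond_pmf k (z - q z g) \<partial>Gauss)" by simp
        also have "\<dots> = f (q z g)"
          unfolding f_def S1d[OF q1, symmetric]
          by (rule nn_integral_distr[OF S1[OF q1], where f="\<lambda>c. \<integral>\<^sup>+d. indicator A (glue m c d) \<partial>srw_cond_pmf k (z - q z g)", symmetric]) simp
        finally show "(\<integral>\<^sup>+u. \<integral>\<^sup>+v. indicator A (glue m (S1 (q z g) u) (S2 (z - q z g) v)) \<partial>Gauss \<partial>Gauss) = f (q z g)" .
      qed
      also have "\<dots> = (\<integral>\<^sup>+x. f x \<partial>mid_law m k z)"
        unfolding qd[symmetric] by (rule nn_integral_distr[symmetric]) (auto simp: measurable_cong_sets[of std_normal borel])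
      also have "\<dots> = emeasure (srw_cond_pmf (m + k) z) A"
        unfolding srw_cond_pmf_add(1)[OF z] emeasure_bind_pmf
      proof (intro nn_integral_cong)
        fix x
        have "emeasure (map_pmf (\<lambda>(u, v). glue m u v) (pair_pmf (srw_cond_pmf m x) (srw_cond_pmf k (z - x)))) A
          = (\<integral>\<^sup>+y. indicator A y \<partial>map_pmf (\<lambda>(u, v). glue m u v) (pair_pmf (srw_cond_pmf m x) (srw_cond_pmf k (z - x))))"
          by (rule nn_integral_indicator[symmetric]) simp
        also have "\<dots> = f x"
          unfolding f_def nn_integral_map_pmf nn_integral_pair_pmf' by simp
        finally show "f x = emeasure (map_pmf (\<lambda>(u, v). glue m u v) (pair_pmf (srw_cond_pmf m x) (srw_cond_pmf k (z - x)))) A" ..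
      qed
      finally show "emeasure (distr Gauss (count_space UNIV) (S z)) A = emeasure (srw_cond_pmf (m + k) z) A" .
    qed simp
    have RP1: "(\<lambda>y. R1 (q z (fst y)) (fst (snd y))) \<in> borel_measurable ?T"
    proof (rule measurable_compose_countable'[OF _ qI])
      fix x assume "x \<in> ?I"
      then have [measurable]: "R1 x \<in> borel_measurable Gauss" using R1 xI by blast
      show "(\<lambda>y. R1 x (fst (snd y))) \<in> borel_measurable ?T" by measurable
    qed simp
    have RP2: "(\<lambda>y. R2 (z - q z (fst y)) (snd (snd y))) \<in> borel_measurable ?T"
    proof (rule measurable_compose_countable'[OF _ qI])
      fix x assume "x \<in> ?I"
      then have [measurable]: "R2 (z - x) \<in> borel_measurable Gauss" using R2 xI by blast
      show "(\<lambda>y. R2 (z - x) (snd (snd y))) \<in> borel_measurable ?T" by measurable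
    qed simp
    have "(\<lambda>y. err z (fst y) + max (R1 (q z (fst y)) (fst (snd y))) (R2 (z - q z (fst y)) (snd (snd y)))) \<in> borel_measurable ?T"
      using RP1 RP2 by measurable
    from measurable_compose[OF split_m this] show "R z \<in> borel_measurable Gauss"
      by (simp add: R_def[abs_def])
    show "\<bar>sqrt (real (m + k)) * random_concat p B1 B2 (t / real (m + k)) \<omega> + t / real (m + k) * real_of_int z - interp (S z \<omega>) t\<bar> \<le> R z \<omega>"
      if t: "t \<in> {0..real (m + k)}" for \<omega> t
      unfolding random_concat_def S_def R_def err_def p_def
    proof (rule glue_error[OF m k refl])
      let ?x = "q z (\<omega> 0)"
      have s1: "S1 ?x (odds \<omega>) \<in> set_pmf (srw_pmf m)" "S1 ?x (odds \<omega>) m = ?x"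
        using S1s[OF q1, of "\<omega> 0" "odds \<omega>"] unfolding set_srw_cond_pmf[OF q1] by auto
      show "S1 ?x (odds \<omega>) j = ?x" if "m \<le> j" for j using srw_pmf_const[OF s1(1) that] s1(2) by simp
      have "S2 (z - ?x) (evens \<omega>) \<in> set_pmf (srw_pmf k)"
        using S2s[OF q2, of "\<omega> 0" "evens \<omega>"] unfolding set_srw_cond_pmf[OF q2] by auto
      then show "S2 (z - ?x) (evens \<omega>) 0 = 0" by (rule srw_pmf_0)
      show "t \<in> {0..real (m + k)}" by (rule t)
    qed (use E1[OF q1] E2[OF q2] in auto)
    have "(\<integral>\<^sup>+\<omega>. ennreal (exp (a * R z \<omega>)) \<partial>Gauss)
      \<le> (\<integral>\<^sup>+\<omega>. ennreal (exp (a * err z (\<omega> 0))) * (ennreal (exp (a * R1 (q z (\<omega> 0)) (odds \<omega>))) + ennreal (exp (a * R2 (z - q z (\<omega> 0)) (evens \<omega>)))) \<partial>Gauss)"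
    proof (intro nn_integral_mono)
      fix \<omega>
      let ?r1 = "R1 (q z (\<omega> 0)) (odds \<omega>)" and ?r2 = "R2 (z - q z (\<omega> 0)) (evens \<omega>)"
      have "exp (a * R z \<omega>) = exp (a * err z (\<omega> 0)) * exp (a * max ?r1 ?r2)"
        by (simp add: R_def distrib_left exp_add)
      \<comment> \<open>Exp of the maximum is at most the sum of the exps, so the constants
        \<open>G1\<close> and \<open>G2\<close> are added and not multiplied.\<close>
      also have "\<dots> \<le> exp (a * err z (\<omega> 0)) * (exp (a * ?r1) + exp (a * ?r2))"
        by (intro mult_left_mono) (auto simp: max_def)
      finally show "ennreal (exp (a * R z \<omega>)) \<le> ennreal (exp (a * err z (\<omega> 0))) * (ennreal (exp (a * ?r1)) + ennreal (exp (a * ?r2)))"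
        by (simp flip: ennreal_plus ennreal_mult)
    qed
    also have "\<dots> = (\<integral>\<^sup>+g. \<integral>\<^sup>+u. \<integral>\<^sup>+v. ennreal (exp (a * err z g)) * (ennreal (exp (a * R1 (q z g) u)) + ennreal (exp (a * R2 (z - q z g) v))) \<partial>Gauss \<partial>Gauss \<partial>std_normal)"
    proof (rule nn_integral_Gauss_split[where F="\<lambda>g u v. ennreal (exp (a * err z g)) * (ennreal (exp (a * R1 (q z g) u)) + ennreal (exp (a * R2 (z - q z g) v)))"])
      have "(\<lambda>y. ennreal (exp (a * err z (fst y))) * (ennreal (exp (a * R1 (q z (fst y)) (fst (snd y)))) + ennreal (exp (a * R2 (z - q z (fst y)) (snd (snd y)))))) \<in> borel_measurable ?T"
        using RP1 RP2 by measurable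
      then show "(\<lambda>(g, u, v). ennreal (exp (a * err z g)) * (ennreal (exp (a * R1 (q z g) u)) + ennreal (exp (a * R2 (z - q z g) v)))) \<in> borel_measurable ?T"
        by (simp add: case_prod_beta')
    qed
    also have "\<dots> \<le> (\<integral>\<^sup>+g. ennreal (exp (a * err z g) * (G1 * exp ((of_int (q z g))\<^sup>2 / (16 * real m)) + G2 * exp ((of_int (z - q z g))\<^sup>2 / (16 * real k)))) \<partial>std_normal)"
    proof (intro nn_integral_mono)
      fix g
      have [measurable]: "R1 (q z g) \<in> borel_measurable Gauss" "R2 (z - q z g) \<in> borel_measurable Gauss"
        using R1 R2 q1 q2 by auto
      have "(\<integral>\<^sup>+u. \<integral>\<^sup>+v. ennreal (exp (a * err z g)) * (ennreal (exp (a * R1 (q z g) u)) + ennreal (exp (a * R2 (z - q z g) v))) \<partial>Gauss \<partial>Gauss)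
        = ennreal (exp (a * err z g)) * ((\<integral>\<^sup>+u. ennreal (exp (a * R1 (q z g) u)) \<partial>Gauss) + (\<integral>\<^sup>+v. ennreal (exp (a * R2 (z - q z g) v)) \<partial>Gauss))"
        by (simp add: nn_integral_cmult nn_integral_add Gauss.emeasure_space_1[simplified])
      also have "\<dots> \<le> ennreal (exp (a * err z g)) * (ennreal (G1 * exp ((of_int (q z g))\<^sup>2 / (16 * real m))) + ennreal (G2 * exp ((of_int (z - q z g))\<^sup>2 / (16 * real k))))"
        by (intro mult_left_mono add_mono M1[OF q1] M2[OF q2]) simp
      also have "\<dots> = ennreal (exp (a * err z g) * (G1 * exp ((of_int (q z g))\<^sup>2 / (16 * real m)) + G2 * exp ((of_int (z - q z g))\<^sup>2 / (16 * real k))))"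
        using G by (simp flip: ennreal_plus ennreal_mult)
      finally show "(\<integral>\<^sup>+u. \<integral>\<^sup>+v. ennreal (exp (a * err z g)) * (ennreal (exp (a * R1 (q z g) u)) + ennreal (exp (a * R2 (z - q z g) v))) \<partial>Gauss \<partial>Gauss)
        \<le> ennreal (exp (a * err z g) * (G1 * exp ((of_int (q z g))\<^sup>2 / (16 * real m)) + G2 * exp ((of_int (z - q z g))\<^sup>2 / (16 * real k))))" .
    qed
    also have "\<dots> \<le> ennreal (G * exp ((of_int z)\<^sup>2 / (16 * real (m + k))))"
      unfolding err_def p_def by (rule mom[OF z q[OF z]])
    finally show "(\<integral>\<^sup>+\<omega>. ennreal (exp (a * R z \<omega>)) \<partial>Gauss) \<le> ennreal (G * exp ((of_int z)\<^sup>2 / (16 * real (m + k))))" .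
  qed
qed

section \<open>Doubling, one added step, and polynomial growth of the moment\<close>

lemma coupled_double:
  assumes m: "m \<ge> 1" and a: "0 \<le> a" "a \<le> 1 / 100663296" and G: "0 \<le> G" and C: "coupled a m G"
  shows "coupled a (m + m) (4 * G)"
proof (rule coupled_add[OF m m a(1) G G C C])
  fix z q assume z: "z \<in> L (m + m)" and q: "monotone_coupling (mid_law m m z) q"
  have m0: "real m > 0" using m by simp
  have qm [measurable]: "q \<in> measurable borel (count_space UNIV)" using q by (simp add: monotone_coupling_def)
  have e1: "real m / real (m + m) * of_int z = of_int z / 2" using m0 by (simp add: field_simps)
  have e2: "real m * real m / real (m + m) = real m / 2" using m0 by (simp add: field_simps)
  define err where "err g = \<bar>of_int (q g) - of_int z / 2 - sqrt (real m / 2) * g\<bar>" for g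
  have em [measurable]: "err \<in> borel_measurable borel" unfolding err_def by measurable
  note mom = mid_law_coupling_moment[OF m z q a, folded err_def]
  have "(\<integral>\<^sup>+g. ennreal (exp (a * err g) * (G * exp ((of_int (q g))\<^sup>2 / (16 * real m)) + G * exp ((of_int (z - q g))\<^sup>2 / (16 * real m)))) \<partial>std_normal)
    = (\<integral>\<^sup>+g. ennreal G * (ennreal (exp (a * err g + (of_int (q g))\<^sup>2 / (16 * real m))) + ennreal (exp (a * err g + (of_int (z - q g))\<^sup>2 / (16 * real m)))) \<partial>std_normal)"
    using G by (intro nn_integral_cong) (simp add: exp_add algebra_simps flip: ennreal_plus ennreal_mult)
  also have "\<dots> = ennreal G * ((\<integral>\<^sup>+g. ennreal (exp (a * err g + (of_int (q g))\<^sup>2 / (16 * real m))) \<partial>std_normal) + (\<integral>\<^sup>+g. ennreal (exp (a * err g + (of_int (z - q g))\<^sup>2 / (16 * real m))) \<partial>std_normal))"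
    by (subst nn_integral_cmult, simp, subst nn_integral_add) auto
  also have "\<dots> \<le> ennreal G * (ennreal (2 * exp ((of_int z)\<^sup>2 / (32 * real m))) + ennreal (2 * exp ((of_int z)\<^sup>2 / (32 * real m))))"
    using mom[of "\<lambda>x. x"] mom[of "\<lambda>x. z - x"] by (intro mult_left_mono add_mono) auto
  also have "\<dots> = ennreal (4 * G * exp ((of_int z)\<^sup>2 / (16 * real (m + m))))"
    using G by (simp add: mult_ac flip: ennreal_plus ennreal_mult)
  finally show "(\<integral>\<^sup>+g. ennreal (exp (a * \<bar>of_int (q g) - real m / real (m + m) * of_int z - sqrt (real m * real m / real (m + m)) * g\<bar>)
         * (G * exp ((of_int (q g))\<^sup>2 / (16 * real m)) + G * exp ((of_int (z - q g))\<^sup>2 / (16 * real m)))) \<partial>std_normal)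
      \<le> ennreal (4 * G * exp ((of_int z)\<^sup>2 / (16 * real (m + m))))"
    unfolding e1 e2 err_def .
qed

text \<open>Passing from \<open>x^2\<close> to \<open>z^2\<close> loses at most
  \<open>2 * \<bar>x\<bar>\<close>, and enlarging the denominator loses
  \<open>x^2 / (m * (m + 1))\<close>. By \<open>\<bar>x\<bar> \<le> m\<close> these losses amount to
  at most 2 and 1.\<close>

lemma square_div_step:
  fixes x z m :: real
  assumes m: "1 \<le> m" and x: "\<bar>x\<bar> \<le> m" and xz: "\<bar>z\<bar> \<ge> \<bar>x\<bar> - 1"
  shows "x\<^sup>2 / m \<le> z\<^sup>2 / (m + 1) + 3"
proof -
  have x2: "x\<^sup>2 \<le> m * \<bar>x\<bar>" using mult_right_mono[OF x, of "\<bar>x\<bar>"] by (simp add: power2_eq_square)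
  have "x\<^sup>2 - 2 * \<bar>x\<bar> \<le> z\<^sup>2"
  proof (cases "\<bar>x\<bar> \<le> 1")
    case True
    then have "\<bar>x\<bar> * \<bar>x\<bar> \<le> 1 * \<bar>x\<bar>" by (intro mult_right_mono) auto
    then have "x\<^sup>2 \<le> \<bar>x\<bar>" by (simp add: power2_eq_square)
    moreover have "0 \<le> z\<^sup>2" by simp
    ultimately show ?thesis by linarith
  next
    case False
    then have "(\<bar>x\<bar> - 1)\<^sup>2 \<le> \<bar>z\<bar>\<^sup>2" using xz by (intro power_mono) auto
    then show ?thesis by (simp add: power2_diff)
  qed
  then have "m * (x\<^sup>2 - 2 * \<bar>x\<bar>) \<le> m * z\<^sup>2" using m by (intro mult_left_mono) auto
  moreover have "m * \<bar>x\<bar> \<le> m * m" using m x by (intro mult_left_mono) auto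
  moreover have "m * (x\<^sup>2 - 2 * \<bar>x\<bar>) = m * x\<^sup>2 - 2 * (m * \<bar>x\<bar>)" by (simp add: algebra_simps)
  ultimately have "m * x\<^sup>2 + x\<^sup>2 \<le> m * z\<^sup>2 + 3 * (m * m) + 3 * m"
    using x2 m by linarith
  then have "(m + 1) * x\<^sup>2 \<le> m * z\<^sup>2 + 3 * (m * (m + 1))" by (simp add: algebra_simps)
  then show ?thesis using m by (simp add: field_simps)
qed

text \<open>For a single added step no quantile estimate is needed: the value at the cut is within 1
  of \<open>z\<close>, so the error is at most \<open>2 + \<bar>g\<bar>\<close>. The factor collects
  2 from the two parts, \<open>exp 2\<close> from this error, \<open>exp 1\<close> from the change
  of the quadratic exponent and \<open>2 * exp (1 / 2)\<close> from the moment of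
  \<open>exp \<bar>g\<bar>\<close>.\<close>

lemma coupled_Suc:
  assumes m: "m \<ge> 1" and a: "0 \<le> a" "a \<le> 1" and G: "0 \<le> G" and C: "coupled a m G" and C1: "coupled a 1 G"
  shows "coupled a (m + 1) (4 * exp 4 * G)"
proof (rule coupled_add[OF m le_refl a(1) G G C C1])
  fix z q assume z: "z \<in> L (m + 1)" and q: "monotone_coupling (mid_law m 1 z) q"
  have m1: "1 \<le> real m" using m by simp
  define n where "n = real (m + 1)"
  have n: "n = real m + 1" "n > 0" by (simp_all add: n_def)
  define Z where "Z = exp ((of_int z)\<^sup>2 / (16 * n))"
  have zn: "\<bar>real_of_int z\<bar> \<le> n" using L_bound[OF z] unfolding n_def by linarith
  have pt: "exp (a * \<bar>of_int (q g) - real m / n * of_int z - sqrt (real m * real 1 / n) * g\<bar>)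
      * (G * exp ((of_int (q g))\<^sup>2 / (16 * real m)) + G * exp ((of_int (z - q g))\<^sup>2 / (16 * real 1)))
    \<le> 2 * G * exp 3 * Z * exp \<bar>g\<bar>" for g
  proof -
    have qs: "q g \<in> set_pmf (mid_law m 1 z)" using q by (simp add: monotone_coupling_def)
    have x: "\<bar>q g\<bar> \<le> int m" and xz: "\<bar>z - q g\<bar> \<le> 1"
      using set_mid_law[OF z qs] L_bound by fastforce+
    have "of_int (q g) - real m / n * of_int z - sqrt (real m * real 1 / n) * g
      = - of_int (z - q g) + of_int z / n - sqrt (real m / n) * g"
      using n by (simp add: field_simps)
    also have "\<bar>\<dots>\<bar> \<le> 1 + 1 + \<bar>g\<bar>"
    proof -
      have "\<bar>real_of_int (z - q g)\<bar> \<le> 1" using xz by linarith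
      moreover have "\<bar>real_of_int z / n\<bar> \<le> 1" using zn n(2) by (simp add: abs_divide divide_le_eq)
      moreover have "\<bar>sqrt (real m / n) * g\<bar> \<le> 1 * \<bar>g\<bar>"
        unfolding abs_mult using n m1 by (intro mult_right_mono) (auto simp: divide_le_eq)
      ultimately show ?thesis by linarith
    qed
    finally have e: "\<bar>of_int (q g) - real m / n * of_int z - sqrt (real m * real 1 / n) * g\<bar> \<le> 2 + \<bar>g\<bar>" by simp
    have "a * \<bar>of_int (q g) - real m / n * of_int z - sqrt (real m * real 1 / n) * g\<bar> \<le> 1 * (2 + \<bar>g\<bar>)"
      using a e by (intro mult_mono) auto
    then have e1: "exp (a * \<bar>of_int (q g) - real m / n * of_int z - sqrt (real m * real 1 / n) * g\<bar>) \<le> exp 2 * exp \<bar>g\<bar>"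
      by (simp flip: exp_add)
    have "(real_of_int (q g))\<^sup>2 / real m \<le> (of_int z)\<^sup>2 / (real m + 1) + 3"
      by (rule square_div_step[OF m1]) (use x xz in linarith)+
    then have "(real_of_int (q g))\<^sup>2 / real m / 16 \<le> ((of_int z)\<^sup>2 / (real m + 1) + 3) / 16"
      by (rule divide_right_mono) simp
    also have "\<dots> = (of_int z)\<^sup>2 / (16 * n) + 3 / 16"
      unfolding n(1) add_divide_distrib by (simp add: mult.commute)
    also have "\<dots> \<le> (of_int z)\<^sup>2 / (16 * n) + 1" by simp
    finally have "(real_of_int (q g))\<^sup>2 / (16 * real m) \<le> (of_int z)\<^sup>2 / (16 * n) + 1"
      by (simp add: mult.commute)
    then have e2: "exp ((of_int (q g))\<^sup>2 / (16 * real m)) \<le> Z * exp 1"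
      unfolding Z_def by (simp flip: exp_add)
    have "(real_of_int (z - q g))\<^sup>2 \<le> 1" using xz power_mono[of "\<bar>real_of_int (z - q g)\<bar>" 1 2] by simp
    moreover have "0 \<le> (of_int z)\<^sup>2 / (16 * n)" using n by simp
    ultimately have "(real_of_int (z - q g))\<^sup>2 / (16 * real 1) \<le> (of_int z)\<^sup>2 / (16 * n) + 1" by simp
    then have e3: "exp ((of_int (z - q g))\<^sup>2 / (16 * real 1)) \<le> Z * exp 1"
      unfolding Z_def by (simp flip: exp_add)
    have "exp (a * \<bar>of_int (q g) - real m / n * of_int z - sqrt (real m * real 1 / n) * g\<bar>)
      * (G * exp ((of_int (q g))\<^sup>2 / (16 * real m)) + G * exp ((of_int (z - q g))\<^sup>2 / (16 * real 1)))
      \<le> (exp 2 * exp \<bar>g\<bar>) * (G * (Z * exp 1) + G * (Z * exp 1))"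
      using e1 e2 e3 G by (intro mult_mono add_mono mult_left_mono) auto
    also have "\<dots> = 2 * G * (exp 2 * exp 1) * Z * exp \<bar>g\<bar>" by simp
    also have "exp 2 * exp 1 = exp (3 :: real)" by (simp flip: exp_add)
    finally show ?thesis .
  qed
  have Z0: "0 \<le> Z" by (simp add: Z_def)
  have "(\<integral>\<^sup>+g. ennreal (exp (a * \<bar>of_int (q g) - real m / n * of_int z - sqrt (real m * real 1 / n) * g\<bar>)
      * (G * exp ((of_int (q g))\<^sup>2 / (16 * real m)) + G * exp ((of_int (z - q g))\<^sup>2 / (16 * real 1)))) \<partial>std_normal)
    \<le> (\<integral>\<^sup>+g. ennreal (2 * G * exp 3 * Z) * ennreal (exp \<bar>g\<bar>) \<partial>std_normal)"
    using pt G Z0 by (intro nn_integral_mono) (simp flip: ennreal_mult)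
  also have "\<dots> = ennreal (2 * G * exp 3 * Z) * (\<integral>\<^sup>+g. ennreal (exp \<bar>g\<bar>) \<partial>std_normal)"
    by (rule nn_integral_cmult) simp
  also have "\<dots> \<le> ennreal (2 * G * exp 3 * Z) * ennreal (2 * exp (1 / 2))"
    by (intro mult_left_mono std_normal_exp_abs) simp
  also have "\<dots> = ennreal (4 * G * Z * (exp 3 * exp (1 / 2)))"
    using G Z0 by (simp add: mult_ac flip: ennreal_mult)
  also have "\<dots> \<le> ennreal (4 * G * Z * exp 4)"
    using G Z0 by (intro ennreal_leI mult_left_mono) (auto simp flip: exp_add)
  finally show "(\<integral>\<^sup>+g. ennreal (exp (a * \<bar>of_int (q g) - real m / real (m + 1) * of_int z - sqrt (real m * real 1 / real (m + 1)) * g\<bar>)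
      * (G * exp ((of_int (q g))\<^sup>2 / (16 * real m)) + G * exp ((of_int (z - q g))\<^sup>2 / (16 * real 1)))) \<partial>std_normal)
    \<le> ennreal (4 * exp 4 * G * exp ((of_int z)\<^sup>2 / (16 * real (m + 1))))"
    unfolding Z_def n_def by (simp add: mult_ac)
qed

text \<open>The number \<open>16 * exp 4\<close> is the factor 4 of the doubling times the factor
  \<open>4 * exp 4\<close> of the added step, which is the most that one halving of \<open>n\<close>
  can cost.\<close>

lemma coupled_growth:
  assumes a: "0 \<le> a" "a \<le> 1 / 100663296" and G: "0 \<le> G" and C1: "coupled a 1 G"
    and n: "n \<ge> 1" and \<alpha>: "2 powr \<alpha> = 16 * exp 4"
  shows "coupled a n (G * real n powr \<alpha>)"
  using n
proof (induction n rule: less_induct)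
  case (less n)
  have e4: "1 \<le> exp (4 :: real)" by simp
  have dbl: "coupled a (m + m) (4 * (G * real m powr \<alpha>))" if m: "m \<ge> 1" "m < n" for m
    using m a G by (intro coupled_double less.IH) auto
  have \<alpha>0: "0 \<le> \<alpha>"
  proof (rule ccontr)
    assume "\<not> 0 \<le> \<alpha>"
    then have "2 powr \<alpha> < (2 :: real) powr 0" by (intro powr_less_mono) auto
    then show False using \<alpha> e4 by simp
  qed
  consider "n = 1" | m where "m \<ge> 1" "n = m + m" | m where "m \<ge> 1" "n = m + m + 1"
  proof -
    have "n = n div 2 + n div 2 + n mod 2" by presburger
    moreover have "n mod 2 = 0 \<or> n mod 2 = 1" by presburger
    moreover have "n = 1 \<or> n div 2 \<ge> 1" using less.prems by presburger
    ultimately show ?thesis using that by (metis add_0_right)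
  qed
  then show ?case
  proof cases
    case 1
    then show ?thesis using C1 by simp
  next
    case (2 m)
    have "4 * (G * real m powr \<alpha>) \<le> 16 * exp 4 * (G * real m powr \<alpha>)"
    proof (rule mult_right_mono)
      show "4 \<le> 16 * exp (4 :: real)" using e4 by linarith
    qed (use G in simp)
    also have "\<dots> = G * (2 * real m) powr \<alpha>" by (simp add: powr_mult \<alpha>)
    finally have "4 * (G * real m powr \<alpha>) \<le> G * real n powr \<alpha>" using 2 by simp
    then show ?thesis using dbl[of m] 2 by (auto intro: coupled_mono)
  next
    case (3 m)
    have "1 \<le> real m powr \<alpha>" using 3 \<alpha>0 by (intro ge_one_powr_ge_zero) auto
    then have "G * 1 \<le> G * real m powr \<alpha>" using G by (intro mult_left_mono)
    then have "G \<le> 4 * (G * real m powr \<alpha>)" using G by linarith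
    then have "coupled a 1 (4 * (G * real m powr \<alpha>))" by (rule coupled_mono[OF C1])
    then have "coupled a (m + m + 1) (4 * exp 4 * (4 * (G * real m powr \<alpha>)))"
      using 3 a G by (intro coupled_Suc dbl) auto
    moreover have "4 * exp 4 * (4 * (G * real m powr \<alpha>)) = G * (2 * real m) powr \<alpha>" by (simp add: powr_mult \<alpha>)
    moreover have "G * (2 * real m) powr \<alpha> \<le> G * real n powr \<alpha>"
      using 3 \<alpha>0 G by (intro mult_left_mono powr_mono2) auto
    ultimately show ?thesis using 3 by (auto intro: coupled_mono)
  qed
qed

section \<open>From the exponential moment to the tail of the discrepancy\<close>

lemma interp_eq_sum:
  assumes t: "0 \<le> t" "t \<le> real n"
  shows "interp S t = of_int (S 0) + (\<Sum>i<Suc n. of_int (S (Suc i) - S i) * max 0 (min 1 (t - real i)))"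
proof -
  define j where "j = nat \<lfloor>t\<rfloor>"
  have j: "real j \<le> t" "t < real j + 1" "frac t = t - real j" using t by (auto simp: j_def frac_def)
  then have jn: "j \<le> n" using t by linarith
  \<comment> \<open>The floor of \<open>t\<close> may be \<open>n\<close> itself, so the index
    \<open>n\<close> has to be included; ramps starting after \<open>t\<close> vanish.\<close>
  have "(\<Sum>i<Suc n. of_int (S (Suc i) - S i) * max 0 (min 1 (t - real i)))
    = (\<Sum>i<Suc j. of_int (S (Suc i) - S i) * max 0 (min 1 (t - real i)))"
    using jn j by (intro sum.mono_neutral_right) (auto simp: max_def min_def)
  also have "\<dots> = (\<Sum>i<j. of_int (S (Suc i) - S i) * max 0 (min 1 (t - real i))) + of_int (S (Suc j) - S j) * frac t"
    using j by (simp add: max_def min_def)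
  also have "(\<Sum>i<j. of_int (S (Suc i) - S i) * max 0 (min 1 (t - real i))) = (\<Sum>i<j. real_of_int (S (Suc i)) - real_of_int (S i))"
    using j by (intro sum.cong) (auto simp: max_def min_def)
  also have "\<dots> = of_int (S j) - of_int (S 0)" by (rule sum_lessThan_telescope)
  finally show ?thesis unfolding interp_def j_def[symmetric] by (simp add: algebra_simps)
qed

text \<open>The definition by floor and fractional part hides the continuity at integers; as a
  finite sum of clamped ramps the path is visibly continuous.\<close>

lemma continuous_on_interp: "continuous_on {0..real n} (interp S)"
proof -
  have "continuous_on {0..real n} (\<lambda>t. of_int (S 0) + (\<Sum>i<Suc n. of_int (S (Suc i) - S i) * max 0 (min 1 (t - real i))))"
    by (intro continuous_intros)
  then show ?thesis
    by (rule continuous_on_cong[THEN iffD1, rotated -1]) (use interp_eq_sum in auto)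
qed

text \<open>Rounding \<open>t\<close> down to multiples of \<open>1 / (j + 1)\<close> stays inside
  the interval and converges to \<open>t\<close>. This makes the event that a supremum exceeds a
  level a countable union.\<close>

lemma exists_rational_time:
  fixes h :: "real \<Rightarrow> real"
  assumes h: "continuous_on {0..c} h" and t: "t \<in> {0..c}" "x < h t"
  shows "\<exists>i j :: nat. real i / real (Suc j) \<in> {0..c} \<and> x < h (real i / real (Suc j))"
proof (rule ccontr)
  assume *: "\<not> ?thesis"
  define T where "T j = real (nat \<lfloor>t * real (Suc j)\<rfloor>) / real (Suc j)" for j
  have T: "T j \<le> t" "t - 1 / real (Suc j) \<le> T j" "0 \<le> T j" for j
  proof -
    have "0 \<le> t * real (Suc j)" using t by simp
    then have N: "real (nat \<lfloor>t * real (Suc j)\<rfloor>) \<le> t * real (Suc j)" "t * real (Suc j) - 1 \<le> real (nat \<lfloor>t * real (Suc j)\<rfloor>)"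
      by linarith+
    have J: "0 < real (Suc j)" by simp
    show "T j \<le> t" unfolding T_def using N(1) by (simp only: pos_divide_le_eq[OF J])
    have "t - 1 / real (Suc j) = (t * real (Suc j) - 1) / real (Suc j)" using J by (simp add: diff_divide_distrib del: of_nat_Suc)
    also have "\<dots> \<le> T j" unfolding T_def using N(2) J by (intro divide_right_mono) auto
    finally show "t - 1 / real (Suc j) \<le> T j" .
    show "0 \<le> T j" unfolding T_def by simp
  qed
  have inT: "T j \<in> {0..c}" for j using T(1)[of j] T(3)[of j] t unfolding atLeastAtMost_iff by linarith
  have "(\<lambda>j. t - 1 / real (Suc j)) \<longlonglongrightarrow> t - 0" by (intro tendsto_diff tendsto_const LIMSEQ_Suc lim_1_over_n)
  then have lim: "(\<lambda>j. t - 1 / real (Suc j)) \<longlonglongrightarrow> t" by (simp only: diff_0_right)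
  have "T \<longlonglongrightarrow> t"
    by (rule real_tendsto_sandwich[OF always_eventually always_eventually lim tendsto_const]) (use T in blast)+
  then have "(\<lambda>j. h (T j)) \<longlonglongrightarrow> h t"
    by (intro continuous_on_tendsto_compose[OF h]) (use t inT in auto)
  moreover have "h (T j) \<le> x" for j using * inT[of j] unfolding T_def by (metis not_le)
  ultimately have "h t \<le> x" by (intro LIMSEQ_le_const2) auto
  with t show False by simp
qed

text \<open>Measurability comes from rational times and path continuity; the bound is Markov's
  inequality for \<open>exp (a * R)\<close>, as \<open>R\<close> dominates the supremum.\<close>

lemma Delta_tail:
  assumes n: "n \<ge> 1" and B: "gaussian_bridge B" and C: "coupling_at a n G B z S R"
    and a: "0 < a" and G: "0 \<le> G"
  shows "{\<omega> \<in> space Gauss. x < Delta n z B S \<omega>} \<in> sets Gauss"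
    and "measure Gauss {\<omega> \<in> space Gauss. x < Delta n z B S \<omega>} \<le> exp (- a * x) * (G * exp ((of_int z)\<^sup>2 / (16 * real n)))"
proof -
  note D = coupling_atD[OF C]
  have [measurable]: "R \<in> borel_measurable Gauss" by (rule D(4))
  have n0: "real n > 0" using n by simp
  define h where "h \<omega> t = \<bar>sqrt (real n) * B (t / real n) \<omega> + t / real n * real_of_int z - interp (S \<omega>) t\<bar>" for \<omega> t
  have cont: "continuous_on {0..real n} (h \<omega>)" for \<omega>
  proof -
    have "continuous_on {0..real n} (\<lambda>t. B (t / real n) \<omega>)"
      by (rule continuous_on_compose2[of "{0..1}" "\<lambda>t. B t \<omega>"])
         (use B n0 in \<open>auto simp: gaussian_bridge_def divide_le_eq intro!: continuous_intros\<close>)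
    then show ?thesis unfolding h_def using n0 by (intro continuous_intros continuous_on_interp) auto
  qed
  have hR: "h \<omega> t \<le> R \<omega>" if "t \<in> {0..real n}" for \<omega> t using D(5)[OF that] by (simp add: h_def)
  have Delta: "Delta n z B S \<omega> = (SUP t\<in>{0..real n}. h \<omega> t)" for \<omega> by (simp add: Delta_def h_def)
  have bdd: "bdd_above (h \<omega> ` {0..real n})" for \<omega> using hR by (auto intro!: bdd_aboveI[of _ "R \<omega>"])
  have DR: "Delta n z B S \<omega> \<le> R \<omega>" for \<omega> unfolding Delta using hR by (intro cSUP_least) auto
  have iff: "x < Delta n z B S \<omega> \<longleftrightarrow> (\<exists>i j. real i / real (Suc j) \<in> {0..real n} \<and> x < h \<omega> (real i / real (Suc j)))" for \<omega>
  proof -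
    have "x < Delta n z B S \<omega> \<longleftrightarrow> (\<exists>t\<in>{0..real n}. x < h \<omega> t)"
      unfolding Delta by (rule less_cSUP_iff[OF _ bdd]) simp
    also have "\<dots> \<longleftrightarrow> (\<exists>i j. real i / real (Suc j) \<in> {0..real n} \<and> x < h \<omega> (real i / real (Suc j)))"
      using exists_rational_time[OF cont] by blast
    finally show ?thesis .
  qed
  have hm: "(\<lambda>\<omega>. h \<omega> t) \<in> borel_measurable Gauss" if "t \<in> {0..real n}" for t
  proof -
    have "t / real n \<in> {0..1}" using that n0 by (auto simp: divide_le_eq)
    then have [measurable]: "B (t / real n) \<in> borel_measurable Gauss"
      using B by (auto simp: gaussian_bridge_def gaussian_process_def)
    have [measurable]: "(\<lambda>\<omega>. interp (S \<omega>) t) \<in> borel_measurable Gauss"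
      by (rule measurable_compose[OF D(1)]) simp
    show ?thesis unfolding h_def by measurable
  qed
  have m: "{\<omega> \<in> space Gauss. real i / real (Suc j) \<in> {0..real n} \<and> x < h \<omega> (real i / real (Suc j))} \<in> sets Gauss" for i j
  proof (cases "real i / real (Suc j) \<in> {0..real n}")
    case True
    have "{\<omega> \<in> space Gauss. x < h \<omega> (real i / real (Suc j))} \<in> sets Gauss"
      using hm[OF True] by measurable
    then show ?thesis using True by simp
  qed simp
  show meas: "{\<omega> \<in> space Gauss. x < Delta n z B S \<omega>} \<in> sets Gauss"
    unfolding iff by (intro sets.sets_Collect_countable_Ex m)
  have "emeasure Gauss {\<omega> \<in> space Gauss. x < Delta n z B S \<omega>} = (\<integral>\<^sup>+\<omega>. indicator {\<omega> \<in> space Gauss. x < Delta n z B S \<omega>} \<omega> \<partial>Gauss)"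
    using meas by simp
  also have "\<dots> \<le> (\<integral>\<^sup>+\<omega>. ennreal (exp (- a * x)) * ennreal (exp (a * R \<omega>)) \<partial>Gauss)"
  proof (intro nn_integral_mono)
    fix \<omega>
    have "1 \<le> exp (- a * x) * exp (a * R \<omega>)" if "x < Delta n z B S \<omega>"
    proof -
      have "a * x \<le> a * R \<omega>" using that DR[of \<omega>] a by (intro mult_left_mono) auto
      then have "0 \<le> - a * x + a * R \<omega>" by simp
      then have "1 \<le> exp (- a * x + a * R \<omega>)" by (simp only: one_le_exp_iff)
      then show ?thesis by (simp only: exp_add)
    qed
    then show "indicator {\<omega> \<in> space Gauss. x < Delta n z B S \<omega>} \<omega> \<le> ennreal (exp (- a * x)) * ennreal (exp (a * R \<omega>))"
      by (auto simp: indicator_def simp flip: ennreal_mult)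
  qed
  also have "\<dots> = ennreal (exp (- a * x)) * (\<integral>\<^sup>+\<omega>. ennreal (exp (a * R \<omega>)) \<partial>Gauss)"
    by (rule nn_integral_cmult) measurable
  also have "\<dots> \<le> ennreal (exp (- a * x)) * ennreal (G * exp ((of_int z)\<^sup>2 / (16 * real n)))"
    by (intro mult_left_mono D(6)) simp
  also have "\<dots> = ennreal (exp (- a * x) * (G * exp ((of_int z)\<^sup>2 / (16 * real n))))"
    using G by (simp flip: ennreal_mult)
  finally show "measure Gauss {\<omega> \<in> space Gauss. x < Delta n z B S \<omega>} \<le> exp (- a * x) * (G * exp ((of_int z)\<^sup>2 / (16 * real n)))"
    using G by (subst (asm) Gauss.emeasure_eq_measure) (simp add: ennreal_le_iff)
qed

theorem theorem3:
  fixes b :: real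
  assumes "b > 0"
  shows "\<exists>c \<alpha> :: real. 0 < c \<and> 0 < \<alpha> \<and>
    (\<forall>n::nat. n \<ge> 1 \<longrightarrow>
      (\<exists>(M :: (nat \<Rightarrow> real) measure) (B :: real \<Rightarrow> (nat \<Rightarrow> real) \<Rightarrow> real)
         (S :: int \<Rightarrow> (nat \<Rightarrow> real) \<Rightarrow> nat \<Rightarrow> int).
         prob_space M \<and> brownian_bridge M B \<and>
         (\<forall>z\<in>L n. S z \<in> measurable M (count_space UNIV) \<and>
                   distr M (count_space UNIV) (S z) = measure_pmf (srw_cond_pmf n z)) \<and>
         (\<forall>z\<in>L n. \<forall>r::real. r > 0 \<longrightarrow>
            {\<omega> \<in> space M. Delta n z B (S z) \<omega> > r * c * ln (real n)} \<in> sets M \<and>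
            measure M {\<omega> \<in> space M. Delta n z B (S z) \<omega> > r * c * ln (real n)}
              \<le> c * real n powr (\<alpha> - r) * exp (b * real_of_int z ^ 2 / real n))))"
proof -
  obtain B0 R0 a0 G0 where B0: "gaussian_bridge B0" "R0 \<in> borel_measurable Gauss"
    "\<And>\<omega> t. t \<in> {0..1} \<Longrightarrow> \<bar>B0 t \<omega>\<bar> \<le> R0 \<omega>" "\<And>\<omega>. 0 \<le> R0 \<omega>"
    and a0: "0 < a0" and G0: "(\<integral>\<^sup>+\<omega>. ennreal (exp (a0 * R0 \<omega>)) \<partial>Gauss) \<le> ennreal G0"
    using exists_gaussian_bridge by metis
  define a where "a = min a0 (1 / 100663296)"
  have a: "0 < a" "a \<le> a0" "a \<le> 1 / 100663296" using a0 by (auto simp: a_def)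
  \<comment> \<open>At least 1, so that powers of \<open>G\<close> with exponent at most 1 stay
    below \<open>G\<close>.\<close>
  define G where "G = max G0 1"
  have G1: "1 \<le> G" by (simp add: G_def)
  have "ennreal G0 \<le> ennreal G" by (intro ennreal_leI) (simp add: G_def)
  then have C1: "coupled a 1 G"
    using coupled_1[OF B0 order_trans[OF G0]] G1 a by simp
  define \<beta> where "\<beta> = log 2 (16 * exp (4 :: real))"
  have \<beta>: "2 powr \<beta> = 16 * exp (4 :: real)" by (simp add: \<beta>_def)
  have \<beta>0: "0 < \<beta>"
  proof -
    have "1 < exp (4 :: real)" by simp
    then have "1 < 16 * exp (4 :: real)" by linarith
    then show ?thesis unfolding \<beta>_def by simp
  qed
  \<comment> \<open>The exponent to which the Markov bound is raised: it turns the rate 1/16 into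
    \<open>\<theta> / 16\<close>, which is at most \<open>b\<close>.\<close>
  define \<theta> where "\<theta> = min 1 (16 * b)"
  have \<theta>: "0 < \<theta>" "\<theta> \<le> 1" "\<theta> / 16 \<le> b" using assms by (auto simp: \<theta>_def)
  \<comment> \<open>The second entry gives \<open>\<theta> * a * c \<ge> 1\<close>, so that after
    raising to the power \<open>\<theta>\<close> the factor \<open>exp (- a * r * c * ln n)\<close>
    is at most \<open>n powr (- r)\<close>.\<close>
  define c where "c = max G (1 / (\<theta> * a))"
  have c: "0 < c" "G \<le> c" "1 / (\<theta> * a) \<le> c" using G1 by (auto simp: c_def)
  show ?thesis
  proof (rule exI[of _ c], rule exI[of _ \<beta>], intro conjI allI impI c(1) \<beta>0)
    fix n :: nat assume n: "n \<ge> 1"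
    then have n1: "1 \<le> real n" by simp
    have "coupled a n (G * real n powr \<beta>)"
      using a G1 C1 n \<beta> by (intro coupled_growth) auto
    then obtain B S R where B: "gaussian_bridge B"
      and S: "\<And>z. z \<in> L n \<Longrightarrow> coupling_at a n (G * real n powr \<beta>) B z (S z) (R z)"
      unfolding coupled_def by blast
    show "\<exists>(M :: (nat \<Rightarrow> real) measure) (B :: real \<Rightarrow> (nat \<Rightarrow> real) \<Rightarrow> real)
         (S :: int \<Rightarrow> (nat \<Rightarrow> real) \<Rightarrow> nat \<Rightarrow> int).
         prob_space M \<and> brownian_bridge M B \<and>
         (\<forall>z\<in>L n. S z \<in> measurable M (count_space UNIV) \<and>
                   distr M (count_space UNIV) (S z) = measure_pmf (srw_cond_pmf n z)) \<and>
         (\<forall>z\<in>L n. \<forall>r::real. r > 0 \<longrightarrow>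
            {\<omega> \<in> space M. Delta n z B (S z) \<omega> > r * c * ln (real n)} \<in> sets M \<and>
            measure M {\<omega> \<in> space M. Delta n z B (S z) \<omega> > r * c * ln (real n)}
              \<le> c * real n powr (\<beta> - r) * exp (b * real_of_int z ^ 2 / real n))"
    \<comment> \<open>Bridge and walks are read from the odd coordinates; coordinate 0 and the
      positive even ones are kept for extending the bridge to a Brownian motion.\<close>
    proof (intro exI[of _ Gauss] exI[of _ "\<lambda>t \<omega>. B t (odds \<omega>)"] exI[of _ "\<lambda>z \<omega>. S z (odds \<omega>)"] conjI ballI allI impI)
      show "prob_space Gauss" by (rule Gauss.prob_space_axioms)
      show "brownian_bridge Gauss (\<lambda>t \<omega>. B t (odds \<omega>))" by (rule brownian_bridge_of_gaussian_bridge[OF B])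
      fix z assume z: "z \<in> L n"
      note D = coupling_atD[OF S[OF z]]
      show "(\<lambda>\<omega>. S z (odds \<omega>)) \<in> measurable Gauss (count_space UNIV)"
        by (rule measurable_compose[OF measurable_odds D(1)])
      have "distr (distr Gauss Gauss odds) (count_space UNIV) (S z) = distr Gauss (count_space UNIV) (S z \<circ> odds)"
        by (rule distr_distr[OF D(1) measurable_odds])
      then show "distr Gauss (count_space UNIV) (\<lambda>\<omega>. S z (odds \<omega>)) = measure_pmf (srw_cond_pmf n z)"
        unfolding distr_odds D(3) by (simp add: comp_def)
    next
      fix z r assume z: "z \<in> L n" and r: "(0 :: real) < r"
      define x where "x = r * c * ln (real n)"
      let ?E = "{\<omega> \<in> space Gauss. x < Delta n z B (S z) \<omega>}"
      have G0': "0 \<le> G * real n powr \<beta>" using G1 by simp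
      note tail = Delta_tail[OF n B S[OF z] a(1) G0', of x]
      have eq: "{\<omega> \<in> space Gauss. x < Delta n z (\<lambda>t \<omega>. B t (odds \<omega>)) (\<lambda>\<omega>. S z (odds \<omega>)) \<omega>} = odds -` ?E \<inter> space Gauss"
        by (auto simp: Delta_def)
      show "{\<omega> \<in> space Gauss. r * c * ln (real n) < Delta n z (\<lambda>t \<omega>. B t (odds \<omega>)) (\<lambda>\<omega>. S z (odds \<omega>)) \<omega>} \<in> sets Gauss"
        unfolding x_def[symmetric] eq by (rule measurable_sets[OF measurable_odds tail(1)])
      have "measure Gauss (odds -` ?E \<inter> space Gauss) = measure (distr Gauss Gauss odds) ?E"
        by (rule measure_distr[OF measurable_odds tail(1), symmetric])
      then have P: "measure Gauss (odds -` ?E \<inter> space Gauss) = measure Gauss ?E" by (simp only: distr_odds)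
      define A where "A = exp (- a * x) * (G * real n powr \<beta> * exp ((of_int z)\<^sup>2 / (16 * real n)))"
      have A: "measure Gauss ?E \<le> A" unfolding A_def by (rule tail(2))
      have A0: "0 < A" unfolding A_def using G1 n1 by simp
      \<comment> \<open>For \<open>A \<le> 1\<close> lowering the exponent increases the power; for
        \<open>A > 1\<close> the power exceeds every probability.\<close>
      have le_powr: "measure Gauss ?E \<le> A powr \<theta>"
      proof (cases "A \<le> 1")
        case True
        have "A powr 1 \<le> A powr \<theta>" using A0 True \<theta> by (intro powr_mono') auto
        then show ?thesis using A A0 by simp
      next
        case False
        then have "1 \<le> A powr \<theta>" using \<theta> by (intro ge_one_powr_ge_zero) auto
        then show ?thesis using Gauss.prob_le_1[of ?E] by linarith
      qed
      have "A powr \<theta> = exp (- a * x) powr \<theta> * (G powr \<theta> * (real n powr \<beta>) powr \<theta> * exp ((of_int z)\<^sup>2 / (16 * real n)) powr \<theta>)"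
        unfolding A_def using G1 by (simp add: powr_mult)
      also have "\<dots> \<le> real n powr (- r) * (c * real n powr \<beta> * exp (b * (of_int z)\<^sup>2 / real n))"
      proof (intro mult_mono)
        have "r * ln (real n) * 1 \<le> r * ln (real n) * (c * (\<theta> * a))"
          using r n1 c(3) \<theta> a by (intro mult_left_mono) (auto simp: divide_le_eq)
        then have "\<theta> * (- a * x) \<le> - r * ln (real n)" unfolding x_def by (simp add: mult_ac)
        then show "exp (- a * x) powr \<theta> \<le> real n powr (- r)"
          using n1 by (simp add: powr_def)
        have "G powr \<theta> \<le> G powr 1" using G1 \<theta> by (intro powr_mono) auto
        then show "G powr \<theta> \<le> c" using c(2) G1 by simp
        have "(real n powr \<beta>) powr \<theta> = real n powr (\<beta> * \<theta>)" by (rule powr_powr)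
        also have "\<dots> \<le> real n powr \<beta>" using n1 \<beta>0 \<theta> by (intro powr_mono) (auto simp: mult_left_le)
        finally show "(real n powr \<beta>) powr \<theta> \<le> real n powr \<beta>" .
        have "(\<theta> / 16) * ((of_int z)\<^sup>2 / real n) \<le> b * ((of_int z)\<^sup>2 / real n)"
          using \<theta>(3) by (intro mult_right_mono) auto
        then show "exp ((of_int z)\<^sup>2 / (16 * real n)) powr \<theta> \<le> exp (b * (of_int z)\<^sup>2 / real n)"
          by (simp add: powr_def)
      qed (use c G1 in auto)
      also have "\<dots> = c * real n powr (\<beta> - r) * exp (b * real_of_int z ^ 2 / real n)"
      proof -
        have "real n powr (- r) * real n powr \<beta> = real n powr (\<beta> - r)" by (simp flip: powr_add)
        then show ?thesis by (metis mult.assoc mult.left_commute)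
      qed
      finally show "measure Gauss {\<omega> \<in> space Gauss. r * c * ln (real n) < Delta n z (\<lambda>t \<omega>. B t (odds \<omega>)) (\<lambda>\<omega>. S z (odds \<omega>)) \<omega>}
        \<le> c * real n powr (\<beta> - r) * exp (b * real_of_int z ^ 2 / real n)"
        unfolding x_def[symmetric] eq P using le_powr by linarith
    qed
  qed
qed

end
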